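(* Let $N\ge 2$ and let $V\subset\mathbb{R}^{N-1}$ be the Sierpinski gasket with intrinsic boundary $V_0$ and normalized Hausdorff measure $\mu$. Let $f\colon V\times\mathbb{R}\to\mathbb{R}$ be a continuous function and let $F\colon V\times\mathbb{R}\to\mathbb{R}$ be $F(x,t)=\int_0^t f(x,\xi)\,d\xi$. Assume that: (1) there exist $\alpha\in[0,2[$, $a\in L^1(V,\mu)$ and $m\ge 0$ such that $F(x,t)\le m(a(x)+|t|^\alpha)$ for all $(x,t)\in V\times\mathbb{R}$; (2) there exist $t_0>0$, $M\ge 0$ and $\beta>2$ such that $F(x,t)\le M|t|^\beta$ for all $(x,t)\in V\times[-t_0,t_0]$; (3) there exists $t_1\in\mathbb{R}\setminus\{0\}$ such that for all $x\in V$ and for all $t$ between $0$ and $t_1$ we have $F(x,t_1)>0$ and $F(x,t)\ge 0$. Then there exists a real number $\Lambda\ge 0$ such that, for each compact interval $[\lambda_1,\lambda_2]\subset\,]\Lambda,\infty[$, there exists a positive real number $r$ with the following property: for every $\lambda\in[\lambda_1,\lambda_2]$ and every continuous function $g\colon V\times\mathbb{R}\to\mathbb{R}$ there exists $\delta>0$ such that, for each $\eta\in[0,\delta]$, the Dirichlet problem $$-\Delta u(x)=\lambda f(x,u(x))+\eta g(x,u(x))\ \ \forall x\in V\setminus V_0,\qquad u|_{V_0}=0,$$ has at least three (distinct) solutions $u\in H_0^1(V)$ whose norms $\|u\|$ are less than $r$.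
   Context: Sierpinski gasket: let $N\ge 2$ be a natural number and $p_1,\dots,p_N\in\mathbb{R}^{N-1}$ with $|p_i-p_j|=1$ for $i\ne j$ ($|\cdot|$ the Euclidean norm). Let $S_i(x)=\frac12x+\frac12p_i$ for $i=1,\dots,N$. The Sierpinski gasket $V\subset\mathbb{R}^{N-1}$ is the unique nonempty compact set with $V=\bigcup_{i=1}^N S_i(V)$. Put $V_0=\{p_1,\dots,p_N\}$ (the intrinsic boundary) and $V_m=\bigcup_{i=1}^N S_i(V_{m-1})$ for $m\ge1$; then $V=\overline{\bigcup_{m\ge0}V_m}$. Let $\mu$ be the restriction to $V$ of the $d$-dimensional Hausdorff measure, $d=\ln N/\ln 2$, normalized so that $\mu(V)=1$. The space $H_0^1(V)$: let $C_0(V)=\{u\in C(V): u|_{V_0}=0\}$. For $u\colon V\to\mathbb{R}$ and $m\in\mathbb{N}$ put $$W_m(u)=\left(\tfrac{N+2}{N}\right)^m\sum_{x,y\in V_m,\ |x-y|=2^{-m}}(u(x)-u(y))^2,\qquad W(u)=\lim_{m\to\infty}W_m(u)\in[0,\infty].$$ $H_0^1(V)=\{u\in C_0(V): W(u)<\infty\}$ is a real Hilbert space with norm $\|u\|=\sqrt{W(u)}$ and inner product $$\mathcal{W}(u,v)=\lim_{m\to\infty}\left(\tfrac{N+2}{N}\right)^m\sum_{x,y\in V_m,\ |x-y|=2^{-m}}(u(x)-u(y))(v(x)-v(y)).$$ Solutions: $\Delta$ is the weak Laplacian on $V$, the operator $\Delta\colon D\to L^2(V,\mu)$, $D\subset H_0^1(V)$,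 characterized by $-\mathcal{W}(u,v)=\int_V\Delta u\cdot v\,d\mu$ for $u\in D$, $v\in H_0^1(V)$. For continuous $h\colon V\times\mathbb{R}\to\mathbb{R}$, a solution (meaning weak solution) of the Dirichlet problem $-\Delta u(x)=h(x,u(x))$ on $V\setminus V_0$, $u|_{V_0}=0$, is a function $u\in H_0^1(V)$ with $\mathcal{W}(u,v)-\int_V h(x,u(x))v(x)\,d\mu=0$ for all $v\in H_0^1(V)$. *)

theory Defs
  imports "HOL-Analysis.Analysis"
begin

section \<open>Hausdorff measure\<close>

text \<open>
  The size \<open>\<delta>\<close> approximation uses countable covers (finite ones can be padded with empty sets).
  Boundedness is required because \<^const>\<open>diameter\<close> is unspecified on unbounded sets.
  Intended for \<open>s > 0\<close>: as \<open>0 powr 0 = 0\<close>, the case \<open>s = 0\<close> would not give counting measure.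
\<close>

definition hausdorff_pre :: "real \<Rightarrow> real \<Rightarrow> 'a::metric_space set \<Rightarrow> ennreal" where
  "hausdorff_pre s \<delta> A =
     (INF U \<in> {U :: nat \<Rightarrow> 'a set. (\<forall>i. bounded (U i) \<and> diameter (U i) \<le> \<delta>) \<and> A \<subseteq> (\<Union>i. U i)}.
        \<Sum>i. ennreal (diameter (U i) powr s))"

definition hausdorff_outer :: "real \<Rightarrow> 'a::metric_space set \<Rightarrow> ennreal" where
  "hausdorff_outer s A = (SUP \<delta> \<in> {0<..}. hausdorff_pre s \<delta> A)"

text \<open>The outer measure restricted to its Caratheodory-measurable sets.\<close>

definition hausdorff_measure :: "real \<Rightarrow> 'a::metric_space measure" where
  "hausdorff_measure s =
     measure_of UNIV (lambda_system UNIV UNIV (hausdorff_outer s)) (hausdorff_outer s)"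


section \<open>The Sierpinski gasket\<close>

text \<open>
  Throughout, the corner points are \<open>p 1, \<dots>, p N\<close>; the values of \<open>p\<close> at other indices are irrelevant.
\<close>

definition gasket_map :: "(nat \<Rightarrow> 'a::real_vector) \<Rightarrow> nat \<Rightarrow> 'a \<Rightarrow> 'a" where
  "gasket_map p i x = (1/2) *\<^sub>R x + (1/2) *\<^sub>R p i"

definition gasket :: "nat \<Rightarrow> (nat \<Rightarrow> 'a::real_normed_vector) \<Rightarrow> 'a set" where
  "gasket N p = (THE V. compact V \<and> V \<noteq> {} \<and> V = (\<Union>i\<in>{1..N}. gasket_map p i ` V))"

primrec gasket_vertices :: "nat \<Rightarrow> (nat \<Rightarrow> 'a::real_vector) \<Rightarrow> nat \<Rightarrow> 'a set" where
  "gasket_vertices N p 0 = p ` {1..N}"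
| "gasket_vertices N p (Suc m) = (\<Union>i\<in>{1..N}. gasket_map p i ` gasket_vertices N p m)"

definition gasket_measure :: "nat \<Rightarrow> (nat \<Rightarrow> 'a::real_normed_vector) \<Rightarrow> 'a measure" where
  "gasket_measure N p =
     (let H = hausdorff_measure (ln (real N) / ln 2)
      in scale_measure (1 / emeasure H (gasket N p)) (restrict_space H (gasket N p)))"


section \<open>The energy form and the space \<open>H\<^sub>0\<^sup>1(V)\<close>\<close>

text \<open>
  The sums range over ordered pairs, and over all pairs of points of \<open>V\<^sub>m\<close> at distance \<open>2\<^sup>-\<^sup>m\<close>.
  For \<open>N \<ge> 3\<close> and \<open>m \<ge> 2\<close> the latter includes pairs whose points do not lie in a common
  \<open>m\<close>-cell of the gasket.
\<close>

definition gasket_edges :: "nat \<Rightarrow> (nat \<Rightarrow> 'a::real_normed_vector) \<Rightarrow> nat \<Rightarrow> ('a \<times> 'a) set" where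
  "gasket_edges N p m =
     {(x, y). x \<in> gasket_vertices N p m \<and> y \<in> gasket_vertices N p m \<and> norm (x - y) = (1/2) ^ m}"

definition gasket_energy_level ::
    "nat \<Rightarrow> (nat \<Rightarrow> 'a::real_normed_vector) \<Rightarrow> nat \<Rightarrow> ('a \<Rightarrow> real) \<Rightarrow> real" where
  "gasket_energy_level N p m u =
     ((real N + 2) / real N) ^ m * (\<Sum>(x, y) \<in> gasket_edges N p m. (u x - u y)\<^sup>2)"

definition gasket_energy :: "nat \<Rightarrow> (nat \<Rightarrow> 'a::real_normed_vector) \<Rightarrow> ('a \<Rightarrow> real) \<Rightarrow> ennreal" where
  "gasket_energy N p u = lim (\<lambda>m. ennreal (gasket_energy_level N p m u))"

definition gasket_inner ::
    "nat \<Rightarrow> (nat \<Rightarrow> 'a::real_normed_vector) \<Rightarrow> ('a \<Rightarrow> real) \<Rightarrow> ('a \<Rightarrow> real) \<Rightarrow> real" where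
  "gasket_inner N p u v =
     lim (\<lambda>m. ((real N + 2) / real N) ^ m *
              (\<Sum>(x, y) \<in> gasket_edges N p m. (u x - u y) * (v x - v y)))"

text \<open>
  A function on \<open>V\<close> is represented by any total function extending it; hence two elements of
  \<open>gasket_H01\<close> are to be identified when they agree on \<open>V\<close>.
\<close>

definition gasket_C0 :: "nat \<Rightarrow> (nat \<Rightarrow> 'a::real_normed_vector) \<Rightarrow> ('a \<Rightarrow> real) set" where
  "gasket_C0 N p =
     {u. continuous_on (gasket N p) u \<and> (\<forall>x \<in> gasket_vertices N p 0. u x = 0)}"

definition gasket_H01 :: "nat \<Rightarrow> (nat \<Rightarrow> 'a::real_normed_vector) \<Rightarrow> ('a \<Rightarrow> real) set" where
  "gasket_H01 N p = {u \<in> gasket_C0 N p. gasket_energy N p u < \<infinity>}"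

definition gasket_norm :: "nat \<Rightarrow> (nat \<Rightarrow> 'a::real_normed_vector) \<Rightarrow> ('a \<Rightarrow> real) \<Rightarrow> real" where
  "gasket_norm N p u = sqrt (enn2real (gasket_energy N p u))"


section \<open>Weak solutions of the Dirichlet problem \<open>-\<Delta>u(x) = h(x, u(x))\<close>\<close>

definition gasket_solution ::
    "nat \<Rightarrow> (nat \<Rightarrow> 'a::real_normed_vector) \<Rightarrow> ('a \<Rightarrow> real \<Rightarrow> real) \<Rightarrow> ('a \<Rightarrow> real) \<Rightarrow> bool" where
  "gasket_solution N p h u \<longleftrightarrow>
     u \<in> gasket_H01 N p \<and>
     (\<forall>v \<in> gasket_H01 N p.
        gasket_inner N p u v - (LINT x|gasket_measure N p. h x (u x) * v x) = 0)"

text \<open>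
  The power \<open>\<bar>t\<bar>\<^sup>\<alpha>\<close> for \<open>\<alpha> \<ge> 0\<close> with the usual convention \<open>0\<^sup>0 = 1\<close>, whereas \<open>0 powr 0 = 0\<close>.
\<close>

definition abs_pow :: "real \<Rightarrow> real \<Rightarrow> real" where
  "abs_pow t \<alpha> = (if \<alpha> = 0 then 1 else \<bar>t\<bar> powr \<alpha>)"

end

theory Submission
  imports Defs "HOL-Complex_Analysis.Great_Picard"
begin

text \<open>
  Finite energy forces a uniform modulus of continuity, so a bounded sequence in \<open>H\<^sub>0\<^sup>1(V)\<close> has a
  uniformly convergent subsequence, along which the energy is lower semicontinuous. This is the only
  compactness used: it yields the Riesz representation, minimisers on balls and limits of
  Palais--Smale sequences. The hypotheses make the functional \<open>W(u)/2 - \<lambda> \<integral>F(x, u)\<close> coercive, positive on a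
  small sphere and negative at some \<open>w\<close>; after \<open>g\<close> is truncated outside a ball that depends only on
  \<open>\<lambda>\<^sub>1\<close> and \<open>\<lambda>\<^sub>2\<close>, a small multiple of its primitive does not change this. The three solutions are a minimiser over
  the small ball, a global minimiser and a mountain pass point; their levels differ.

  The level energies of the paper also count pairs of vertices from different cells. On a harmonic
  function these extra pairs contribute a multiple \<open>c\<^sub>m\<close> of the energy, where \<open>c\<^sub>m\<close> is independent of
  the function, increasing and bounded. Hence, by approximation with harmonic splines, the limit
  \<open>W\<close> exists and is a constant multiple of the usual self-similar energy, which is the supremum of a
  monotone sequence.
\<close>

section \<open>Critical points in a space of continuous functions\<close>

text \<open>The statement rests on descriptions: \<open>gasket\<close> is a \<open>THE\<close>,
  energy and inner product are a \<open>lim\<close>, and the measure is divided by the Hausdorff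
  measure of the gasket. So a unique attractor, convergence of both limits, and a positive finite
  Hausdorff measure must be established before any analysis. The extra pairs are the obstacle to
  convergence, since with them monotonicity in \<open>m\<close> is not evident. In its place stands
  the comparison \<open>EN m u u \<le> WN m u u \<le> 5 * EN m u u\<close>, which bounds the
  constants c_m and carries convergence from splines to all functions of finite energy. Beyond
  integrability of continuous functions, the analysis uses that every cell has positive measure:
  \<open>w\<close> is \<open>t\<^sub>1\<close> times a function known to be 1 only on some small
  cell. The threshold is half the squared norm of \<open>w\<close> divided by the integral of
  \<open>F x (w x)\<close>; for \<lambda> above it the unperturbed functional is negative at
  \<open>w\<close>. The radius is found before \<open>g\<close> is known, so all bounds reserve a
  fixed allowance for the perturbation, and \<delta> is chosen last to keep the perturbation within
  it.\<close>

definition lin :: "real \<Rightarrow> ('a \<Rightarrow> real) \<Rightarrow> real \<Rightarrow> ('a \<Rightarrow> real) \<Rightarrow> 'a \<Rightarrow> real" where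
  "lin a u b v = (\<lambda>x. a * u x + b * v x)"

text \<open>First-order condition at a minimum: at a small \<open>t\<close> of sign opposite to
  \<open>a\<close> the linear term would win.\<close>

lemma nonneg_quadratic_imp_zero:
  fixes a b :: real
  assumes "\<And>t. 0 \<le> t * a + t\<^sup>2 * b" shows "a = 0"
proof (rule ccontr)
  assume "a \<noteq> 0"
  \<comment> \<open>A positive upper bound for \<open>b\<close>, valid for either sign of
    \<open>b\<close>.\<close>
  define k where "k = \<bar>b\<bar> + 1"
  have "k > 0" by (simp add: k_def)
  have "0 \<le> (- a / (2*k)) * a + (- a / (2*k))\<^sup>2 * b" by (rule assms)
  also have "\<dots> \<le> (- a / (2*k)) * a + (- a / (2*k))\<^sup>2 * k"
    by (intro add_left_mono mult_left_mono) (auto simp: k_def)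
  also have "\<dots> = - (a\<^sup>2 / (4 * k))"
    using \<open>k > 0\<close> by (simp add: field_simps power2_eq_square)
  finally show False using \<open>a \<noteq> 0\<close> \<open>k > 0\<close> by (simp add: divide_le_0_iff)
qed

text \<open>\<open>W_compact\<close> plays the part of completeness and of weak compactness. Its
  last clause is lower semicontinuity written without a limit: every eventual bound of the energies
  also bounds the energy of the limit. Elements of \<open>H\<close> are total functions that matter
  only on \<open>V\<close>, hence \<open>W_cong\<close>; definiteness of \<open>W\<close> on
  \<open>V\<close> comes from \<open>sup_bound\<close>. Combinations are the constant
  \<open>lin\<close>, so that linearity can serve as a simp rule.\<close>

locale energy_space =
  fixes V :: "'a::metric_space set" and M :: "'a measure"
    and H :: "('a \<Rightarrow> real) set" and W :: "('a \<Rightarrow> real) \<Rightarrow> ('a \<Rightarrow> real) \<Rightarrow> real" and C :: real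
  assumes compact_V: "compact V"
    and finite_M: "finite_measure M" and space_M: "space M = V" and measure_V: "measure M V = 1"
    and cont_measurable: "\<And>\<phi>::'a \<Rightarrow> real. continuous_on V \<phi> \<Longrightarrow> \<phi> \<in> borel_measurable M"
    and H_cont: "\<And>u. u \<in> H \<Longrightarrow> continuous_on V u"
    and H_zero: "(\<lambda>x. 0) \<in> H"
    and H_lin [intro, simp]: "\<And>u v a b. u \<in> H \<Longrightarrow> v \<in> H \<Longrightarrow> lin a u b v \<in> H"
    and W_lin [simp]: "\<And>u v w a b. u \<in> H \<Longrightarrow> v \<in> H \<Longrightarrow> w \<in> H \<Longrightarrow> W (lin a u b v) w = a * W u w + b * W v w"
    and W_sym: "\<And>u v. u \<in> H \<Longrightarrow> v \<in> H \<Longrightarrow> W u v = W v u"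
    and W_nonneg: "\<And>u. u \<in> H \<Longrightarrow> 0 \<le> W u u"
    and W_cong: "\<And>u v. u \<in> H \<Longrightarrow> v \<in> H \<Longrightarrow> (\<And>x. x \<in> V \<Longrightarrow> u x = v x) \<Longrightarrow> W u u = W v v"
    and C_pos: "0 < C"
    and sup_bound: "\<And>u x. u \<in> H \<Longrightarrow> x \<in> V \<Longrightarrow> \<bar>u x\<bar> \<le> C * sqrt (W u u)"
    and W_compact: "\<And>U B. (\<And>n. U n \<in> H) \<Longrightarrow> (\<And>n. W (U n) (U n) \<le> B) \<Longrightarrow>
       \<exists>k u. strict_mono (k :: nat \<Rightarrow> nat) \<and> u \<in> H \<and> uniform_limit V (\<lambda>n. U (k n)) u sequentially \<and>
         (\<forall>b. (\<forall>\<^sub>F n in sequentially. W (U (k n)) (U (k n)) \<le> b) \<longrightarrow> W u u \<le> b)"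
begin

section \<open>Norm, distance, integration and minimisation in the energy space\<close>

lemma W_lin_right [simp]:
  "u \<in> H \<Longrightarrow> v \<in> H \<Longrightarrow> w \<in> H \<Longrightarrow> W w (lin a u b v) = a * W w u + b * W w v"
  by (metis H_lin W_lin W_sym)

definition nrm :: "('a \<Rightarrow> real) \<Rightarrow> real" where "nrm u = sqrt (W u u)"

text \<open>A pseudometric: \<open>dst u v = 0\<close> means agreement on \<open>V\<close>, by
  \<open>sup_bound\<close> and \<open>W_cong\<close>.\<close>

definition dst :: "('a \<Rightarrow> real) \<Rightarrow> ('a \<Rightarrow> real) \<Rightarrow> real" where "dst u v = nrm (lin 1 u (-1) v)"

lemma nrm_nonneg [simp]: "u \<in> H \<Longrightarrow> 0 \<le> nrm u"
  by (simp add: nrm_def W_nonneg)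

lemma nrm_sq: "u \<in> H \<Longrightarrow> (nrm u)\<^sup>2 = W u u"
  by (simp add: nrm_def W_nonneg)

lemma sup_bound_nrm: "u \<in> H \<Longrightarrow> x \<in> V \<Longrightarrow> \<bar>u x\<bar> \<le> C * nrm u"
  using sup_bound by (simp add: nrm_def)

lemma Cauchy_Schwarz: assumes "u \<in> H" "v \<in> H" shows "\<bar>W u v\<bar> \<le> nrm u * nrm v"
proof -
  have q: "0 \<le> W v v * t\<^sup>2 + 2 * W u v * t + W u u" for t
    using W_nonneg[of "lin 1 u t v"] assms W_sym[of u v] by (simp add: power2_eq_square algebra_simps)
  have "(W u v)\<^sup>2 \<le> W u u * W v v"
  proof (cases "W v v = 0")
    case True
    have "W u v = 0"
    proof (rule ccontr)
      assume n: "W u v \<noteq> 0"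
      \<comment> \<open>The quadratic has become affine in \<open>t\<close>; at this
        \<open>t\<close> its value is -1.\<close>
      show False using q[of "- (W u u + 1) / (2 * W u v)"] n True by simp
    qed
    then show ?thesis using True by simp
  next
    case False
    then have p: "W v v > 0" using W_nonneg[OF assms(2)] by simp
    \<comment> \<open>\<open>t\<close> is the vertex of the parabola; the factor
      \<open>W v v\<close> clears the denominator.\<close>
    have "0 \<le> W v v * (W v v * (- W u v / W v v)\<^sup>2 + 2 * W u v * (- W u v / W v v) + W u u)"
      by (rule mult_nonneg_nonneg[OF less_imp_le[OF p] q])
    also have "\<dots> = W u u * W v v - (W u v)\<^sup>2"
      using p by (simp add: field_simps power2_eq_square)
    finally show ?thesis by simp
  qed
  then have "sqrt ((W u v)\<^sup>2) \<le> sqrt (W u u * W v v)" by (rule real_sqrt_le_mono)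
  then show ?thesis by (simp add: nrm_def real_sqrt_mult)
qed

lemma nrm_lin: assumes "u \<in> H" "v \<in> H" shows "nrm (lin a u b v) \<le> \<bar>a\<bar> * nrm u + \<bar>b\<bar> * nrm v"
proof -
  have "(nrm (lin a u b v))\<^sup>2 = a\<^sup>2 * W u u + b\<^sup>2 * W v v + 2 * (a * b * W u v)"
    unfolding nrm_sq[OF H_lin[OF assms]]
    using assms W_sym[of u v] by (simp add: power2_eq_square algebra_simps)
  also have "\<dots> \<le> a\<^sup>2 * W u u + b\<^sup>2 * W v v + 2 * (\<bar>a\<bar> * \<bar>b\<bar> * (nrm u * nrm v))"
  proof -
    have "a * b * W u v \<le> \<bar>a * b * W u v\<bar>" by simp
    also have "\<dots> = \<bar>a\<bar> * \<bar>b\<bar> * \<bar>W u v\<bar>" by (simp add: abs_mult)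
    also have "\<dots> \<le> \<bar>a\<bar> * \<bar>b\<bar> * (nrm u * nrm v)"
      using Cauchy_Schwarz[OF assms] by (intro mult_left_mono) auto
    finally show ?thesis by simp
  qed
  also have "\<dots> = (\<bar>a\<bar> * nrm u + \<bar>b\<bar> * nrm v)\<^sup>2"
    using nrm_sq[OF assms(1)] nrm_sq[OF assms(2)] by (simp add: power2_sum power_mult_distrib algebra_simps)
  finally show ?thesis by (rule power2_le_imp_le) (use assms in simp)
qed

lemma dst_nonneg [simp]: "u \<in> H \<Longrightarrow> v \<in> H \<Longrightarrow> 0 \<le> dst u v"
  by (simp add: dst_def)

lemma nrm_triangle: assumes "u \<in> H" "v \<in> H" shows "\<bar>nrm u - nrm v\<bar> \<le> dst u v"
proof -
  have a: "u = lin 1 v 1 (lin 1 u (-1) v)" and b: "v = lin 1 u (-1) (lin 1 u (-1) v)"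
    by (auto simp: lin_def)
  have "nrm u \<le> nrm v + dst u v" using nrm_lin[of v "lin 1 u (-1) v" 1 1] assms a by (simp add: dst_def)
  moreover have "nrm v \<le> nrm u + dst u v"
    using nrm_lin[of u "lin 1 u (-1) v" 1 "-1"] assms b by (simp add: dst_def)
  ultimately show ?thesis by simp
qed

lemma dst_triangle: assumes "u \<in> H" "v \<in> H" "w \<in> H" shows "dst u w \<le> dst u v + dst v w"
proof -
  have "lin 1 u (-1) w = lin 1 (lin 1 u (-1) v) 1 (lin 1 v (-1) w)" by (auto simp: lin_def)
  then show ?thesis using nrm_lin[of "lin 1 u (-1) v" "lin 1 v (-1) w" 1 1] assms by (simp add: dst_def)
qed

lemma sup_dst: "u \<in> H \<Longrightarrow> v \<in> H \<Longrightarrow> x \<in> V \<Longrightarrow> \<bar>u x - v x\<bar> \<le> C * dst u v"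
  using sup_bound_nrm[OF H_lin, of u v x 1 "-1"] by (simp add: dst_def) (simp add: lin_def)

lemma integrable_cont: assumes "continuous_on V (\<phi>::'a \<Rightarrow> real)" shows "integrable M \<phi>"
proof -
  interpret finite_measure M by (rule finite_M)
  have "bounded (\<phi> ` V)" using assms compact_V compact_continuous_image compact_imp_bounded by blast
  then obtain B where "\<And>x. x \<in> V \<Longrightarrow> norm (\<phi> x) \<le> B" by (auto simp: bounded_iff)
  then show ?thesis
    by (intro integrable_const_bound[of _ B] cont_measurable assms) (auto simp: space_M)
qed

lemma integral_bound: assumes "continuous_on V (\<phi>::'a \<Rightarrow> real)" "\<And>x. x \<in> V \<Longrightarrow> \<bar>\<phi> x\<bar> \<le> B"
  shows "\<bar>\<integral>x. \<phi> x \<partial>M\<bar> \<le> B"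
proof -
  interpret finite_measure M by (rule finite_M)
  have "\<bar>\<integral>x. \<phi> x \<partial>M\<bar> \<le> (\<integral>x. \<bar>\<phi> x\<bar> \<partial>M)" by (rule integral_abs_bound)
  also have "\<dots> \<le> (\<integral>x. B \<partial>M)"
    using assms by (intro integral_mono integrable_cont continuous_intros) (auto simp: space_M)
  also have "\<dots> = B" by (simp add: space_M measure_V)
  finally show ?thesis .
qed

lemma integral_le: assumes "continuous_on V (\<phi>::'a \<Rightarrow> real)" "\<And>x. x \<in> V \<Longrightarrow> \<phi> x \<le> B"
  shows "(\<integral>x. \<phi> x \<partial>M) \<le> B"
proof -
  interpret finite_measure M by (rule finite_M)
  have "(\<integral>x. \<phi> x \<partial>M) \<le> (\<integral>x. B \<partial>M)"
    using assms by (intro integral_mono integrable_cont continuous_intros) (auto simp: space_M)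
  also have "\<dots> = B" by (simp add: space_M measure_V)
  finally show ?thesis .
qed

lemma W_zero: "W (\<lambda>x. 0) (\<lambda>x. 0) = 0"
  using W_lin[of "\<lambda>x. 0" "\<lambda>x. 0" "\<lambda>x. 0" 0 0] H_zero by (simp add: lin_def)

lemma bounded_subsequence:
  assumes "\<And>n. U n \<in> H" "\<And>n. W (U n) (U n) \<le> B"
  obtains k u where "strict_mono (k :: nat \<Rightarrow> nat)" "u \<in> H" "uniform_limit V (\<lambda>n. U (k n)) u sequentially"
    "\<And>b. (\<forall>\<^sub>F n in sequentially. W (U (k n)) (U (k n)) \<le> b) \<Longrightarrow> W u u \<le> b"
  using W_compact[of U B, OF assms] by (elim exE conjE) (rule that, auto)

text \<open>Direct method: along the subsequence from \<open>W_compact\<close>, \<open>J\<close>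
  converges because the convergence is uniform, and the quadratic part is semicontinuous. Stated for
  arbitrary \<open>J\<close>, since it serves the Riesz representation as well as the nonlinear
  functional.\<close>

lemma ball_minimizer:
  assumes b: "0 \<le> b"
    and J: "\<And>U u. (\<And>n. U n \<in> H) \<Longrightarrow> u \<in> H \<Longrightarrow> uniform_limit V U u sequentially \<Longrightarrow> (\<lambda>n. J (U n)) \<longlonglongrightarrow> (J u :: real)"
    and K: "\<And>u. u \<in> H \<Longrightarrow> W u u \<le> b \<Longrightarrow> J u \<le> K"
  shows "\<exists>u\<in>H. W u u \<le> b \<and> (\<forall>v\<in>H. W v v \<le> b \<longrightarrow> W u u / 2 - J u \<le> W v v / 2 - J v)"
proof -
  define E where "E u = W u u / 2 - J u" for u
  define D where "D = {u \<in> H. W u u \<le> b}"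
  then have ne: "D \<noteq> {}" using H_zero W_zero b by (auto simp: D_def)
  have lb: "bdd_below (E ` D)"
  proof (rule bdd_belowI2)
    fix u assume "u \<in> D"
    then show "-K \<le> E u" using K[of u] W_nonneg[of u] by (auto simp: D_def E_def)
  qed
  define m where "m = (INF u\<in>D. E u)"
  have "\<exists>u\<in>D. E u < m + 1 / real (Suc n)" for n
    using cINF_less_iff[OF ne lb, of "m + 1 / real (Suc n)"] by (simp add: m_def)
  then obtain U where U: "\<And>n. U n \<in> D" "\<And>n. E (U n) < m + 1 / real (Suc n)" by metis
  have "\<And>n. U n \<in> H" "\<And>n. W (U n) (U n) \<le> b" using U by (auto simp: D_def)
  from bounded_subsequence[of U b, OF this] obtain k u where k: "strict_mono (k :: nat \<Rightarrow> nat)" and u: "u \<in> H"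
    and lim: "uniform_limit V (\<lambda>n. U (k n)) u sequentially"
    and lsc: "\<And>b. (\<forall>\<^sub>F n in sequentially. W (U (k n)) (U (k n)) \<le> b) \<Longrightarrow> W u u \<le> b" by metis
  have Jl: "(\<lambda>n. J (U (k n))) \<longlonglongrightarrow> J u" using U u lim by (intro J) (auto simp: D_def)
  have "W u u \<le> b" using U by (intro lsc) (auto simp: D_def)
  \<comment> \<open>The energies of the subsequence are eventually at most
    \<open>2 * (m + J u + e)\<close>. Semicontinuity passes this bound to \<open>u\<close>, and
    \<open>e\<close> is arbitrary.\<close>
  have "E u \<le> m"
  proof (rule field_le_epsilon)
    fix e :: real assume e: "0 < e"
    have "(\<lambda>n. 2 * (m + 1 / real (Suc (k n)) + J (U (k n)))) \<longlonglongrightarrow> 2 * (m + 0 + J u)"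
      using LIMSEQ_subseq_LIMSEQ[OF LIMSEQ_inverse_real_of_nat k]
      by (intro tendsto_intros Jl) (simp add: o_def inverse_eq_divide)
    moreover have "2 * (m + 0 + J u) < 2 * (m + J u + e)" using e by simp
    ultimately have "\<forall>\<^sub>F n in sequentially. 2 * (m + 1 / real (Suc (k n)) + J (U (k n))) < 2 * (m + J u + e)"
      by (rule order_tendstoD(2))
    then have "\<forall>\<^sub>F n in sequentially. W (U (k n)) (U (k n)) \<le> 2 * (m + J u + e)"
    proof eventually_elim
      case (elim n)
      then show ?case using U(2)[of "k n"] by (simp add: E_def)
    qed
    from lsc[OF this] show "E u \<le> m + e" by (simp add: E_def)
  qed
  moreover have "m \<le> E v" if "v \<in> D" for v unfolding m_def by (rule cINF_lower[OF lb that])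
  ultimately have "\<forall>v\<in>D. E u \<le> E v" by fastforce
  then show ?thesis using u \<open>W u u \<le> b\<close> by (auto simp: D_def E_def)
qed

lemma integral_uniform_limit:
  fixes \<phi> :: "nat \<Rightarrow> 'a \<Rightarrow> real"
  assumes "\<And>n. continuous_on V (\<phi> n)" "uniform_limit V \<phi> \<psi> sequentially"
  shows "(\<lambda>n. \<integral>x. \<phi> n x \<partial>M) \<longlonglongrightarrow> (\<integral>x. \<psi> x \<partial>M)"
proof -
  have c: "continuous_on V \<psi>"
    by (rule uniform_limit_theorem[OF _ assms(2)]) (use assms(1) in auto)
  show ?thesis
  proof (rule LIMSEQ_I)
    fix e :: real assume "e > 0"
    then have "\<forall>\<^sub>F n in sequentially. \<forall>x\<in>V. dist (\<phi> n x) (\<psi> x) < e/2"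
      using uniform_limitD[OF assms(2), of "e/2"] by simp
    then obtain n0 where n0: "\<And>n x. n \<ge> n0 \<Longrightarrow> x \<in> V \<Longrightarrow> dist (\<phi> n x) (\<psi> x) < e/2"
      by (auto simp: eventually_sequentially)
    have "norm ((\<integral>x. \<phi> n x \<partial>M) - (\<integral>x. \<psi> x \<partial>M)) < e" if "n \<ge> n0" for n
    proof -
      have "\<bar>\<integral>x. (\<phi> n x - \<psi> x) \<partial>M\<bar> \<le> e/2"
        by (rule integral_bound) (use n0[OF that] assms(1) c in \<open>auto simp: dist_real_def intro!: continuous_intros less_imp_le\<close>)
      then show ?thesis
        using integrable_cont[OF assms(1)] integrable_cont[OF c] \<open>e > 0\<close> by simp
    qed
    then show "\<exists>no. \<forall>n\<ge>no. norm ((\<integral>x. \<phi> n x \<partial>M) - (\<integral>x. \<psi> x \<partial>M)) < e" by blast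
  qed
qed

text \<open>The representer is the minimiser of \<open>W v v / 2\<close> minus the linear
  functional, and its equation is the first-order condition there.\<close>

lemma Riesz:
  assumes q: "continuous_on V q"
  shows "\<exists>R\<in>H. \<forall>v\<in>H. W R v = (\<integral>x. q x * v x \<partial>M)"
proof -
  have "bounded (q ` V)" using q compact_V compact_continuous_image compact_imp_bounded by blast
  then obtain Q where Q: "\<And>x. x \<in> V \<Longrightarrow> \<bar>q x\<bar> \<le> Q" "Q > 0" by (auto simp: bounded_pos)
  define J where "J v = (\<integral>x. q x * v x \<partial>M)" for v
  \<comment> \<open>From norm \<open>2 * Q * C\<close> on, the quadratic part outweighs
    \<open>Q * C * nrm v\<close>. The functional is nonnegative there, so a minimiser over the ball
    is a global one.\<close>
  define b where "b = (2 * Q * C)\<^sup>2"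
  have cq: "continuous_on V (\<lambda>x. q x * v x)" if "v \<in> H" for v
    using q H_cont[OF that] by (intro continuous_intros)
  have Jb: "\<bar>J v\<bar> \<le> Q * (C * nrm v)" if v: "v \<in> H" for v unfolding J_def
    by (intro integral_bound cq v) (use Q sup_bound_nrm[OF v] in \<open>auto simp: abs_mult intro!: mult_mono\<close>)
  have "\<exists>u\<in>H. W u u \<le> b \<and> (\<forall>v\<in>H. W v v \<le> b \<longrightarrow> W u u / 2 - J u \<le> W v v / 2 - J v)"
  proof (rule ball_minimizer)
    show "0 \<le> b" by (simp add: b_def)
    show "J u \<le> Q * (C * sqrt b)" if "u \<in> H" "W u u \<le> b" for u
    proof -
      have "J u \<le> Q * (C * nrm u)" using Jb[OF that(1)] by simp
      also have "\<dots> \<le> Q * (C * sqrt b)"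
        using that C_pos Q by (intro mult_left_mono) (auto simp: nrm_def)
      finally show ?thesis .
    qed
    show "(\<lambda>n. J (U n)) \<longlonglongrightarrow> J u"
      if "\<And>n. U n \<in> H" "u \<in> H" and ul: "uniform_limit V U u sequentially" for U u
      unfolding J_def
    proof (rule integral_uniform_limit)
      have "bounded (u ` V)"
        using H_cont[OF that(2)] compact_V compact_continuous_image compact_imp_bounded by blast
      then show "uniform_limit V (\<lambda>n x. q x * U n x) (\<lambda>x. q x * u x) sequentially"
        using ul \<open>bounded (q ` V)\<close> by (intro uniform_lim_mult uniform_limit_const) 
    qed (use cq that in auto)
  qed
  then obtain u where u: "u \<in> H" "W u u \<le> b" and min: "\<And>v. v \<in> H \<Longrightarrow> W v v \<le> b \<Longrightarrow> W u u / 2 - J u \<le> W v v / 2 - J v"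
    by blast
  have J0: "J (\<lambda>x. 0) = 0" by (simp add: J_def)
  have min': "W u u / 2 - J u \<le> W v v / 2 - J v" if v: "v \<in> H" for v
  proof (cases "W v v \<le> b")
    case False
    then have "b \<le> (nrm v)\<^sup>2" using v by (simp add: nrm_sq)
    then have "2 * Q * C \<le> nrm v" unfolding b_def by (rule power2_le_imp_le) (use v in simp)
    then have "nrm v * (2 * Q * C) \<le> nrm v * nrm v" using v by (intro mult_left_mono) auto
    then have "0 \<le> (nrm v)\<^sup>2 / 2 - Q * (C * nrm v)" by (simp add: power2_eq_square algebra_simps)
    then have "0 \<le> W v v / 2 - J v" using Jb[OF v] v by (simp add: nrm_sq)
    moreover have "W u u / 2 - J u \<le> 0" using min[OF H_zero] J0 W_zero by (simp add: b_def)
    ultimately show ?thesis by linarith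
  qed (use min v in auto)
  have "W u v = J v" if v: "v \<in> H" for v
  proof -
    have "W u v - J v = 0"
    proof (rule nonneg_quadratic_imp_zero)
      fix t :: real
      have "J (lin 1 u t v) = J u + t * J v"
        unfolding J_def lin_def using integrable_cont[OF cq[OF u(1)]] integrable_cont[OF cq[OF v]]
        by (simp add: algebra_simps)
      then show "0 \<le> t * (W u v - J v) + t\<^sup>2 * (W v v / 2)"
        using min'[of "lin 1 u t v"] u v W_sym[OF u(1) v] by (simp add: power2_eq_square algebra_simps)
    qed
    then show ?thesis by simp
  qed
  then show ?thesis using u by (auto simp: J_def)
qed

end

locale nonlinear_problem = energy_space +
  fixes h P :: "'a \<Rightarrow> real \<Rightarrow> real"
  assumes h_cont: "continuous_on (V \<times> UNIV) (\<lambda>(x, t). h x t)"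
    and P_deriv: "\<And>x t. x \<in> V \<Longrightarrow> (P x has_real_derivative h x t) (at t)"
    and P_zero: "\<And>x. x \<in> V \<Longrightarrow> P x 0 = 0"
begin

section \<open>The functional \<open>E\<close> and its gradient\<close>

definition J :: "('a \<Rightarrow> real) \<Rightarrow> real" where "J u = (\<integral>x. P x (u x) \<partial>M)"

definition E :: "('a \<Rightarrow> real) \<Rightarrow> real" where "E u = W u u / 2 - J u"

text \<open>The gradient of \<open>J\<close> at \<open>u\<close> for the form \<open>W\<close>. The
  equation fixes it only on \<open>V\<close>, hence the choice.\<close>

definition R :: "('a \<Rightarrow> real) \<Rightarrow> 'a \<Rightarrow> real" where
  "R u = (SOME r. r \<in> H \<and> (\<forall>v\<in>H. W r v = (\<integral>x. h x (u x) * v x \<partial>M)))"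

definition grad :: "('a \<Rightarrow> real) \<Rightarrow> 'a \<Rightarrow> real" where "grad u = lin 1 u (-1) (R u)"

definition critical :: "('a \<Rightarrow> real) \<Rightarrow> bool" where
  "critical u \<longleftrightarrow> u \<in> H \<and> (\<forall>v\<in>H. W u v = (\<integral>x. h x (u x) * v x \<partial>M))"

text \<open>\<open>P_deriv\<close> says nothing about continuity in \<open>x\<close>. Writing the
  integration variable as \<open>s * t\<close> moves the integral to the fixed interval from 0 to 1,
  where continuity in parameters is available.\<close>

lemma P_cont: "continuous_on (V \<times> UNIV) (\<lambda>(x, t). P x t)"
proof -
  have eq: "P x t = integral (cbox 0 1) (\<lambda>s. t * h x (s * t))" if "x \<in> V" for x t
  proof -
    have "((\<lambda>s. t * h x (s * t)) has_integral P x (1 * t) - P x (0 * t)) {0..1}"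
    proof (rule fundamental_theorem_of_calculus)
      fix s :: real assume "s \<in> {0..1}"
      have "((\<lambda>s. P x (s * t)) has_real_derivative h x (s * t) * t) (at s within {0..1})"
        by (rule DERIV_chain2[OF P_deriv[OF that]]) (auto intro!: derivative_eq_intros)
      then show "((\<lambda>s. P x (s * t)) has_vector_derivative t * h x (s * t)) (at s within {0..1})"
        by (simp add: has_real_derivative_iff_has_vector_derivative mult.commute)
    qed simp
    then have "((\<lambda>s. t * h x (s * t)) has_integral P x t) (cbox 0 1)"
      using P_zero[OF that] by simp
    then show ?thesis by (rule integral_unique[symmetric])
  qed
  have "continuous_on (V \<times> UNIV) (\<lambda>z. integral (cbox 0 1) (\<lambda>s. snd z * h (fst z) (s * snd z)))"
  proof (rule integral_continuous_on_param)
    have "continuous_on ((V \<times> UNIV) \<times> cbox (0::real) 1) (\<lambda>w. (\<lambda>(x, t). h x t) (fst (fst w), snd w * snd (fst w)))"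
      by (rule continuous_on_compose2[OF h_cont]) (auto intro!: continuous_intros)
    then show "continuous_on ((V \<times> UNIV) \<times> cbox 0 1) (\<lambda>(z, s). snd z * h (fst z) (s * snd z))"
      by (auto simp: case_prod_unfold intro!: continuous_intros)
  qed
  then show ?thesis
    by (rule continuous_on_cong[THEN iffD1, rotated -1]) (auto simp: eq)
qed

lemma comp_cont:
  assumes "continuous_on V u"
  shows "continuous_on V (\<lambda>x. h x (u x))" "continuous_on V (\<lambda>x. P x (u x))"
proof -
  have c: "continuous_on V (\<lambda>x. (x, u x))" using assms by (intro continuous_intros)
  show "continuous_on V (\<lambda>x. h x (u x))" using continuous_on_compose2[OF h_cont c] by auto
  show "continuous_on V (\<lambda>x. P x (u x))" using continuous_on_compose2[OF P_cont c] by auto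
qed

lemma compact_box: "compact (V \<times> {-B..B::real})"
  by (intro compact_Times compact_V) simp

lemma h_bounded: obtains Q where "Q > 0" "\<And>x t. x \<in> V \<Longrightarrow> \<bar>t\<bar> \<le> B \<Longrightarrow> \<bar>h x t\<bar> \<le> Q"
proof -
  have "continuous_on (V \<times> {-B..B}) (\<lambda>(x, t). h x t)" by (rule continuous_on_subset[OF h_cont]) auto
  then have "bounded ((\<lambda>(x, t). h x t) ` (V \<times> {-B..B}))"
    using compact_box compact_continuous_image compact_imp_bounded by blast
  then obtain Q where "Q > 0" and Q: "\<And>z. z \<in> V \<times> {-B..B} \<Longrightarrow> norm ((\<lambda>(x, t). h x t) z) \<le> Q"
    by (auto simp: bounded_pos)
  show ?thesis
  proof (rule that[OF \<open>Q > 0\<close>])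
    fix x t assume "x \<in> V" "\<bar>t\<bar> \<le> B"
    then have "(x, t) \<in> V \<times> {-B..B}" by auto
    from Q[OF this] show "\<bar>h x t\<bar> \<le> Q" by simp
  qed
qed

lemma h_unif:
  assumes "e > 0"
  obtains d where "d > 0"
    "\<And>x s t. x \<in> V \<Longrightarrow> \<bar>t\<bar> \<le> B \<Longrightarrow> \<bar>s\<bar> \<le> B \<Longrightarrow> \<bar>t - s\<bar> < d \<Longrightarrow> \<bar>h x t - h x s\<bar> < e"
proof -
  have "continuous_on (V \<times> {-B..B}) (\<lambda>(x, t). h x t)" by (rule continuous_on_subset[OF h_cont]) auto
  then have "uniformly_continuous_on (V \<times> {-B..B}) (\<lambda>(x, t). h x t)"
    by (rule compact_uniformly_continuous[OF _ compact_box])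
  then obtain d where "d > 0" and d: "\<And>z w. z \<in> V \<times> {-B..B} \<Longrightarrow> w \<in> V \<times> {-B..B} \<Longrightarrow> dist w z < d \<Longrightarrow>
      dist ((\<lambda>(x, t). h x t) w) ((\<lambda>(x, t). h x t) z) < e"
    by (rule uniformly_continuous_onE[OF _ assms]) (rule that)
  show ?thesis
  proof (rule that[OF \<open>d > 0\<close>])
    fix x s t assume "x \<in> V" "\<bar>t\<bar> \<le> B" "\<bar>s\<bar> \<le> B" "\<bar>t - s\<bar> < d"
    then have "(x, s) \<in> V \<times> {-B..B}" "(x, t) \<in> V \<times> {-B..B}" "dist (x, t) (x, s) < d"
      by (auto simp: dist_Pair_Pair dist_real_def)
    from d[OF this] show "\<bar>h x t - h x s\<bar> < e" by (simp add: dist_real_def)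
  qed
qed

lemma P_affine_deriv:
  "x \<in> V \<Longrightarrow> ((\<lambda>t. P x t - a * t) has_field_derivative h x r - a) (at r within S)"
  by (rule has_field_derivative_at_within, rule DERIV_diff[OF P_deriv DERIV_cmult_Id])

lemma P_lipschitz:
  assumes Q: "\<And>r. \<bar>r\<bar> \<le> B \<Longrightarrow> \<bar>h x r - a\<bar> \<le> Q" and x: "x \<in> V" and st: "\<bar>s\<bar> \<le> B" "\<bar>t\<bar> \<le> B"
  shows "\<bar>P x t - P x s - a * (t - s)\<bar> \<le> Q * \<bar>t - s\<bar>"
proof -
  have "norm ((\<lambda>t. P x t - a * t) t - (\<lambda>t. P x t - a * t) s) \<le> Q * norm (t - s)"
  proof (rule field_differentiable_bound)
    show "convex {-B..B}" by simp
    show "((\<lambda>t. P x t - a * t) has_field_derivative h x r - a) (at r within {-B..B})" for r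
      by (rule P_affine_deriv[OF x])
  qed (use Q st in auto)
  then show ?thesis by (simp add: algebra_simps)
qed

lemma J_uniform_limit:
  assumes U: "\<And>n. U n \<in> H" and u: "u \<in> H" and l: "uniform_limit V U u sequentially"
  shows "(\<lambda>n. J (U n)) \<longlonglongrightarrow> J u" "uniform_limit V (\<lambda>n x. h x (U n x)) (\<lambda>x. h x (u x)) sequentially"
proof -
  have "bounded (u ` V)" using H_cont[OF u] compact_V compact_continuous_image compact_imp_bounded by blast
  then obtain B0 where B0: "B0 > 0" "\<And>x. x \<in> V \<Longrightarrow> \<bar>u x\<bar> \<le> B0" by (auto simp: bounded_pos)
  \<comment> \<open>One unit of room: from some index on, all \<open>U n\<close> take their values
    in \<open>{-B..B}\<close>, where \<open>h\<close> is uniformly continuous.\<close>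
  define B where "B = B0 + 1"
  have "\<forall>\<^sub>F n in sequentially. \<forall>x\<in>V. dist (U n x) (u x) < 1"
    by (rule uniform_limitD[OF l]) simp
  then have evB: "\<forall>\<^sub>F n in sequentially. \<forall>x\<in>V. \<bar>U n x\<bar> \<le> B"
  proof eventually_elim
    case (elim n)
    show ?case
    proof
      fix x assume "x \<in> V"
      then have "\<bar>U n x - u x\<bar> < 1" "\<bar>u x\<bar> \<le> B0" using elim B0 by (auto simp: dist_real_def)
      then show "\<bar>U n x\<bar> \<le> B" by (simp add: B_def)
    qed
  qed
  have uB: "\<And>x. x \<in> V \<Longrightarrow> \<bar>u x\<bar> \<le> B" using B0 by (force simp: B_def)
  show "uniform_limit V (\<lambda>n x. h x (U n x)) (\<lambda>x. h x (u x)) sequentially"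
  proof (rule uniform_limitI)
    fix e :: real assume "e > 0"
    obtain d where "d > 0" and
      d: "\<And>x s t. x \<in> V \<Longrightarrow> \<bar>t\<bar> \<le> B \<Longrightarrow> \<bar>s\<bar> \<le> B \<Longrightarrow> \<bar>t - s\<bar> < d \<Longrightarrow> \<bar>h x t - h x s\<bar> < e"
      by (rule h_unif[OF \<open>e > 0\<close>, of B]) (rule that)
    show "\<forall>\<^sub>F n in sequentially. \<forall>x\<in>V. dist (h x (U n x)) (h x (u x)) < e"
      using evB uniform_limitD[OF l \<open>d > 0\<close>]
    proof eventually_elim
      case (elim n)
      then show ?case using d uB by (auto simp: dist_real_def)
    qed
  qed
  obtain Q where "Q > 0" and Q: "\<And>x t. x \<in> V \<Longrightarrow> \<bar>t\<bar> \<le> B \<Longrightarrow> \<bar>h x t\<bar> \<le> Q"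
    by (rule h_bounded[of B]) (rule that)
  have "uniform_limit V (\<lambda>n x. P x (U n x)) (\<lambda>x. P x (u x)) sequentially"
  proof (rule uniform_limitI)
    fix e :: real assume "e > 0"
    then have "e / Q > 0" using \<open>Q > 0\<close> by simp
    from evB uniform_limitD[OF l this]
    show "\<forall>\<^sub>F n in sequentially. \<forall>x\<in>V. dist (P x (U n x)) (P x (u x)) < e"
    proof eventually_elim
      case (elim n)
      show ?case
      proof
        fix x assume x: "x \<in> V"
        have "\<bar>P x (U n x) - P x (u x) - 0 * (U n x - u x)\<bar> \<le> Q * \<bar>U n x - u x\<bar>"
          by (rule P_lipschitz[of B]) (use Q x elim uB in auto)
        also have "\<dots> < Q * (e / Q)"
          using elim x \<open>Q > 0\<close> by (intro mult_strict_left_mono) (auto simp: dist_real_def)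
        finally show "dist (P x (U n x)) (P x (u x)) < e" using \<open>Q > 0\<close> by (simp add: dist_real_def)
      qed
    qed
  qed
  then show "(\<lambda>n. J (U n)) \<longlonglongrightarrow> J u"
    unfolding J_def using comp_cont(2) H_cont U by (intro integral_uniform_limit) auto
qed

lemma R_in [simp]: "u \<in> H \<Longrightarrow> R u \<in> H"
  and W_R: "u \<in> H \<Longrightarrow> v \<in> H \<Longrightarrow> W (R u) v = (\<integral>x. h x (u x) * v x \<partial>M)"
proof -
  have *: "R u \<in> H \<and> (\<forall>v\<in>H. W (R u) v = (\<integral>x. h x (u x) * v x \<partial>M))" if "u \<in> H"
  proof -
    let ?S = "\<lambda>r. r \<in> H \<and> (\<forall>v\<in>H. W r v = (\<integral>x. h x (u x) * v x \<partial>M))"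
    have "\<exists>r. ?S r" using Riesz[OF comp_cont(1)[OF H_cont[OF that]]] by (simp only: Bex_def)
    then have "?S (SOME r. ?S r)" by (rule someI_ex)
    then show ?thesis unfolding R_def .
  qed
  show "u \<in> H \<Longrightarrow> R u \<in> H" "u \<in> H \<Longrightarrow> v \<in> H \<Longrightarrow> W (R u) v = (\<integral>x. h x (u x) * v x \<partial>M)"
    using * by auto
qed

lemma grad_in [simp]: "u \<in> H \<Longrightarrow> grad u \<in> H"
  by (simp add: grad_def)

lemma hv_cont: "u \<in> H \<Longrightarrow> v \<in> H \<Longrightarrow> continuous_on V (\<lambda>x. h x (u x) * v x)"
  by (intro continuous_intros comp_cont H_cont)

text \<open>Test the representer against itself and cancel one factor
  \<open>nrm (R u)\<close>.\<close>

lemma nrm_R: assumes u: "u \<in> H" and Q: "\<And>x. x \<in> V \<Longrightarrow> \<bar>h x (u x)\<bar> \<le> Q" "0 \<le> Q"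
  shows "nrm (R u) \<le> C * Q"
proof -
  have "nrm (R u) * nrm (R u) = (\<integral>x. h x (u x) * R u x \<partial>M)"
    using nrm_sq[OF R_in[OF u]] W_R[OF u R_in[OF u]] by (simp add: power2_eq_square)
  also have "\<dots> \<le> \<bar>\<integral>x. h x (u x) * R u x \<partial>M\<bar>" by simp
  also have "\<dots> \<le> Q * (C * nrm (R u))"
    by (intro integral_bound hv_cont u R_in)
       (use Q sup_bound_nrm[OF R_in[OF u]] in \<open>auto simp: abs_mult intro!: mult_mono\<close>)
  finally have "nrm (R u) * nrm (R u) \<le> (C * Q) * nrm (R u)" by (simp add: algebra_simps)
  then show ?thesis
    using nrm_nonneg[OF R_in[OF u]] C_pos Q(2) by (cases "nrm (R u) = 0") auto
qed

lemma dst_R: assumes u: "u \<in> H" "v \<in> H" and Q: "\<And>x. x \<in> V \<Longrightarrow> \<bar>h x (u x) - h x (v x)\<bar> \<le> Q" "0 \<le> Q"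
  shows "dst (R u) (R v) \<le> C * Q"
proof -
  define r where "r = lin 1 (R u) (-1) (R v)"
  have r: "r \<in> H" using u by (simp add: r_def)
  have "W r r = W (R u) r - W (R v) r" unfolding r_def by (subst W_lin) (use u in simp_all)
  then have "nrm r * nrm r = (\<integral>x. h x (u x) * r x \<partial>M) - (\<integral>x. h x (v x) * r x \<partial>M)"
    using nrm_sq[OF r] W_R[OF u(1) r] W_R[OF u(2) r] by (simp add: power2_eq_square)
  also have "\<dots> = (\<integral>x. (h x (u x) - h x (v x)) * r x \<partial>M)"
    using integrable_cont[OF hv_cont[OF u(1) r]] integrable_cont[OF hv_cont[OF u(2) r]]
    by (simp add: algebra_simps)
  also have "\<dots> \<le> \<bar>\<integral>x. (h x (u x) - h x (v x)) * r x \<partial>M\<bar>" by simp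
  also have "\<dots> \<le> Q * (C * nrm r)"
    by (intro integral_bound continuous_intros comp_cont H_cont u r)
       (use Q sup_bound_nrm[OF r] in \<open>auto simp: abs_mult intro!: mult_mono\<close>)
  finally have "nrm r * nrm r \<le> (C * Q) * nrm r" by (simp add: algebra_simps)
  then have "nrm r \<le> C * Q"
    using nrm_nonneg[OF r] C_pos Q(2) by (cases "nrm r = 0") auto
  then show ?thesis by (simp add: dst_def r_def)
qed

lemma dst_tendsto_uniform:
  assumes "\<And>n. U n \<in> H" "u \<in> H" "(\<lambda>n. dst (U n) u) \<longlonglongrightarrow> 0"
  shows "uniform_limit V U u sequentially"
proof (rule uniform_limitI)
  fix e :: real assume "e > 0"
  then have "e / C > 0" using C_pos by simp
  with assms(3) have "\<forall>\<^sub>F n in sequentially. dst (U n) u < e / C" by (rule order_tendstoD(2))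
  then show "\<forall>\<^sub>F n in sequentially. \<forall>x\<in>V. dist (U n x) (u x) < e"
  proof eventually_elim
    case (elim n)
    show ?case
    proof
      fix x assume "x \<in> V"
      then have "\<bar>U n x - u x\<bar> \<le> C * dst (U n) u" by (intro sup_dst assms)
      also have "\<dots> < C * (e / C)" using elim C_pos by (intro mult_strict_left_mono)
      finally show "dist (U n x) (u x) < e" using C_pos by (simp add: dist_real_def)
    qed
  qed
qed

text \<open>Uniform convergence of the arguments becomes convergence in energy: the derivative of
  \<open>J\<close> is compact. This is what makes approximate critical points converge in
  norm.\<close>

lemma R_tendsto:
  assumes U: "\<And>n. U n \<in> H" "u \<in> H" "uniform_limit V U u sequentially"
  shows "(\<lambda>n. dst (R (U n)) (R u)) \<longlonglongrightarrow> 0"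
proof (rule LIMSEQ_I)
  fix e :: real assume "e > 0"
  then have "e / (2 * C) > 0" using C_pos by simp
  from uniform_limitD[OF J_uniform_limit(2)[OF U] this]
  obtain n0 where n0: "\<And>n x. n \<ge> n0 \<Longrightarrow> x \<in> V \<Longrightarrow> dist (h x (U n x)) (h x (u x)) < e / (2 * C)"
    by (auto simp: eventually_sequentially)
  have "norm (dst (R (U n)) (R u) - 0) < e" if "n \<ge> n0" for n
  proof -
    have "dst (R (U n)) (R u) \<le> C * (e / (2 * C))"
      using n0[OF that] \<open>e > 0\<close> C_pos by (intro dst_R U) (auto simp: dist_real_def intro: less_imp_le)
    then show ?thesis using \<open>e > 0\<close> C_pos U by simp
  qed
  then show "\<exists>no. \<forall>n\<ge>no. norm (dst (R (U n)) (R u) - 0) < e" by blast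
qed

lemma nrm_tendsto:
  assumes "\<And>n. U n \<in> H" "u \<in> H" "(\<lambda>n. dst (U n) u) \<longlonglongrightarrow> 0"
  shows "(\<lambda>n. nrm (U n)) \<longlonglongrightarrow> nrm u"
proof -
  have "(\<lambda>n. nrm (U n) - nrm u) \<longlonglongrightarrow> 0"
    using nrm_triangle assms by (intro Lim_null_comparison[OF _ assms(3)] always_eventually) auto
  then show ?thesis by (simp add: LIM_zero_iff)
qed

lemma E_tendsto:
  assumes U: "\<And>n. U n \<in> H" "u \<in> H" "(\<lambda>n. dst (U n) u) \<longlonglongrightarrow> 0"
  shows "(\<lambda>n. E (U n)) \<longlonglongrightarrow> E u"
proof -
  have "(\<lambda>n. (nrm (U n))\<^sup>2 / 2 - J (U n)) \<longlonglongrightarrow> (nrm u)\<^sup>2 / 2 - J u"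
    by (intro tendsto_intros nrm_tendsto[OF U] J_uniform_limit(1)[OF U(1,2) dst_tendsto_uniform[OF U]]) simp
  then show ?thesis using U by (simp add: nrm_sq E_def)
qed

lemma E_zero: "E (\<lambda>x. 0) = 0"
  unfolding E_def W_zero J_def
  using Bochner_Integration.integral_cong[OF refl, of M "\<lambda>x. P x 0" "\<lambda>x. 0"] by (simp add: P_zero space_M)

lemma E_cong: assumes "u \<in> H" "v \<in> H" "\<And>x. x \<in> V \<Longrightarrow> u x = v x" shows "E u = E v"
proof -
  have "J u = J v" unfolding J_def
    by (rule Bochner_Integration.integral_cong) (simp_all add: assms(3) space_M)
  then show ?thesis using W_cong[OF assms] by (simp add: E_def)
qed

section \<open>Descent along the gradient, and continuous paths\<close>

lemma nrm_grad_bounded: obtains Q where "Q > 0" "\<And>u. u \<in> H \<Longrightarrow> nrm u \<le> B \<Longrightarrow> nrm (grad u) \<le> Q"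
proof -
  obtain Q where "Q > 0" and Q: "\<And>x t. x \<in> V \<Longrightarrow> \<bar>t\<bar> \<le> C * B \<Longrightarrow> \<bar>h x t\<bar> \<le> Q"
    by (rule h_bounded[of "C * B"]) (rule that)
  show ?thesis
  proof (rule that[of "\<bar>B\<bar> + C * Q"])
    show "0 < \<bar>B\<bar> + C * Q" using \<open>Q > 0\<close> C_pos by (simp add: add_nonneg_pos)
    fix u assume u: "u \<in> H" "nrm u \<le> B"
    have "nrm (R u) \<le> C * Q"
    proof (rule nrm_R[OF u(1)])
      fix x assume "x \<in> V"
      then have "\<bar>u x\<bar> \<le> C * nrm u" by (rule sup_bound_nrm[OF u(1)])
      also have "\<dots> \<le> C * B" using u C_pos by simp
      finally show "\<bar>h x (u x)\<bar> \<le> Q" by (rule Q[OF \<open>x \<in> V\<close>])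
    qed (use \<open>Q > 0\<close> in simp)
    then show "nrm (grad u) \<le> \<bar>B\<bar> + C * Q"
      using nrm_lin[OF u(1) R_in[OF u(1)], of 1 "-1"] u(2) by (simp add: grad_def)
  qed
qed

text \<open>With \<open>G = nrm (grad u)\<close>, the first-order decrease is
  \<open>s * G\<^sup>2\<close>. At most one half of it is lost to the quadratic term
  \<open>s\<^sup>2 * G\<^sup>2 / 2\<close> and one quarter to the linearisation error of
  \<open>J\<close>. The step bound is uniform on the ball because \<open>h\<close> is uniformly
  continuous on a compact box.\<close>

lemma descent:
  assumes "0 < \<epsilon>"
  obtains \<tau> where "0 < \<tau>" "\<tau> \<le> 1"
    "\<And>u s. u \<in> H \<Longrightarrow> nrm u \<le> B \<Longrightarrow> \<epsilon> \<le> nrm (grad u) \<Longrightarrow> 0 \<le> s \<Longrightarrow> s \<le> \<tau> \<Longrightarrow>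
       E (lin 1 u (-s) (grad u)) \<le> E u - s / 4 * (nrm (grad u))\<^sup>2"
proof -
  obtain Q where "Q > 0" and Q: "\<And>u. u \<in> H \<Longrightarrow> nrm u \<le> B \<Longrightarrow> nrm (grad u) \<le> Q"
    by (rule nrm_grad_bounded[of B]) (rule that)
  \<comment> \<open>A box for the values before and after the step: with \<open>s \<le> 1\<close>
    the new norm is at most \<open>\<bar>B\<bar> + Q\<close>.\<close>
  define B' where "B' = C * (\<bar>B\<bar> + Q)"
  \<comment> \<open>This tolerance for \<open>h\<close> makes the linearisation error at most
    \<open>s * (\<epsilon> * G) / 4\<close>.\<close>
  have "\<epsilon> / (4 * C) > 0" using assms C_pos by simp
  then obtain d where "d > 0" and
    d: "\<And>x s t. x \<in> V \<Longrightarrow> \<bar>t\<bar> \<le> B' \<Longrightarrow> \<bar>s\<bar> \<le> B' \<Longrightarrow> \<bar>t - s\<bar> < d \<Longrightarrow> \<bar>h x t - h x s\<bar> < \<epsilon> / (4 * C)"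
    by (rule h_unif[of _ B']) (rule that)
  \<comment> \<open>Keeps the pointwise displacement \<open>s * g x\<close> below
    \<open>d\<close>.\<close>
  define \<tau> where "\<tau> = min 1 (d / (2 * C * Q))"
  have \<tau>: "0 < \<tau>" "\<tau> \<le> 1" using \<open>d > 0\<close> C_pos \<open>Q > 0\<close> by (auto simp: \<tau>_def)
  have \<tau>d: "\<tau> * (C * Q) < d"
  proof -
    have "\<tau> * (C * Q) \<le> d / (2 * C * Q) * (C * Q)"
      using C_pos \<open>Q > 0\<close> by (intro mult_right_mono) (auto simp: \<tau>_def)
    also have "\<dots> = d / 2" using C_pos \<open>Q > 0\<close> by simp
    finally show ?thesis using \<open>d > 0\<close> by simp
  qed
  show ?thesis
  proof (rule that[OF \<tau>])
    fix u and s :: real assume u: "u \<in> H" "nrm u \<le> B" and eps: "\<epsilon> \<le> nrm (grad u)" and s: "0 \<le> s" "s \<le> \<tau>"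
    define g where "g = grad u"
    define G where "G = nrm g"
    have g: "g \<in> H" using u by (simp add: g_def)
    have GQ: "G \<le> Q" "0 \<le> G" using Q[OF u] g by (auto simp: G_def g_def)
    define v where "v = lin 1 u (-s) g"
    have v: "v \<in> H" using u g by (simp add: v_def)
    have gx: "\<bar>g x\<bar> \<le> C * G" if "x \<in> V" for x unfolding G_def by (rule sup_bound_nrm[OF g that])
    have ux: "\<bar>u x\<bar> \<le> B'" if "x \<in> V" for x
    proof -
      have "\<bar>u x\<bar> \<le> C * nrm u" by (rule sup_bound_nrm[OF u(1) that])
      also have "\<dots> \<le> B'" unfolding B'_def using u(2) C_pos \<open>Q > 0\<close> by (intro mult_left_mono) auto
      finally show ?thesis .
    qed
    have sg: "\<bar>s * g x\<bar> \<le> s * (C * G)" if "x \<in> V" for x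
      using gx[OF that] s(1) by (simp add: abs_mult mult_left_mono)
    have sgd: "\<bar>s * g x\<bar> < d" if "x \<in> V" for x
    proof -
      have "s * (C * G) \<le> \<tau> * (C * Q)" using s GQ C_pos \<open>Q > 0\<close> by (intro mult_mono) auto
      then show ?thesis using sg[OF that] \<tau>d by linarith
    qed
    have vx: "\<bar>v x\<bar> \<le> B'" if "x \<in> V" for x
    proof -
      have "nrm v \<le> nrm u + s * G" unfolding v_def G_def using nrm_lin[OF u(1) g, of 1 "-s"] s by simp
      also have "s * G \<le> 1 * Q" using s \<tau> GQ by (intro mult_mono) auto
      finally have "nrm v \<le> \<bar>B\<bar> + Q" using u(2) by linarith
      then have "C * nrm v \<le> B'" unfolding B'_def using C_pos by (intro mult_left_mono) auto
      then show ?thesis using sup_bound_nrm[OF v that] by linarith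
    qed
    have key: "\<bar>P x (v x) - P x (u x) + s * (h x (u x) * g x)\<bar> \<le> \<epsilon> / (4 * C) * (s * (C * G))" if x: "x \<in> V" for x
    proof -
      have vu: "v x - u x = - (s * g x)" by (simp add: v_def lin_def)
      define lo hi where "lo = min (u x) (v x)" and "hi = max (u x) (v x)"
      have "norm ((\<lambda>t. P x t - h x (u x) * t) (v x) - (\<lambda>t. P x t - h x (u x) * t) (u x)) \<le> \<epsilon> / (4 * C) * norm (v x - u x)"
      proof (rule field_differentiable_bound)
        show "convex {lo..hi}" by simp
        show "((\<lambda>t. P x t - h x (u x) * t) has_field_derivative h x r - h x (u x)) (at r within {lo..hi})" for r
          by (rule P_affine_deriv[OF x])
        show "norm (h x r - h x (u x)) \<le> \<epsilon> / (4 * C)" if r: "r \<in> {lo..hi}" for r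
        proof -
          have "\<bar>r\<bar> \<le> B'" using r ux[OF x] vx[OF x] by (auto simp: lo_def hi_def)
          moreover have "\<bar>r - u x\<bar> < d" using r sgd[OF x] vu by (auto simp: lo_def hi_def)
          ultimately show ?thesis using d[OF x _ ux[OF x]] by (simp add: less_imp_le)
        qed
      qed (auto simp: lo_def hi_def)
      also have "\<dots> \<le> \<epsilon> / (4 * C) * (s * (C * G))"
        using sg[OF x] vu assms C_pos by (intro mult_left_mono) auto
      also have "(\<lambda>t. P x t - h x (u x) * t) (v x) - (\<lambda>t. P x t - h x (u x) * t) (u x)
         = P x (v x) - P x (u x) - h x (u x) * (v x - u x)" by (simp add: algebra_simps)
      finally show ?thesis by (simp add: vu algebra_simps)
    qed
    have ints: "integrable M (\<lambda>x. P x (v x))" "integrable M (\<lambda>x. P x (u x))" "integrable M (\<lambda>x. h x (u x) * g x)"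
      by (intro integrable_cont comp_cont H_cont u v hv_cont g)+
    have "\<bar>\<integral>x. (P x (v x) - P x (u x) + s * (h x (u x) * g x)) \<partial>M\<bar> \<le> \<epsilon> / (4 * C) * (s * (C * G))"
      by (intro integral_bound key continuous_intros comp_cont H_cont u v g)
    also have "\<dots> = s * (\<epsilon> * G) / 4" using C_pos by simp
    also have "(\<integral>x. (P x (v x) - P x (u x) + s * (h x (u x) * g x)) \<partial>M) = J v - J u + s * W (R u) g"
      unfolding J_def W_R[OF u(1) g] using ints by simp
    finally have Jv: "\<bar>J v - J u + s * W (R u) g\<bar> \<le> s * (\<epsilon> * G) / 4" .
    have eG: "s * (\<epsilon> * G) \<le> s * G\<^sup>2"
      using eps GQ s by (intro mult_left_mono) (auto simp: power2_eq_square G_def g_def intro!: mult_right_mono)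
    have Wv: "W v v = W u u - 2 * s * W u g + s\<^sup>2 * W g g"
      unfolding v_def using u(1) g W_sym[OF u(1) g] by (simp add: power2_eq_square algebra_simps)
    have Wg: "G\<^sup>2 = W u g - W (R u) g"
    proof -
      have "G\<^sup>2 = W g g" unfolding G_def by (rule nrm_sq[OF g])
      also have "\<dots> = W u g - W (R u) g"
        by (subst (1) g_def, subst grad_def, subst W_lin) (use u g in auto)
      finally show ?thesis .
    qed
    have gg: "W g g = G\<^sup>2" unfolding G_def by (rule nrm_sq[OF g, symmetric])
    have "s\<^sup>2 * G\<^sup>2 \<le> s * G\<^sup>2"
    proof -
      have "s * s \<le> 1 * s" using s \<tau> by (intro mult_right_mono) auto
      then show ?thesis by (intro mult_right_mono) (auto simp: power2_eq_square)
    qed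
    moreover have "s * G\<^sup>2 = s * W u g - s * W (R u) g" by (simp add: Wg algebra_simps)
    moreover have "E v = W u u / 2 - s * W u g + s\<^sup>2 * G\<^sup>2 / 2 - J v" unfolding E_def Wv gg by simp
    moreover have "E u = W u u / 2 - J u" by (simp add: E_def)
    ultimately have "E v \<le> E u - s * G\<^sup>2 / 4" using Jv eG by linarith
    then show "E (lin 1 u (-s) (grad u)) \<le> E u - s / 4 * (nrm (grad u))\<^sup>2"
      by (simp add: v_def g_def G_def)
  qed
qed

lemma dst_grad_tendsto:
  assumes U: "\<And>n. U n \<in> H" "u \<in> H" "(\<lambda>n. dst (U n) u) \<longlonglongrightarrow> 0"
  shows "(\<lambda>n. dst (grad (U n)) (grad u)) \<longlonglongrightarrow> 0"
proof (rule Lim_null_comparison)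
  have "dst (grad a) (grad b) \<le> dst a b + dst (R a) (R b)" if "a \<in> H" "b \<in> H" for a b
  proof -
    have "lin 1 (grad a) (-1) (grad b) = lin 1 (lin 1 a (-1) b) (-1) (lin 1 (R a) (-1) (R b))"
      by (auto simp: lin_def grad_def)
    then show ?thesis
      using nrm_lin[of "lin 1 a (-1) b" "lin 1 (R a) (-1) (R b)" 1 "-1"] that by (simp add: dst_def)
  qed
  then show "\<forall>\<^sub>F n in sequentially. norm (dst (grad (U n)) (grad u)) \<le> dst (U n) u + dst (R (U n)) (R u)"
    using U by (intro always_eventually) auto
  show "(\<lambda>n. dst (U n) u + dst (R (U n)) (R u)) \<longlonglongrightarrow> 0"
    using tendsto_add[OF U(3) R_tendsto[OF U(1,2) dst_tendsto_uniform[OF U]]] by simp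
qed

text \<open>Continuous in \<open>u\<close>, so that \<open>step\<close> maps continuous paths to
  continuous paths. It vanishes when the gradient norm is at most \<open>\<epsilon>\<close>, since
  \<open>descent\<close> says nothing about smaller gradients.\<close>

definition step_size :: "real \<Rightarrow> real \<Rightarrow> ('a \<Rightarrow> real) \<Rightarrow> real" where
  "step_size \<tau> \<epsilon> u = \<tau> * min 1 (max 0 (nrm (grad u) - \<epsilon>))"

definition step :: "real \<Rightarrow> real \<Rightarrow> ('a \<Rightarrow> real) \<Rightarrow> 'a \<Rightarrow> real" where
  "step \<tau> \<epsilon> u = lin 1 u (- step_size \<tau> \<epsilon> u) (grad u)"

lemma step_in [simp]: "u \<in> H \<Longrightarrow> step \<tau> \<epsilon> u \<in> H"
  by (simp add: step_def)

lemma step_size_bounds: "0 < \<tau> \<Longrightarrow> 0 \<le> step_size \<tau> \<epsilon> u \<and> step_size \<tau> \<epsilon> u \<le> \<tau>"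
  by (auto simp: step_size_def mult_le_cancel_left1 intro!: mult_nonneg_nonneg)

lemma step_tendsto:
  assumes U: "\<And>n. U n \<in> H" "u \<in> H" "(\<lambda>n. dst (U n) u) \<longlonglongrightarrow> 0"
  shows "(\<lambda>n. dst (step \<tau> \<epsilon> (U n)) (step \<tau> \<epsilon> u)) \<longlonglongrightarrow> 0"
proof (rule Lim_null_comparison)
  let ?s = "step_size \<tau> \<epsilon>"
  have "dst (step \<tau> \<epsilon> a) (step \<tau> \<epsilon> b) \<le> dst a b + (\<bar>?s a\<bar> * dst (grad a) (grad b) + \<bar>?s a - ?s b\<bar> * nrm (grad b))"
    if "a \<in> H" "b \<in> H" for a b
  proof -
    \<comment> \<open>The difference of the two corrections, split into the change of the gradient
      and the change of the step size.\<close>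
    let ?r = "lin (?s a) (lin 1 (grad a) (-1) (grad b)) (?s a - ?s b) (grad b)"
    have "lin 1 (step \<tau> \<epsilon> a) (-1) (step \<tau> \<epsilon> b) = lin 1 (lin 1 a (-1) b) (-1) ?r"
      by (auto simp: lin_def step_def algebra_simps)
    then have "dst (step \<tau> \<epsilon> a) (step \<tau> \<epsilon> b) \<le> dst a b + nrm ?r"
      using nrm_lin[of "lin 1 a (-1) b" ?r 1 "-1"] that by (simp add: dst_def)
    also have "nrm ?r \<le> \<bar>?s a\<bar> * dst (grad a) (grad b) + \<bar>?s a - ?s b\<bar> * nrm (grad b)"
      using nrm_lin[of "lin 1 (grad a) (-1) (grad b)" "grad b" "?s a" "?s a - ?s b"] that by (simp add: dst_def)
    finally show ?thesis by simp
  qed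
  then show "\<forall>\<^sub>F n in sequentially. norm (dst (step \<tau> \<epsilon> (U n)) (step \<tau> \<epsilon> u)) \<le>
     dst (U n) u + (\<bar>?s (U n)\<bar> * dst (grad (U n)) (grad u) + \<bar>?s (U n) - ?s u\<bar> * nrm (grad u))"
    using U by (intro always_eventually) auto
  have "(\<lambda>n. ?s (U n)) \<longlonglongrightarrow> ?s u" unfolding step_size_def
    using U by (intro tendsto_intros nrm_tendsto dst_grad_tendsto) auto
  then have "(\<lambda>n. dst (U n) u + (\<bar>?s (U n)\<bar> * dst (grad (U n)) (grad u) + \<bar>?s (U n) - ?s u\<bar> * nrm (grad u)))
      \<longlonglongrightarrow> 0 + (\<bar>?s u\<bar> * 0 + \<bar>?s u - ?s u\<bar> * nrm (grad u))"
    by (intro tendsto_intros U dst_grad_tendsto)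
  then show "(\<lambda>n. dst (U n) u + (\<bar>?s (U n)\<bar> * dst (grad (U n)) (grad u) + \<bar>?s (U n) - ?s u\<bar> * nrm (grad u)))
      \<longlonglongrightarrow> 0" by simp
qed

text \<open>Sequential continuity with respect to \<open>dst\<close>, which is not the metric of a
  type class.\<close>

definition cpath :: "(real \<Rightarrow> 'a \<Rightarrow> real) \<Rightarrow> bool" where
  "cpath \<gamma> \<longleftrightarrow> (\<forall>t. \<gamma> t \<in> H) \<and> (\<forall>t X. X \<longlonglongrightarrow> t \<longrightarrow> (\<lambda>n. dst (\<gamma> (X n)) (\<gamma> t)) \<longlonglongrightarrow> 0)"

text \<open>With \<open>k = 1\<close> and start 0 this is the initial path; with
  \<open>k = - s u\<close> it is the segment from \<open>u\<close> to its next iterate.\<close>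

lemma cpath_line: assumes "u \<in> H" "v \<in> H" shows "cpath (\<lambda>t. lin 1 u (k * t) v)"
  unfolding cpath_def
proof (intro conjI allI impI)
  fix t and X :: "nat \<Rightarrow> real" assume X: "X \<longlonglongrightarrow> t"
  have "dst (lin 1 u (k * a) v) (lin 1 u (k * b) v) \<le> \<bar>k * a - k * b\<bar> * nrm v" for a b
  proof -
    have "lin 1 (lin 1 u (k * a) v) (-1) (lin 1 u (k * b) v) = lin 0 v (k * a - k * b) v"
      by (auto simp: lin_def algebra_simps)
    then show ?thesis using nrm_lin[of v v 0 "k * a - k * b"] assms by (simp add: dst_def)
  qed
  then have 1: "\<forall>\<^sub>F n in sequentially. norm (dst (lin 1 u (k * X n) v) (lin 1 u (k * t) v)) \<le> \<bar>k * X n - k * t\<bar> * nrm v"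
    using assms by (intro always_eventually) auto
  have "(\<lambda>n. \<bar>k * X n - k * t\<bar> * nrm v) \<longlonglongrightarrow> \<bar>k * t - k * t\<bar> * nrm v"
    by (intro tendsto_intros X)
  then have 2: "(\<lambda>n. \<bar>k * X n - k * t\<bar> * nrm v) \<longlonglongrightarrow> 0" by simp
  show "(\<lambda>n. dst (lin 1 u (k * X n) v) (lin 1 u (k * t) v)) \<longlonglongrightarrow> 0"
    by (rule Lim_null_comparison[OF 1 2])
qed (use assms in auto)

lemma cpath_step: "cpath \<gamma> \<Longrightarrow> cpath (\<lambda>t. step \<tau> \<epsilon> (\<gamma> t))"
  unfolding cpath_def by (auto intro!: step_tendsto)

lemma cpath_nrm: assumes "cpath \<gamma>" shows "continuous_on S (\<lambda>t. nrm (\<gamma> t))"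
  by (intro continuous_at_imp_continuous_on ballI)
     (use assms in \<open>auto simp: continuous_at_sequentially o_def cpath_def intro!: nrm_tendsto\<close>)

lemma cpath_crosses:
  assumes "cpath \<gamma>" "nrm (\<gamma> 0) \<le> \<rho>" "\<rho> \<le> nrm (\<gamma> 1)"
  shows "\<exists>t. 0 \<le> t \<and> t \<le> 1 \<and> nrm (\<gamma> t) = \<rho>"
  using IVT'[of "\<lambda>t. nrm (\<gamma> t)" 0 \<rho> 1] cpath_nrm[OF assms(1)] assms by auto

lemma cpath_crosses':
  assumes "cpath \<gamma>" "\<rho> \<le> nrm (\<gamma> 0)" "nrm (\<gamma> 1) \<le> \<rho>"
  shows "\<exists>t. 0 \<le> t \<and> t \<le> 1 \<and> nrm (\<gamma> t) = \<rho>"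
  using IVT2'[of "\<lambda>t. nrm (\<gamma> t)" 1 \<rho> 0] cpath_nrm[OF assms(1)] assms by auto

text \<open>The path \<open>t \<mapsto> t w\<close> is deformed by iterating an explicit gradient step, whose length is cut off
  where the gradient is small. Every deformed path still crosses the sphere; by compactness of the
  parameter interval, one parameter stays above level \<open>c\<close> under all iterates, so its orbit
  cannot keep descending.\<close>

lemma mountain_pass_approx:
  assumes w: "w \<in> H" and \<rho>: "0 < \<rho>" "\<rho> < nrm w"
    and barrier: "\<And>u. u \<in> H \<Longrightarrow> nrm u = \<rho> \<Longrightarrow> c \<le> E u" and c: "0 < c" "E w < c"
    and top: "\<And>t. 0 \<le> t \<Longrightarrow> t \<le> 1 \<Longrightarrow> E (\<lambda>x. t * w x) \<le> L"
    and bd: "\<And>u. u \<in> H \<Longrightarrow> E u \<le> L \<Longrightarrow> nrm u \<le> B" and \<epsilon>: "0 < \<epsilon>" "\<epsilon> \<le> 1"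
  shows "\<exists>u\<in>H. c \<le> E u \<and> E u \<le> L \<and> nrm (grad u) \<le> 2 * \<epsilon>"
proof -
  obtain \<tau> where \<tau>: "0 < \<tau>" "\<tau> \<le> 1" and desc: "\<And>u s. u \<in> H \<Longrightarrow> nrm u \<le> B \<Longrightarrow> \<epsilon> \<le> nrm (grad u) \<Longrightarrow>
     0 \<le> s \<Longrightarrow> s \<le> \<tau> \<Longrightarrow> E (lin 1 u (-s) (grad u)) \<le> E u - s / 4 * (nrm (grad u))\<^sup>2"
    by (rule descent[OF \<epsilon>(1), of B]) (rule that)
  define s where "s = step_size \<tau> \<epsilon>"
  have s: "0 \<le> s u" "s u \<le> \<tau>" for u using step_size_bounds[OF \<tau>(1)] by (auto simp: s_def)
  have s0: "s u = 0" if "\<not> \<epsilon> \<le> nrm (grad u)" for u using that by (auto simp: s_def step_size_def)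
  \<comment> \<open>The factor \<open>r\<close> gives the estimate on the whole segment to the next
    iterate and not only at its end, because crossings of the sphere in between must be
    excluded.\<close>
  have desc': "E (lin 1 u (- (r * s u)) (grad u)) \<le> E u - r * s u / 4 * \<epsilon>\<^sup>2"
    if u: "u \<in> H" "E u \<le> L" and r: "0 \<le> r" "r \<le> 1" for u r
  proof (cases "\<epsilon> \<le> nrm (grad u)")
    case True
    have "r * s u \<le> 1 * \<tau>" using s r \<tau> by (intro mult_mono) auto
    then have "E (lin 1 u (- (r * s u)) (grad u)) \<le> E u - r * s u / 4 * (nrm (grad u))\<^sup>2"
      using s r bd[OF u] True u by (intro desc) auto
    also have "\<dots> \<le> E u - r * s u / 4 * \<epsilon>\<^sup>2"
      using s[of u] r True \<epsilon> by (intro diff_left_mono mult_left_mono power_mono) auto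
    finally show ?thesis .
  next
    case False
    then have "lin 1 u (- (r * s u)) (grad u) = u" using s0 by (simp add: lin_def)
    then show ?thesis using s0[OF False] by simp
  qed
  have mono: "E (step \<tau> \<epsilon> u) \<le> E u - s u / 4 * \<epsilon>\<^sup>2" if "u \<in> H" "E u \<le> L" for u
    using desc'[OF that, of 1] by (simp add: step_def s_def)
  have mono0: "E (step \<tau> \<epsilon> u) \<le> E u" if "u \<in> H" "E u \<le> L" for u
  proof -
    have "0 \<le> s u / 4 * \<epsilon>\<^sup>2" using s[of u] by simp
    then show ?thesis using mono[OF that] by linarith
  qed
  have seg: "E (lin 1 u (- s u * r) (grad u)) < c" if "u \<in> H" "E u \<le> L" "E u < c" "0 \<le> r" "r \<le> 1" for u r
  proof -
    have "0 \<le> r * s u / 4 * \<epsilon>\<^sup>2" using s[of u] that by simp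
    then show ?thesis using desc'[of u r] that by (simp add: mult.commute)
  qed
  \<comment> \<open>A discrete step might jump across the sphere. If it did, its segment would meet
    the sphere below level \<open>c\<close>, against \<open>barrier\<close>.\<close>
  have in_stays: "nrm (step \<tau> \<epsilon> u) < \<rho>" if u: "u \<in> H" "E u \<le> L" "E u < c" "nrm u < \<rho>" for u
  proof (rule ccontr)
    assume "\<not> ?thesis"
    then have "\<exists>t. 0 \<le> t \<and> t \<le> 1 \<and> nrm (lin 1 u (- s u * t) (grad u)) = \<rho>"
      using u cpath_line[OF u(1) grad_in[OF u(1)], of "- s u"]
      by (intro cpath_crosses) (auto simp: step_def s_def lin_def)
    then show False using seg[OF u(1-3)] barrier[of "lin 1 u (- s u * t) (grad u)" for t] u by fastforce
  qed
  have out_stays: "\<rho> < nrm (step \<tau> \<epsilon> u)" if u: "u \<in> H" "E u \<le> L" "E u < c" "\<rho> < nrm u" for u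
  proof (rule ccontr)
    assume "\<not> ?thesis"
    then have "\<exists>t. 0 \<le> t \<and> t \<le> 1 \<and> nrm (lin 1 u (- s u * t) (grad u)) = \<rho>"
      using u cpath_line[OF u(1) grad_in[OF u(1)], of "- s u"]
      by (intro cpath_crosses') (auto simp: step_def s_def lin_def)
    then show False using seg[OF u(1-3)] barrier[of "lin 1 u (- s u * t) (grad u)" for t] u by fastforce
  qed
  define \<gamma> where "\<gamma> i t = (step \<tau> \<epsilon> ^^ i) (lin 1 (\<lambda>x. 0) (1 * t) w)" for i :: nat and t
  have \<gamma>S: "\<gamma> (Suc i) t = step \<tau> \<epsilon> (\<gamma> i t)" for i t by (simp add: \<gamma>_def)
  have cp: "cpath (\<gamma> i)" for i
  proof (induction i)
    case 0
    show ?case using cpath_line[OF H_zero w, of 1] by (simp add: \<gamma>_def)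
  next
    case (Suc i)
    then show ?case using cpath_step[of "\<gamma> i"] by (simp add: \<gamma>S)
  qed
  have \<gamma>H: "\<gamma> i t \<in> H" for i t using cp by (auto simp: cpath_def)
  have \<gamma>L: "E (\<gamma> i t) \<le> L" if "0 \<le> t" "t \<le> 1" for i t
  proof (induction i)
    case 0
    then show ?case using top[OF that] by (simp add: \<gamma>_def lin_def)
  next
    case (Suc i)
    then show ?case using mono0[OF \<gamma>H Suc] by (simp add: \<gamma>S)
  qed
  have dec: "E (\<gamma> (i + k) t) \<le> E (\<gamma> i t)" if "0 \<le> t" "t \<le> 1" for i k t
  proof (induction k)
    case (Suc k)
    then show ?case using mono0[OF \<gamma>H \<gamma>L[OF that, of "i + k"]] by (simp add: \<gamma>S)
  qed simp
  have start: "nrm (\<gamma> i 0) < \<rho> \<and> E (\<gamma> i 0) < c" for i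
  proof (induction i)
    case 0
    show ?case using E_zero c \<rho> W_zero by (simp add: \<gamma>_def lin_def nrm_def)
  next
    case (Suc i)
    have "E (\<gamma> i 0) \<le> L" by (rule \<gamma>L) auto
    then show ?case using in_stays[OF \<gamma>H, of i 0] mono0[OF \<gamma>H, of i 0] Suc by (simp add: \<gamma>S)
  qed
  have fin: "\<rho> < nrm (\<gamma> i 1) \<and> E (\<gamma> i 1) < c" for i
  proof (induction i)
    case 0
    show ?case using c \<rho> by (simp add: \<gamma>_def lin_def)
  next
    case (Suc i)
    have "E (\<gamma> i 1) \<le> L" by (rule \<gamma>L) auto
    then show ?case using out_stays[OF \<gamma>H, of i 1] mono0[OF \<gamma>H, of i 1] Suc by (simp add: \<gamma>S)
  qed
  have "\<exists>t. 0 \<le> t \<and> t \<le> 1 \<and> nrm (\<gamma> i t) = \<rho>" for i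
    using start[of i] fin[of i] by (intro cpath_crosses cp) auto
  then have "\<exists>t. 0 \<le> t \<and> t \<le> 1 \<and> c \<le> E (\<gamma> i t)" for i using barrier[OF \<gamma>H] by blast
  then obtain T where T: "\<And>i. 0 \<le> T i" "\<And>i. T i \<le> 1" "\<And>i. c \<le> E (\<gamma> i (T i))" by metis
  have "\<forall>i. T i \<in> {0..1}" using T by simp
  with compact_Icc[of 0 "1::real"] obtain t k where t: "t \<in> {0..1}" "strict_mono (k :: nat \<Rightarrow> nat)" "(T \<circ> k) \<longlonglongrightarrow> t"
    unfolding compact_def by blast
  have above: "c \<le> E (\<gamma> i t)" for i
  proof -
    have "(\<lambda>j. dst (\<gamma> i ((T \<circ> k) j)) (\<gamma> i t)) \<longlonglongrightarrow> 0" using cp[of i] t(3) unfolding cpath_def by blast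
    then have "(\<lambda>j. E (\<gamma> i ((T \<circ> k) j))) \<longlonglongrightarrow> E (\<gamma> i t)" by (intro E_tendsto \<gamma>H)
    \<comment> \<open>Energies decrease under iteration, so \<open>T (k j)\<close> is above
      \<open>c\<close> already at the earlier iterate \<open>i\<close>.\<close>
    moreover have "\<forall>\<^sub>F j in sequentially. c \<le> E (\<gamma> i ((T \<circ> k) j))"
    proof (rule eventually_sequentiallyI[of i])
      fix j assume "i \<le> j"
      then have "i \<le> k j" using seq_suble[OF t(2), of j] by simp
      then show "c \<le> E (\<gamma> i ((T \<circ> k) j))"
        using dec[of "T (k j)" i "k j - i"] T(1,2)[of "k j"] T(3)[of "k j"] by simp
    qed
    ultimately show ?thesis by (rule tendsto_lowerbound) simp
  qed
  have "\<exists>i. s (\<gamma> i t) < \<tau> * \<epsilon>"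
  proof (rule ccontr)
    assume "\<nexists>i. s (\<gamma> i t) < \<tau> * \<epsilon>"
    then have big: "\<tau> * \<epsilon> \<le> s (\<gamma> i t)" for i by (simp add: not_less)
    \<comment> \<open>The guaranteed drop per iteration; after finitely many iterations the energy
      would fall below \<open>c\<close>.\<close>
    define \<theta> where "\<theta> = \<tau> * \<epsilon> / 4 * \<epsilon>\<^sup>2"
    have \<theta>: "\<theta> > 0" using \<tau> \<epsilon> by (simp add: \<theta>_def)
    have le: "E (\<gamma> i t) \<le> L - real i * \<theta>" for i
    proof (induction i)
      case 0
      show ?case using \<gamma>L[of t 0] t by simp
    next
      case (Suc i)
      have "\<theta> \<le> s (\<gamma> i t) / 4 * \<epsilon>\<^sup>2" unfolding \<theta>_def using big[of i] by (intro mult_right_mono) auto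
      moreover have "E (\<gamma> i t) \<le> L" using \<gamma>L[of t i] t by simp
      ultimately show ?case using mono[OF \<gamma>H, of i t] Suc by (simp add: \<gamma>S algebra_simps)
    qed
    obtain i where "L - c < real i * \<theta>" using reals_Archimedean3[OF \<theta>] by blast
    then show False using le[of i] above[of i] by simp
  qed
  then obtain i where i: "s (\<gamma> i t) < \<tau> * \<epsilon>" by blast
  then have "min 1 (max 0 (nrm (grad (\<gamma> i t)) - \<epsilon>)) < \<epsilon>"
    using \<tau> by (simp add: s_def step_size_def)
  \<comment> \<open>As \<open>\<epsilon> \<le> 1\<close>, the cap 1 is not reached, so the excess of
    the gradient norm over \<open>\<epsilon>\<close> is below \<open>\<epsilon>\<close>.\<close>
  then have "nrm (grad (\<gamma> i t)) \<le> 2 * \<epsilon>" using \<epsilon> by (auto simp: min_def max_def split: if_splits)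
  then show ?thesis using above[of i] \<gamma>L[of t i] t \<gamma>H by auto
qed

section \<open>Existence of critical points\<close>

lemma nrm_grad_zero_critical: assumes "u \<in> H" "nrm (grad u) = 0" shows "critical u"
  unfolding critical_def
proof (intro conjI ballI assms)
  fix v assume v: "v \<in> H"
  have "W (grad u) v = 0" using Cauchy_Schwarz[OF grad_in[OF assms(1)] v] assms(2) by simp
  then show "W u v = (\<integral>x. h x (u x) * v x \<partial>M)" using assms v by (simp add: grad_def W_R)
qed

lemma Palais_Smale_limit:
  assumes U: "\<And>n. U n \<in> H" "\<And>n. nrm (U n) \<le> B" and g: "(\<lambda>n. nrm (grad (U n))) \<longlonglongrightarrow> 0"
    and E: "\<And>n. c \<le> E (U n)" "\<And>n. E (U n) \<le> L"
  shows "\<exists>u. critical u \<and> c \<le> E u \<and> E u \<le> L"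
proof -
  have "W (U n) (U n) \<le> B\<^sup>2" for n
    using power_mono[OF U(2)[of n], of 2] U(1)[of n] by (simp add: nrm_sq)
  with U(1) obtain k u where k: "strict_mono (k :: nat \<Rightarrow> nat)" and u: "u \<in> H"
    and l: "uniform_limit V (\<lambda>n. U (k n)) u sequentially"
    using bounded_subsequence[of U "B\<^sup>2"] by blast
  \<comment> \<open>The limit in energy is \<open>R u\<close>: each \<open>U (k n)\<close> is the
    sum of its gradient, which tends to 0, and of \<open>R (U (k n))\<close>, which tends to
    \<open>R u\<close>. Both limits agree on \<open>V\<close>, so \<open>v\<close> solves the
    equation.\<close>
  define v where "v = R u"
  have v: "v \<in> H" using u by (simp add: v_def)
  have d: "(\<lambda>n. dst (U (k n)) v) \<longlonglongrightarrow> 0"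
  proof (rule Lim_null_comparison)
    have "dst a v \<le> nrm (grad a) + dst (R a) v" if "a \<in> H" for a
      using dst_triangle[of a "R a" v] that v by (simp add: grad_def dst_def)
    then show "\<forall>\<^sub>F n in sequentially. norm (dst (U (k n)) v) \<le> nrm (grad (U (k n))) + dst (R (U (k n))) (R u)"
      using U v by (intro always_eventually) (auto simp: v_def)
    have "(\<lambda>n. nrm (grad (U (k n))) + dst (R (U (k n))) (R u)) \<longlonglongrightarrow> 0 + 0"
      using LIMSEQ_subseq_LIMSEQ[OF g k] U(1) u l by (intro tendsto_add R_tendsto) (auto simp: o_def)
    then show "(\<lambda>n. nrm (grad (U (k n))) + dst (R (U (k n))) (R u)) \<longlonglongrightarrow> 0" by simp
  qed
  have ul: "uniform_limit V (\<lambda>n. U (k n)) v sequentially" by (intro dst_tendsto_uniform U v d)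
  have uv: "u x = v x" if "x \<in> V" for x
    using tendsto_uniform_limitI[OF l that] tendsto_uniform_limitI[OF ul that] LIMSEQ_unique by blast
  have "critical v" unfolding critical_def
  proof (intro conjI ballI v)
    fix z assume z: "z \<in> H"
    have "W v z = (\<integral>x. h x (u x) * z x \<partial>M)" unfolding v_def by (rule W_R[OF u z])
    also have "\<dots> = (\<integral>x. h x (v x) * z x \<partial>M)"
      by (rule Bochner_Integration.integral_cong) (simp_all add: uv space_M)
    finally show "W v z = (\<integral>x. h x (v x) * z x \<partial>M)" .
  qed
  moreover have "(\<lambda>n. E (U (k n))) \<longlonglongrightarrow> E v" by (intro E_tendsto U v d)
  then have "c \<le> E v" "E v \<le> L"
    using E by (auto intro: LIMSEQ_le_const LIMSEQ_le_const2)
  ultimately show ?thesis by blast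
qed

lemma mountain_pass:
  assumes w: "w \<in> H" and \<rho>: "0 < \<rho>" "\<rho> < nrm w"
    and barrier: "\<And>u. u \<in> H \<Longrightarrow> nrm u = \<rho> \<Longrightarrow> c \<le> E u" and c: "0 < c" "E w < c"
    and top: "\<And>t. 0 \<le> t \<Longrightarrow> t \<le> 1 \<Longrightarrow> E (\<lambda>x. t * w x) \<le> L"
    and bd: "\<And>u. u \<in> H \<Longrightarrow> E u \<le> L \<Longrightarrow> nrm u \<le> B"
  shows "\<exists>u. critical u \<and> c \<le> E u \<and> E u \<le> L"
proof -
  have "\<exists>u\<in>H. c \<le> E u \<and> E u \<le> L \<and> nrm (grad u) \<le> 2 * (1 / real (Suc n))" for n
    by (rule mountain_pass_approx[OF w \<rho> barrier c top bd]) auto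
  then obtain U where U: "\<And>n. U n \<in> H" "\<And>n. c \<le> E (U n)" "\<And>n. E (U n) \<le> L"
    and g: "\<And>n. nrm (grad (U n)) \<le> 2 * (1 / real (Suc n))" by metis
  have "(\<lambda>n. nrm (grad (U n))) \<longlonglongrightarrow> 0"
  proof (rule Lim_null_comparison)
    show "\<forall>\<^sub>F n in sequentially. norm (nrm (grad (U n))) \<le> 2 * (1 / real (Suc n))"
      using g U(1) by (intro always_eventually) auto
    show "(\<lambda>n. 2 * (1 / real (Suc n))) \<longlonglongrightarrow> 0"
      using tendsto_mult[OF tendsto_const LIMSEQ_inverse_real_of_nat, of 2] by (simp add: inverse_eq_divide)
  qed
  then show ?thesis using U bd by (intro Palais_Smale_limit[of U B]) auto
qed

text \<open>\<open>E\<close> vanishes at 0 and is positive on the sphere, so the minimiser lies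
  inside, where a nonzero gradient would allow a short descent step within the ball. Applied to the
  small ball, and again to a ball so large that coercivity provides the barrier.\<close>

lemma ball_critical:
  assumes \<rho>: "0 < \<rho>" and barrier: "\<And>u. u \<in> H \<Longrightarrow> nrm u = \<rho> \<Longrightarrow> 0 < E u"
  shows "\<exists>u. critical u \<and> nrm u < \<rho> \<and> (\<forall>v\<in>H. nrm v \<le> \<rho> \<longrightarrow> E u \<le> E v)"
proof -
  have ball: "W v v \<le> \<rho>\<^sup>2 \<longleftrightarrow> nrm v \<le> \<rho>" if "v \<in> H" for v
    using \<rho> by (simp add: nrm_def real_sqrt_le_iff' real_le_lsqrt sqrt_le_D W_nonneg[OF that])
  obtain Q where "Q > 0" and Q: "\<And>x t. x \<in> V \<Longrightarrow> \<bar>t\<bar> \<le> C * \<rho> \<Longrightarrow> \<bar>h x t\<bar> \<le> Q"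
    by (rule h_bounded[of "C * \<rho>"]) (rule that)
  have "\<exists>u\<in>H. W u u \<le> \<rho>\<^sup>2 \<and> (\<forall>v\<in>H. W v v \<le> \<rho>\<^sup>2 \<longrightarrow> W u u / 2 - J u \<le> W v v / 2 - J v)"
  proof (rule ball_minimizer)
    fix u assume u: "u \<in> H" "W u u \<le> \<rho>\<^sup>2"
    have ux: "\<bar>u x\<bar> \<le> C * \<rho>" if "x \<in> V" for x
    proof -
      have "C * nrm u \<le> C * \<rho>" using u ball C_pos by simp
      then show ?thesis using sup_bound_nrm[OF u(1) that] by linarith
    qed
    show "J u \<le> Q * (C * \<rho>)" unfolding J_def
    proof (rule integral_le[OF comp_cont(2)[OF H_cont[OF u(1)]]])
      fix x assume x: "x \<in> V"
      have "\<bar>P x (u x) - P x 0 - 0 * (u x - 0)\<bar> \<le> Q * \<bar>u x - 0\<bar>"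
        by (rule P_lipschitz[of "C * \<rho>"]) (use Q[OF x] x ux C_pos \<rho> in auto)
      also have "\<dots> \<le> Q * (C * \<rho>)" using ux[OF x] \<open>Q > 0\<close> by simp
      finally show "P x (u x) \<le> Q * (C * \<rho>)" using P_zero[OF x] by simp
    qed
  qed (use J_uniform_limit(1) in auto)
  then obtain u where u: "u \<in> H" "nrm u \<le> \<rho>" and min: "\<And>v. v \<in> H \<Longrightarrow> nrm v \<le> \<rho> \<Longrightarrow> E u \<le> E v"
    using ball by (auto simp: E_def)
  have "E u \<le> 0" using min[OF H_zero] E_zero \<rho> W_zero by (simp add: nrm_def)
  then have lt: "nrm u < \<rho>" using barrier[OF u(1)] u(2) by force
  have "nrm (grad u) = 0"
  proof (rule ccontr)
    assume "nrm (grad u) \<noteq> 0"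
    then have pos: "0 < nrm (grad u)" using nrm_nonneg[OF grad_in[OF u(1)]] by linarith
    obtain \<tau> where \<tau>: "0 < \<tau>" "\<tau> \<le> 1" and desc: "\<And>v s. v \<in> H \<Longrightarrow> nrm v \<le> \<rho> \<Longrightarrow> nrm (grad u) \<le> nrm (grad v) \<Longrightarrow>
       0 \<le> s \<Longrightarrow> s \<le> \<tau> \<Longrightarrow> E (lin 1 v (-s) (grad v)) \<le> E v - s / 4 * (nrm (grad v))\<^sup>2"
      by (rule descent[OF pos, of \<rho>]) (rule that)
    \<comment> \<open>Short enough to stay in the ball.\<close>
    define s where "s = min \<tau> ((\<rho> - nrm u) / nrm (grad u))"
    have s: "0 < s" "s \<le> \<tau>" using \<tau> lt pos by (auto simp: s_def)
    have "nrm (lin 1 u (-s) (grad u)) \<le> nrm u + s * nrm (grad u)"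
      using nrm_lin[OF u(1) grad_in[OF u(1)], of 1 "-s"] s by simp
    also have "s * nrm (grad u) \<le> (\<rho> - nrm u) / nrm (grad u) * nrm (grad u)"
      using pos by (intro mult_right_mono) (auto simp: s_def)
    also have "\<dots> = \<rho> - nrm u" using pos by simp
    finally have "nrm (lin 1 u (-s) (grad u)) \<le> \<rho>" by simp
    then have "E u \<le> E (lin 1 u (-s) (grad u))" using u by (intro min) auto
    moreover have "E (lin 1 u (-s) (grad u)) \<le> E u - s / 4 * (nrm (grad u))\<^sup>2"
      using u s by (intro desc) auto
    moreover have "0 < s / 4 * (nrm (grad u))\<^sup>2" using s pos by simp
    ultimately show False by linarith
  qed
  then have "critical u" by (rule nrm_grad_zero_critical[OF u(1)])
  then show ?thesis using lt min by blast
qed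

text \<open>The levels are ordered \<open>E u\<^sub>2 < d \<le> E u\<^sub>1 \<le> 0 < c \<le> E
  u\<^sub>3\<close>; the gap below \<open>d\<close> comes from \<open>w\<close>, which lies below
  all values on the small ball. By \<open>E_cong\<close>, different levels give functions that
  differ on \<open>V\<close>.\<close>

theorem three_critical_points:
  assumes w: "w \<in> H" and \<rho>: "0 < \<rho>" "\<rho> < nrm w"
    and barrier: "\<And>u. u \<in> H \<Longrightarrow> nrm u = \<rho> \<Longrightarrow> c \<le> E u" and c: "0 < c"
    and inner: "\<And>u. u \<in> H \<Longrightarrow> nrm u \<le> \<rho> \<Longrightarrow> d \<le> E u" and Ew: "E w < d"
    and top: "\<And>t. 0 \<le> t \<Longrightarrow> t \<le> 1 \<Longrightarrow> E (\<lambda>x. t * w x) \<le> L"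
    and bd: "\<And>u. u \<in> H \<Longrightarrow> E u \<le> L \<Longrightarrow> nrm u \<le> B"
  shows "\<exists>u\<^sub>1 u\<^sub>2 u\<^sub>3. (\<forall>u\<in>{u\<^sub>1, u\<^sub>2, u\<^sub>3}. critical u \<and> nrm u \<le> B) \<and>
    (\<exists>x\<in>V. u\<^sub>1 x \<noteq> u\<^sub>2 x) \<and> (\<exists>x\<in>V. u\<^sub>1 x \<noteq> u\<^sub>3 x) \<and> (\<exists>x\<in>V. u\<^sub>2 x \<noteq> u\<^sub>3 x)"
proof -
  have crit_H: "u \<in> H" if "critical u" for u using that by (simp add: critical_def)
  have L0: "0 \<le> L" using top[of 0] E_zero by simp
  have nz: "nrm (\<lambda>x. 0) = 0" using W_zero by (simp add: nrm_def)
  have d0: "d \<le> 0" using inner[OF H_zero] nz E_zero \<rho> by simp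
  obtain u\<^sub>1 where u1: "critical u\<^sub>1" "nrm u\<^sub>1 < \<rho>" "\<And>v. v \<in> H \<Longrightarrow> nrm v \<le> \<rho> \<Longrightarrow> E u\<^sub>1 \<le> E v"
    using ball_critical[OF \<rho>(1)] barrier c by force
  have E1: "d \<le> E u\<^sub>1" "E u\<^sub>1 \<le> 0"
    using inner[OF crit_H[OF u1(1)]] u1(2) u1(3)[OF H_zero] nz \<rho> E_zero by auto
  have B0: "0 \<le> B" using bd[OF H_zero] E_zero L0 nz by simp
  \<comment> \<open>Where the norm exceeds \<open>B\<close> the energy exceeds
    \<open>L \<ge> 0\<close>, so this sphere is a barrier as well.\<close>
  have "0 < E u" if "u \<in> H" "nrm u = B + 1" for u using bd[OF that(1)] that(2) L0 by force
  then obtain u\<^sub>2 where u2: "critical u\<^sub>2" "\<And>v. v \<in> H \<Longrightarrow> nrm v \<le> B + 1 \<Longrightarrow> E u\<^sub>2 \<le> E v"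
    using ball_critical[of "B + 1"] B0 by force
  have "nrm w \<le> B" using Ew d0 L0 by (intro bd w) simp
  then have E2: "E u\<^sub>2 < d" using u2(2)[OF w] Ew by simp
  have "E w < c" using Ew d0 c by simp
  then obtain u\<^sub>3 where u3: "critical u\<^sub>3" "c \<le> E u\<^sub>3" "E u\<^sub>3 \<le> L"
    using mountain_pass[OF w \<rho> barrier c _ top bd] by blast
  have neq: "\<exists>x\<in>V. u x \<noteq> v x" if "critical u" "critical v" "E u \<noteq> E v" for u v
    using E_cong[OF crit_H[OF that(1)] crit_H[OF that(2)]] that(3) by blast
  have nb: "nrm u \<le> B" if "critical u" "E u \<le> L" for u using bd crit_H that by blast
  show ?thesis
  proof (intro exI conjI neq)
    show "\<forall>u\<in>{u\<^sub>1, u\<^sub>2, u\<^sub>3}. critical u \<and> nrm u \<le> B"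
      using u1(1) u2(1) u3 E1 E2 d0 L0 nb[OF u1(1)] nb[OF u2(1)] nb[OF u3(1)] by auto
  qed (use E1 E2 u1(1) u2(1) u3(1,2) c d0 in auto)
qed

end

section \<open>Geometry of the gasket\<close>

locale simplex_gasket =
  fixes N :: nat and p :: "nat \<Rightarrow> 'a::euclidean_space"
  assumes N2: "2 \<le> N"
    and dist_p: "\<And>i j. i \<in> {1..N} \<Longrightarrow> j \<in> {1..N} \<Longrightarrow> i \<noteq> j \<Longrightarrow> norm (p i - p j) = 1"
begin

section \<open>The attractor and its vertex sets\<close>

definition I :: "nat set" where "I = {1..N}"
abbreviation S :: "nat \<Rightarrow> 'a \<Rightarrow> 'a" where "S \<equiv> gasket_map p"
abbreviation V :: "'a set" where "V \<equiv> gasket N p"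
abbreviation vert :: "nat \<Rightarrow> 'a set" where "vert \<equiv> gasket_vertices N p"

lemma finite_I [simp]: "finite I" and card_I [simp]: "card I = N" and one_in_I: "1 \<in> I"
  using N2 by (auto simp: I_def)

lemma dist_pI: "i \<in> I \<Longrightarrow> j \<in> I \<Longrightarrow> i \<noteq> j \<Longrightarrow> norm (p i - p j) = 1"
  using dist_p by (simp add: I_def)

lemma vert_0 [simp]: "vert 0 = p ` I" and vert_Suc_UN [simp]: "vert (Suc m) = (\<Union>i\<in>I. S i ` vert m)"
  by (simp_all add: I_def)

declare gasket_vertices.simps [simp del]

lemma S_diff: "S i x - S i y = (1/2) *\<^sub>R (x - y)"
  by (simp add: gasket_map_def algebra_simps)

lemma dist_S: "dist (S i x) (S i y) = dist x y / 2"
  by (simp add: dist_norm S_diff)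

lemma S_eq_iff [simp]: "S i x = S i y \<longleftrightarrow> x = y"
  by (simp add: gasket_map_def)

lemma S_fix [simp]: "S i (p i) = p i"
  by (simp add: gasket_map_def flip: scaleR_add_left)

lemma S_comm: "S i (p j) = S j (p i)"
  by (simp add: gasket_map_def add.commute)

lemma cont_S: "continuous_on A (S i)"
  unfolding gasket_map_def by (intro continuous_intros)

definition hutch :: "'a set \<Rightarrow> 'a set" where "hutch A = (\<Union>i\<in>I. S i ` A)"

lemma hutch_mono: "A \<subseteq> B \<Longrightarrow> hutch A \<subseteq> hutch B"
  by (auto simp: hutch_def)

lemma compact_hutch: "compact A \<Longrightarrow> compact (hutch A)"
  unfolding hutch_def by (intro compact_UN compact_continuous_image cont_S) auto

text \<open>A point of \<open>K\<close> farthest from \<open>T\<close> is \<open>S i y\<close> with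
  \<open>y\<close> in \<open>K\<close>, so its distance is at most half that of \<open>y\<close>,
  and the maximum must be 0. This one comparison yields uniqueness of the attractor, its inclusion
  in the simplex and the density of the vertices.\<close>

lemma hutch_attracted:
  assumes K: "compact K" "K \<subseteq> hutch K" and T: "T \<noteq> {}" "hutch T \<subseteq> T"
  shows "K \<subseteq> closure T"
proof (cases "K = {}")
  case False
  then obtain x where x: "x \<in> K" "\<And>y. y \<in> K \<Longrightarrow> infdist y T \<le> infdist x T"
    using continuous_attains_sup[OF K(1) False, of "\<lambda>x. infdist x T"] continuous_on_infdist[OF continuous_on_id, of K T]
    by blast
  then obtain i y where y: "i \<in> I" "y \<in> K" "x = S i y" using K by (auto simp: hutch_def)
  have "2 * infdist x T \<le> infdist y T"
    unfolding infdist_notempty[OF T(1), of y]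
  proof (rule cINF_greatest[OF T(1)])
    fix t assume "t \<in> T"
    then have "infdist x T \<le> dist x (S i t)" using T y by (intro infdist_le) (auto simp: hutch_def)
    then show "2 * infdist x T \<le> dist y t" by (simp add: y dist_S)
  qed
  with x(2)[OF y(2)] have "infdist x T \<le> 0" by simp
  then have "infdist z T = 0" if "z \<in> K" for z using x(2)[OF that] infdist_nonneg[of z T] by simp
  then show ?thesis using in_closure_iff_infdist_zero[OF T(1)] by auto
qed simp

abbreviation hull0 :: "'a set" where "hull0 \<equiv> convex hull (p ` I)"

lemma S_hull: assumes "i \<in> I" "x \<in> hull0" shows "S i x \<in> hull0"
  unfolding gasket_map_def
  by (rule convexD[OF convex_convex_hull assms(2)]) (use assms hull_inc[of "p i" "p ` I" convex] in auto)

text \<open>Resolves the \<open>THE\<close> in \<open>gasket\<close>. Existence: the intersection of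
  the decreasing images of the simplex. Uniqueness: \<open>hutch_attracted\<close> in both
  directions.\<close>

lemma gasket_props: "compact V" "V \<noteq> {}" "V = hutch V"
proof -
  define K where "K n = (hutch ^^ n) hull0" for n
  have KS: "K (Suc n) = hutch (K n)" for n by (simp add: K_def)
  have cK: "compact (K n)" for n
  proof (induction n)
    case 0
    show ?case by (simp add: K_def compact_convex_hull finite_imp_compact)
  qed (simp add: KS compact_hutch)
  have dec: "K (Suc n) \<subseteq> K n" for n
  proof (induction n)
    case 0
    show ?case using S_hull by (auto simp: K_def hutch_def)
  next
    case (Suc n)
    then show ?case using hutch_mono by (simp add: KS)
  qed
  have anti: "K n \<subseteq> K m" if "m \<le> n" for m n using lift_Suc_antimono_le[of K, OF dec that] .
  have p1: "p 1 \<in> K n" for n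
  proof (induction n)
    case 0
    show ?case using one_in_I by (auto simp: K_def intro!: hull_inc)
  next
    case (Suc n)
    have "S 1 (p 1) \<in> hutch (K n)" using Suc one_in_I unfolding hutch_def by blast
    then show ?case by (simp add: KS)
  qed
  define X where "X = (\<Inter>n. K n)"
  have X1: "compact X" unfolding X_def by (rule compact_Inter) (auto simp: cK)
  have X2: "X \<noteq> {}" using p1 by (auto simp: X_def)
  have X3: "X = hutch X"
  proof
    show "hutch X \<subseteq> X"
    proof
      fix x assume "x \<in> hutch X"
      then obtain i y where "i \<in> I" "\<And>n. y \<in> K n" "x = S i y" by (auto simp: hutch_def X_def)
      then have "x \<in> K (Suc n)" for n unfolding KS hutch_def by blast
      then show "x \<in> X" using dec by (auto simp: X_def)
    qed
    \<comment> \<open>Each \<open>S i\<close> has a single preimage \<open>y i\<close> of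
      \<open>x\<close>. If every \<open>y i\<close> leaves the decreasing sets at some stage, then
      at the largest of these stages no preimage is left, although \<open>x\<close> lies in the next
      image.\<close>
    show "X \<subseteq> hutch X"
    proof (rule ccontr)
      assume "\<not> X \<subseteq> hutch X"
      then obtain x where x: "\<And>n. x \<in> K n" "x \<notin> hutch X" by (auto simp: X_def)
      define y where "y i = 2 *\<^sub>R x - p i" for i
      have Sy: "S i (y i) = x" for i by (simp add: y_def gasket_map_def scaleR_diff_right)
      have "\<exists>n. y i \<notin> K n" if "i \<in> I" for i
      proof (rule ccontr)
        assume "\<nexists>n. y i \<notin> K n"
        then have "y i \<in> X" by (auto simp: X_def)
        then have "S i (y i) \<in> hutch X" using that unfolding hutch_def by blast
        then show False using x Sy by simp
      qed
      then obtain n where n: "\<And>i. i \<in> I \<Longrightarrow> y i \<notin> K (n i)" by metis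
      define m where "m = Max (n ` I)"
      have "n i \<le> m" if "i \<in> I" for i using that by (auto simp: m_def)
      then have nm: "y i \<notin> K m" if "i \<in> I" for i using n[OF that] anti that by blast
      from x(1)[of "Suc m"] obtain i z where iz: "i \<in> I" "z \<in> K m" "x = S i z" unfolding KS hutch_def by blast
      then have "z = y i" using Sy[of i] by (metis S_eq_iff)
      then show False using nm iz by simp
    qed
  qed
  have "\<exists>!A. compact A \<and> A \<noteq> {} \<and> A = (\<Union>i\<in>I. S i ` A)"
  proof (rule ex1I[of _ X])
    show "compact X \<and> X \<noteq> {} \<and> X = (\<Union>i\<in>I. S i ` X)" using X1 X2 X3 by (simp add: hutch_def)
    fix A assume A: "compact A \<and> A \<noteq> {} \<and> A = (\<Union>i\<in>I. S i ` A)"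
    then have hA: "A = hutch A" by (simp add: hutch_def)
    have "A \<subseteq> closure X" using A hA X2 X3 by (intro hutch_attracted) auto
    moreover have "X \<subseteq> closure A" using A hA X1 X3 by (intro hutch_attracted) auto
    moreover have "closure X = X" "closure A = A" using X1 A compact_imp_closed closure_closed by blast+
    ultimately show "A = X" by auto
  qed
  from theI'[OF this] show "compact V" "V \<noteq> {}" "V = hutch V"
    unfolding gasket_def[symmetric] hutch_def I_def by auto
qed

lemma closed_V: "closed V" using gasket_props(1) by (rule compact_imp_closed)

lemma S_in_V: "i \<in> I \<Longrightarrow> x \<in> V \<Longrightarrow> S i x \<in> V"
  using gasket_props(3) unfolding hutch_def by blast

lemma V_cases: assumes "x \<in> V" obtains i y where "i \<in> I" "y \<in> V" "x = S i y"
  using assms gasket_props(3) unfolding hutch_def by blast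

lemma p_in_V: assumes "i \<in> I" shows "p i \<in> V"
proof -
  have "{p i} \<subseteq> hutch {p i}" using assms S_fix[of i] by (auto simp: hutch_def intro!: bexI[of _ i])
  then have "{p i} \<subseteq> closure V" using gasket_props by (intro hutch_attracted) auto
  then show ?thesis using closed_V by simp
qed

lemma V_in_hull: "V \<subseteq> hull0"
proof -
  have "V \<subseteq> closure hull0"
    by (rule hutch_attracted) (use gasket_props one_in_I S_hull in \<open>auto simp: hutch_def\<close>)
  then show ?thesis using compact_imp_closed[OF compact_convex_hull[of "p ` I"]]
    by (simp add: finite_imp_compact)
qed

lemma vert_Suc: "vert (Suc m) = hutch (vert m)"
  by (simp add: hutch_def)

lemma p_in_vert: "i \<in> I \<Longrightarrow> p i \<in> vert m"
proof (induction m)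
  case (Suc m)
  then have "S i (p i) \<in> vert (Suc m)" unfolding vert_Suc hutch_def by blast
  then show ?case by simp
qed simp

lemma vert_in_V: "vert m \<subseteq> V"
proof (induction m)
  case 0
  show ?case using p_in_V by auto
next
  case (Suc m)
  then show ?case using hutch_mono[OF Suc] gasket_props(3) unfolding vert_Suc by simp
qed

lemma finite_vert: "finite (vert m)"
  by (induction m) auto

lemma V_closure_vert: "V \<subseteq> closure (\<Union>m. vert m)"
proof (rule hutch_attracted)
  show "hutch (\<Union>m. vert m) \<subseteq> (\<Union>m. vert m)"
  proof
    fix x assume "x \<in> hutch (\<Union>m. vert m)"
    then obtain m where "x \<in> hutch (vert m)" by (auto simp: hutch_def)
    then have "x \<in> vert (Suc m)" by (simp only: vert_Suc)
    then show "x \<in> (\<Union>m. vert m)" by blast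
  qed
  show "(\<Union>m. vert m) \<noteq> {}" using p_in_vert[OF one_in_I, of 0] by blast
qed (use gasket_props in auto)

section \<open>Barycentric coordinates\<close>

text \<open>The scalar product of \<open>p i - cen\<close> and \<open>p j - cen\<close> is \<open>(\<delta>\<^sub>i\<^sub>j - 1/N) / 2\<close>, so \<open>bc i\<close> is the
  \<open>i\<close>-th barycentric coordinate.\<close>

definition cen :: 'a where "cen = (1 / real N) *\<^sub>R (\<Sum>i\<in>I. p i)"

definition bc :: "nat \<Rightarrow> 'a \<Rightarrow> real" where "bc i x = 1 / real N + 2 * ((x - cen) \<bullet> (p i - cen))"

lemma N_pos: "0 < real N" using N2 by simp

lemma sum_p_cen: "(\<Sum>i\<in>I. p i - cen) = 0"
  using N_pos by (simp add: sum_subtractf cen_def sum_constant_scaleR)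

lemma sum_bc: "(\<Sum>i\<in>I. bc i x) = 1"
proof -
  have "(\<Sum>i\<in>I. bc i x) = 1 + 2 * ((x - cen) \<bullet> (\<Sum>i\<in>I. p i - cen))"
    using N_pos by (simp add: bc_def sum.distrib sum_distrib_left inner_sum_right)
  then show ?thesis unfolding sum_p_cen by simp
qed

lemma bc_affine: "a + b = 1 \<Longrightarrow> bc i (a *\<^sub>R x + b *\<^sub>R y) = a * bc i x + b * bc i y"
proof -
  assume ab: "a + b = 1"
  have "a *\<^sub>R x + b *\<^sub>R y - cen = a *\<^sub>R (x - cen) + b *\<^sub>R (y - cen)"
    using ab by (simp add: algebra_simps flip: scaleR_add_left)
  then have "bc i (a *\<^sub>R x + b *\<^sub>R y) = (a + b) * (1 / real N) + 2 * (a * ((x - cen) \<bullet> (p i - cen)) + b * ((y - cen) \<bullet> (p i - cen)))"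
    by (simp only: ab bc_def inner_add_left inner_scaleR_left mult_1)
  also have "\<dots> = a * bc i x + b * bc i y" unfolding bc_def by algebra
  finally show ?thesis .
qed

lemma bc_p: assumes ij: "i \<in> I" "j \<in> I" shows "bc i (p j) = (if i = j then 1 else 0)"
proof -
  define d :: "nat \<Rightarrow> nat \<Rightarrow> real" where "d a b = (if a = b then 0 else 1)" for a b
  have dn: "(p a - p b) \<bullet> (p a - p b) = d a b" if "a \<in> I" "b \<in> I" for a b
    using dist_pI[OF that] by (auto simp: d_def dot_square_norm)
  have pc: "p a - cen = (1 / real N) *\<^sub>R (\<Sum>k\<in>I. p a - p k)" if "a \<in> I" for a
    using N_pos by (simp add: cen_def sum_subtractf sum_constant_scaleR algebra_simps)
  \<comment> \<open>Polarisation: scalar products of differences are expressed by squared distances,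
    which are all 0 or 1.\<close>
  have cross: "(p j - p k) \<bullet> (p i - p l) = (d j l + d k i - d j i - d k l) / 2" if "k \<in> I" "l \<in> I" for k l
    using that ij by (simp add: dn[symmetric] inner_diff_left inner_diff_right inner_commute field_simps)
  have sd: "(\<Sum>k\<in>I. d a k) = real N - 1" if "a \<in> I" for a
  proof -
    have "(\<Sum>k\<in>I. d a k) = (\<Sum>k\<in>I. 1) - (\<Sum>k\<in>I. if a = k then 1 else 0)"
      unfolding sum_subtractf[symmetric] by (intro sum.cong) (auto simp: d_def)
    then show ?thesis using that by simp
  qed
  have dsym: "d a b = d b a" for a b by (simp add: d_def)
  have "(p j - cen) \<bullet> (p i - cen) = (1 / real N)\<^sup>2 * (\<Sum>k\<in>I. \<Sum>l\<in>I. (p j - p k) \<bullet> (p i - p l))"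
  proof -
    have sw: "(\<Sum>l\<in>I. \<Sum>k\<in>I. (p j - p k) \<bullet> (p i - p l)) = (\<Sum>k\<in>I. \<Sum>l\<in>I. (p j - p k) \<bullet> (p i - p l))"
      by (rule sum.swap)
    show ?thesis unfolding pc[OF ij(1)] pc[OF ij(2)]
      by (simp add: inner_sum_left inner_sum_right power2_eq_square sw sum_divide_distrib[symmetric])
  qed
  also have "(\<Sum>k\<in>I. \<Sum>l\<in>I. (p j - p k) \<bullet> (p i - p l)) = (\<Sum>k\<in>I. \<Sum>l\<in>I. (d j l + d i k - d j i - d k l) / 2)"
    by (intro sum.cong refl) (simp add: cross dsym[of i])
  also have "\<dots> = (\<Sum>k\<in>I. (real N - 1) + real N * d i k - real N * d j i - (real N - 1)) / 2"
    using ij by (simp add: sum_divide_distrib[symmetric] sum.distrib sum_subtractf sd)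
  also have "\<dots> = (real N * (real N - 1) - (real N)\<^sup>2 * d j i) / 2"
    using ij by (simp add: sum.distrib sum_subtractf sum_distrib_left[symmetric] sd power2_eq_square algebra_simps)
  finally have "(p j - cen) \<bullet> (p i - cen) = (1 / real N)\<^sup>2 * ((real N * (real N - 1) - (real N)\<^sup>2 * d j i) / 2)" .
  also have "\<dots> = ((real N - 1) / real N - d j i) / 2"
    using N_pos by (simp add: field_simps power2_eq_square)
  finally have "bc i (p j) = 1 / real N + ((real N - 1) / real N - d j i)" by (simp add: bc_def)
  also have "\<dots> = 1 - d j i" using N_pos by (simp add: field_simps)
  finally show ?thesis by (simp add: d_def)
qed

lemma bc_S: "k \<in> I \<Longrightarrow> i \<in> I \<Longrightarrow> bc k (S i x) = bc k x / 2 + (if k = i then 1/2 else 0)"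
  by (simp add: gasket_map_def bc_affine bc_p)

lemma bc_nonneg: assumes "x \<in> V" "i \<in> I" shows "0 \<le> bc i x"
proof -
  have "convex {x. 0 \<le> bc i x}" by (auto simp: convex_alt bc_affine)
  moreover have "p ` I \<subseteq> {x. 0 \<le> bc i x}" using assms bc_p by auto
  ultimately have "hull0 \<subseteq> {x. 0 \<le> bc i x}" by (intro hull_minimal)
  then show ?thesis using assms V_in_hull by auto
qed

lemma bc_le1: assumes "x \<in> V" "i \<in> I" shows "bc i x \<le> 1"
proof -
  have "bc i x \<le> (\<Sum>k\<in>I. bc k x)" by (rule member_le_sum) (use assms bc_nonneg in auto)
  then show ?thesis by (simp add: sum_bc)
qed

text \<open>Both sides are affine and agree at the corners, hence on the simplex.\<close>

lemma bc_sum: assumes "x \<in> V" shows "x = (\<Sum>i\<in>I. bc i x *\<^sub>R p i)"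
proof -
  let ?A = "{x. x = (\<Sum>i\<in>I. bc i x *\<^sub>R p i)}"
  have "convex ?A"
  proof (unfold convex_alt, intro ballI allI impI)
    fix x y and u :: real assume *: "x \<in> ?A" "y \<in> ?A"
    have "(\<Sum>i\<in>I. bc i ((1 - u) *\<^sub>R x + u *\<^sub>R y) *\<^sub>R p i)
        = (1 - u) *\<^sub>R (\<Sum>i\<in>I. bc i x *\<^sub>R p i) + u *\<^sub>R (\<Sum>i\<in>I. bc i y *\<^sub>R p i)"
      by (simp add: bc_affine scaleR_add_left sum.distrib scaleR_sum_right)
    then show "(1 - u) *\<^sub>R x + u *\<^sub>R y \<in> ?A" using * by simp
  qed
  moreover have "p ` I \<subseteq> ?A"
  proof clarify
    fix j assume j: "j \<in> I"
    have "(\<Sum>i\<in>I. bc i (p j) *\<^sub>R p i) = (\<Sum>i\<in>I. if i = j then p i else 0)"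
      using j by (intro sum.cong) (auto simp: bc_p)
    then show "p j = (\<Sum>i\<in>I. bc i (p j) *\<^sub>R p i)" using j by simp
  qed
  ultimately have "hull0 \<subseteq> ?A" by (intro hull_minimal)
  then show ?thesis using assms V_in_hull by blast
qed

lemma bc_eqI: "x \<in> V \<Longrightarrow> y \<in> V \<Longrightarrow> (\<And>k. k \<in> I \<Longrightarrow> bc k x = bc k y) \<Longrightarrow> x = y"
  using bc_sum[of x] bc_sum[of y] by simp

text \<open>Expressing \<open>p i \<bullet> p j\<close> through the unit distances leaves the
  diagonal and terms with the factor \<open>\<Sum>i\<in>I. a i\<close>, the sum of the coordinate
  differences, which is 0.\<close>

lemma norm_bc: assumes "x \<in> V" "y \<in> V" shows "(norm (x - y))\<^sup>2 = (\<Sum>i\<in>I. (bc i x - bc i y)\<^sup>2) / 2"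
proof -
  define a where "a i = bc i x - bc i y" for i
  have sa: "(\<Sum>i\<in>I. a i) = 0" by (simp add: a_def sum_subtractf sum_bc)
  have xy: "x - y = (\<Sum>i\<in>I. a i *\<^sub>R p i)"
    using bc_sum[OF assms(1)] bc_sum[OF assms(2)] by (simp add: a_def scaleR_diff_left sum_subtractf)
  have pp: "p i \<bullet> p j = (p i \<bullet> p i + p j \<bullet> p j - 1 + (if i = j then 1 else 0)) / 2" if "i \<in> I" "j \<in> I" for i j
  proof (cases "i = j")
    case False
    have "(p i - p j) \<bullet> (p i - p j) = 1" using dist_pI[OF that False] by (simp add: dot_square_norm)
    then show ?thesis using False by (simp add: inner_diff_left inner_diff_right inner_commute)
  qed simp
  have "(norm (x - y))\<^sup>2 = (\<Sum>i\<in>I. \<Sum>j\<in>I. a i * a j * (p i \<bullet> p j))"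
    unfolding xy power2_norm_eq_inner
    by (simp add: inner_sum_left inner_sum_right sum_distrib_left mult_ac) (simp add: inner_commute)
  also have "\<dots> = (\<Sum>i\<in>I. \<Sum>j\<in>I. (a i * (p i \<bullet> p i - 1) * a j + a i * (a j * (p j \<bullet> p j)) + (if i = j then a i * a j else 0)) / 2)"
  proof (intro sum.cong refl)
    fix i j assume "i \<in> I" "j \<in> I"
    show "a i * a j * (p i \<bullet> p j) = (a i * (p i \<bullet> p i - 1) * a j + a i * (a j * (p j \<bullet> p j)) + (if i = j then a i * a j else 0)) / 2"
      by (subst pp[OF \<open>i \<in> I\<close> \<open>j \<in> I\<close>]) (simp add: field_simps)
  qed
  also have "\<dots> = ((\<Sum>i\<in>I. a i * (p i \<bullet> p i - 1)) * (\<Sum>j\<in>I. a j) + (\<Sum>i\<in>I. a i) * (\<Sum>j\<in>I. a j * (p j \<bullet> p j)) + (\<Sum>i\<in>I. a i * a i)) / 2"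
    by (simp add: sum_divide_distrib[symmetric] sum.distrib sum_product)
  also have "\<dots> = (\<Sum>i\<in>I. (a i)\<^sup>2) / 2" by (simp add: sa power2_eq_square)
  finally show ?thesis by (simp add: a_def)
qed

lemma bc_one: assumes "x \<in> V" "j \<in> I" "bc j x = 1" shows "x = p j"
proof (rule bc_eqI[OF assms(1) p_in_V[OF assms(2)]])
  fix k assume k: "k \<in> I"
  have "(\<Sum>k\<in>I - {j}. bc k x) = 0" using sum_bc[of x] assms sum.remove[of I j "\<lambda>k. bc k x"] by simp
  then have "\<forall>k\<in>I - {j}. bc k x = 0"
    by (subst (asm) sum_nonneg_eq_0_iff) (use assms bc_nonneg in auto)
  then show "bc k x = bc k (p j)" using k assms bc_p by auto
qed

text \<open>The \<open>j\<close>-th coordinate is at most 1/2 on cell \<open>i\<close> and at least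
  1/2 on cell \<open>j\<close>, so it is 1/2 at a common point and \<open>bc j x = 1\<close>.
  Applied in both directions: two cells meet only at the junction
  \<open>S i (p j) = S j (p i)\<close>.\<close>

lemma overlap: assumes ij: "i \<in> I" "j \<in> I" "i \<noteq> j" and xy: "x \<in> V" "y \<in> V" and eq: "S i x = S j y"
  shows "x = p j"
proof -
  have "bc j (S i x) = bc j y / 2 + 1/2" using bc_S[OF ij(2,2)] eq by simp
  moreover have "bc j (S i x) = bc j x / 2" using bc_S[OF ij(2,1)] ij by simp
  ultimately have "bc j x = 1" using bc_le1[OF xy(1) ij(2)] bc_nonneg[OF xy(2) ij(2)] by linarith
  then show ?thesis by (rule bc_one[OF xy(1) ij(2)])
qed

lemma bc_vert: "x \<in> vert m \<Longrightarrow> k \<in> I \<Longrightarrow> \<exists>z::int. bc k x = of_int z * (1/2) ^ m"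
proof (induction m arbitrary: x)
  case 0
  then obtain j where "j \<in> I" "x = p j" by auto
  then show ?case using bc_p[OF 0(2)] by (intro exI[of _ "if k = j then 1 else 0"]) auto
next
  case (Suc m)
  then obtain i y where y: "i \<in> I" "y \<in> vert m" "x = S i y" by auto
  from Suc.IH[OF y(2) Suc.prems(2)] obtain z :: int where z: "bc k y = of_int z * (1/2) ^ m" by blast
  have "bc k x = of_int (z + (if k = i then 2 ^ m else 0)) * (1/2) ^ Suc m"
    using bc_S[OF Suc.prems(2) y(1), of y] z by (simp add: y field_simps power_one_over)
  then show ?case by blast
qed

lemma bc_S_pow: "k \<in> I \<Longrightarrow> j \<in> I \<Longrightarrow>
  bc k ((S j ^^ m) x) = (1/2) ^ m * bc k x + (if k = j then 1 - (1/2) ^ m else 0)"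
  by (induction m) (auto simp: bc_S field_simps)

lemma S_pow_vert: "j \<in> I \<Longrightarrow> k \<in> I \<Longrightarrow> (S j ^^ m) (p k) \<in> vert m"
  by (induction m) auto

section \<open>Pairs of vertices at distance \<open>(1/2) ^ m\<close>\<close>

abbreviation edges :: "nat \<Rightarrow> ('a \<times> 'a) set" where "edges \<equiv> gasket_edges N p"

definition triples :: "(nat \<times> nat \<times> nat) set" where
  "triples = {(i, j, k). i \<in> I \<and> j \<in> I \<and> k \<in> I \<and> i \<noteq> j \<and> k \<noteq> i \<and> k \<noteq> j}"

lemma finite_triples: "finite triples"
  by (rule finite_subset[of _ "I \<times> I \<times> I"]) (auto simp: triples_def)

text \<open>The additional pairs at level \<open>m + 1\<close>: the neighbours in direction
  \<open>k\<close> of the junction \<open>S i (p j) = S j (p i)\<close>, one in cell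
  \<open>i\<close> and one in cell \<open>j\<close>. They differ by \<open>(1/2) ^ Suc m\<close>
  times \<open>p i - p j\<close>.\<close>

definition cross :: "nat \<Rightarrow> nat \<times> nat \<times> nat \<Rightarrow> 'a \<times> 'a" where
  "cross m = (\<lambda>(i, j, k). (S i ((S j ^^ m) (p k)), S j ((S i ^^ m) (p k))))"

lemma bc_cross:
  assumes "(i, j, k) \<in> triples" "l \<in> I"
  shows "bc l (S i ((S j ^^ m) (p k))) =
    (if l = i then 1/2 else if l = j then 1/2 - (1/2) ^ Suc m else if l = k then (1/2) ^ Suc m else 0)"
  using assms by (auto simp: triples_def bc_S bc_S_pow bc_p field_simps)

lemma edge_iff: "(x, y) \<in> edges m \<longleftrightarrow> x \<in> vert m \<and> y \<in> vert m \<and> norm (x - y) = (1/2) ^ m"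
  by (simp add: gasket_edges_def)

lemma finite_edges: "finite (edges m)"
  by (rule finite_subset[of _ "vert m \<times> vert m"]) (auto simp: edge_iff finite_vert)

text \<open>In units of \<open>(1/2) ^ Suc m\<close> all coordinates are integers, and the distance
  says that the squared integer differences sum to 2. Points without a common cell, one in cell
  \<open>i\<close> and one in cell \<open>j\<close>, thus differ by 1 and -1 in these two
  coordinates and agree in all others.\<close>

lemma edge_Suc_cases:
  assumes e: "(x', y') \<in> edges (Suc m)"
  shows "(\<exists>l\<in>I. \<exists>x y. (x, y) \<in> edges m \<and> x' = S l x \<and> y' = S l y) \<or> (m \<noteq> 0 \<and> (\<exists>t\<in>triples. (x', y') = cross m t))"
proof (cases "\<exists>l\<in>I. x' \<in> S l ` vert m \<and> y' \<in> S l ` vert m")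
  case True
  then obtain l x y where l: "l \<in> I" "x \<in> vert m" "y \<in> vert m" "x' = S l x" "y' = S l y" by blast
  then have "(x, y) \<in> edges m" using e by (simp add: edge_iff S_diff)
  then show ?thesis using l by blast
next
  case False
  define \<epsilon> :: real where "\<epsilon> = (1/2) ^ Suc m"
  have \<epsilon>: "\<epsilon> > 0" and half: "1/2 = 2 ^ m * \<epsilon>" by (simp_all add: \<epsilon>_def power_one_over field_simps)
  have xV: "x' \<in> vert (Suc m)" "y' \<in> vert (Suc m)" and nxy: "norm (x' - y') = \<epsilon>"
    using e by (auto simp: edge_iff \<epsilon>_def simp del: vert_Suc_UN)
  have xV': "x' \<in> V" "y' \<in> V" using xV vert_in_V by blast+
  obtain i x where x: "i \<in> I" "x \<in> vert m" "x' = S i x" using xV by auto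
  obtain j y where y: "j \<in> I" "y \<in> vert m" "y' = S j y" using xV by auto
  have xyV: "x \<in> V" "y \<in> V" using x y vert_in_V by blast+
  have ij: "i \<noteq> j" using False x y by blast
  \<comment> \<open>Otherwise \<open>y'\<close> is the junction and both points lie in cell
    \<open>i\<close>. This makes the upper coordinate bounds below strict.\<close>
  have "y \<noteq> p i"
  proof
    assume "y = p i"
    then have "y' = S i (p j)" using y S_comm by simp
    then have "y' \<in> S i ` vert m" using p_in_vert[OF y(1)] by blast
    then show False using False x by blast
  qed
  then have "bc i y \<noteq> 1" using bc_one[OF xyV(2) x(1)] by blast
  then have biy: "bc i y' < 1/2" using bc_le1[OF xyV(2) x(1)] bc_S[OF x(1) y(1), of y] ij y by simp
  have "x \<noteq> p j"
  proof
    assume "x = p j"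
    then have "x' = S j (p i)" using x S_comm by simp
    then have "x' \<in> S j ` vert m" using p_in_vert[OF x(1)] by blast
    then show False using False y by blast
  qed
  then have "bc j x \<noteq> 1" using bc_one[OF xyV(1) y(1)] by blast
  then have bjx: "bc j x' < 1/2" using bc_le1[OF xyV(1) y(1)] bc_S[OF y(1) x(1), of x] ij x by simp
  have bix: "1/2 \<le> bc i x'" using bc_S[OF x(1) x(1), of x] bc_nonneg[OF xyV(1) x(1)] x by simp
  have bjy: "1/2 \<le> bc j y'" using bc_S[OF y(1) y(1), of y] bc_nonneg[OF xyV(2) y(1)] y by simp
  obtain z where z: "\<And>k. k \<in> I \<Longrightarrow> bc k x' = of_int (z k :: int) * \<epsilon>"
    using bc_vert[OF xV(1)] unfolding \<epsilon>_def by metis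
  obtain w where w: "\<And>k. k \<in> I \<Longrightarrow> bc k y' = of_int (w k :: int) * \<epsilon>"
    using bc_vert[OF xV(2)] unfolding \<epsilon>_def by metis
  define c where "c k = z k - w k" for k
  have "(\<Sum>k\<in>I. (bc k x' - bc k y')\<^sup>2) = 2 * \<epsilon>\<^sup>2" using norm_bc[OF xV'] nxy by simp
  also have "(\<Sum>k\<in>I. (bc k x' - bc k y')\<^sup>2) = (\<Sum>k\<in>I. of_int ((c k)\<^sup>2)) * \<epsilon>\<^sup>2"
    unfolding sum_distrib_right
    by (intro sum.cong refl) (simp add: z w c_def power_mult_distrib flip: left_diff_distrib)
  finally have "(\<Sum>k\<in>I. of_int ((c k)\<^sup>2)) = (2::real)" using \<epsilon> by simp
  then have c2: "(\<Sum>k\<in>I. (c k)\<^sup>2) = 2" by (simp flip: of_int_sum of_int_power)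
  have zi: "2 ^ m \<le> z i" and wi: "w i < 2 ^ m" and zj: "z j < 2 ^ m" and wj: "2 ^ m \<le> w j"
  proof -
    have "(2 ^ m :: real) * \<epsilon> \<le> of_int (z i) * \<epsilon>" using bix half z[OF x(1)] by simp
    then have "(2 ^ m :: real) \<le> of_int (z i)" using \<epsilon> by simp
    then show "2 ^ m \<le> z i" by (metis of_int_le_iff of_int_numeral of_int_power)
    have "of_int (w i) * \<epsilon> < (2 ^ m :: real) * \<epsilon>" using biy half w[OF x(1)] by simp
    then have "of_int (w i) < (2 ^ m :: real)" using \<epsilon> by simp
    then show "w i < 2 ^ m" by (metis of_int_less_iff of_int_numeral of_int_power)
    have "(2 ^ m :: real) * \<epsilon> \<le> of_int (w j) * \<epsilon>" using bjy half w[OF y(1)] by simp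
    then have "(2 ^ m :: real) \<le> of_int (w j)" using \<epsilon> by simp
    then show "2 ^ m \<le> w j" by (metis of_int_le_iff of_int_numeral of_int_power)
    have "of_int (z j) * \<epsilon> < (2 ^ m :: real) * \<epsilon>" using bjx half z[OF y(1)] by simp
    then have "of_int (z j) < (2 ^ m :: real)" using \<epsilon> by simp
    then show "z j < 2 ^ m" by (metis of_int_less_iff of_int_numeral of_int_power)
  qed
  have ci: "1 \<le> c i" "c j \<le> -1" using zi wi zj wj by (auto simp: c_def)
  have sp: "(\<Sum>k\<in>I. (c k)\<^sup>2) = (c i)\<^sup>2 + ((c j)\<^sup>2 + (\<Sum>k\<in>I - {i} - {j}. (c k)\<^sup>2))"
    using x(1) y(1) ij by (simp add: sum.remove[of I i] sum.remove[of "I - {i}" j])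
  have nn: "0 \<le> (\<Sum>k\<in>I - {i} - {j}. (c k)\<^sup>2)" by (intro sum_nonneg) simp
  have s1: "c i \<le> (c i)\<^sup>2" using ci by (simp add: power2_eq_square)
  have s2: "- c j \<le> (c j)\<^sup>2" using mult_left_mono[of 1 "- c j" "- c j"] ci by (simp add: power2_eq_square)
  have cij: "c i = 1" "c j = -1" using sp c2 nn s1 s2 ci by linarith+
  have "(\<Sum>k\<in>I - {i} - {j}. (c k)\<^sup>2) = 0" using sp c2 cij by simp
  then have c0: "c k = 0" if "k \<in> I" "k \<noteq> i" "k \<noteq> j" for k
    using that by (subst (asm) sum_nonneg_eq_0_iff) auto
  \<comment> \<open>\<open>2 ^ m\<close> units are the value 1/2. The four bounds and the
    differences of one unit leave no other values.\<close>
  have zeq: "z i = 2 ^ m" "w i = 2 ^ m - 1" "w j = 2 ^ m" "z j = 2 ^ m - 1"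
    using cij zi wi zj wj by (auto simp: c_def)
  have zw: "w k = z k" if "k \<in> I" "k \<noteq> i" "k \<noteq> j" for k using c0[OF that] by (simp add: c_def)
  have zn: "0 \<le> z k" if "k \<in> I" for k
  proof -
    have "0 \<le> of_int (z k) * \<epsilon>" using bc_nonneg[OF xV'(1) that] z[OF that] by simp
    then show ?thesis using \<epsilon> by (simp add: zero_le_mult_iff)
  qed
  have "(\<Sum>k\<in>I. of_int (z k) * \<epsilon>) = 1" using sum_bc[of x'] z by simp
  then have "(\<Sum>k\<in>I. of_int (z k)) * \<epsilon> = (2 * 2 ^ m) * \<epsilon>" using half by (simp add: sum_distrib_right)
  then have "(\<Sum>k\<in>I. of_int (z k)) = (2 * 2 ^ m :: real)" using \<epsilon> by simp
  then have "real_of_int (\<Sum>k\<in>I. z k) = real_of_int (2 * 2 ^ m)" by simp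
  then have "(\<Sum>k\<in>I. z k) = 2 * 2 ^ m" by (simp only: of_int_eq_iff)
  moreover have "(\<Sum>k\<in>I. z k) = z i + (z j + (\<Sum>k\<in>I - {i} - {j}. z k))"
    using x(1) y(1) ij by (simp add: sum.remove[of I i] sum.remove[of "I - {i}" j])
  \<comment> \<open>All coordinates add up to \<open>2 * 2 ^ m\<close> units, so one unit remains
    for the other indices, and it sits at a single \<open>k\<close>.\<close>
  ultimately have zs: "(\<Sum>k\<in>I - {i} - {j}. z k) = 1" using zeq by simp
  then have "\<exists>k\<in>I - {i} - {j}. z k \<noteq> 0" by (metis sum.neutral zero_neq_one)
  then obtain k where k: "k \<in> I - {i} - {j}" "z k \<noteq> 0" by blast
  have zk1: "1 \<le> z k" using zn[of k] k by simp
  have sk: "(\<Sum>l\<in>I - {i} - {j}. z l) = z k + (\<Sum>l\<in>I - {i} - {j} - {k}. z l)"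
    using k by (intro sum.remove) auto
  have snn: "0 \<le> (\<Sum>l\<in>I - {i} - {j} - {k}. z l)" using zn by (intro sum_nonneg) auto
  have zk: "z k = 1" and "(\<Sum>l\<in>I - {i} - {j} - {k}. z l) = 0" using sk snn zk1 zs by linarith+
  then have z0: "z l = 0" if "l \<in> I" "l \<noteq> i" "l \<noteq> j" "l \<noteq> k" for l
    using that zn by (subst (asm) sum_nonneg_eq_0_iff) auto
  have t: "(i, j, k) \<in> triples" "(j, i, k) \<in> triples" using x y k ij by (auto simp: triples_def)
  have kI: "k \<in> I" using k by simp
  have V1: "S i ((S j ^^ m) (p k)) \<in> V" "S j ((S i ^^ m) (p k)) \<in> V"
    using S_in_V S_pow_vert[OF _ kI] vert_in_V x(1) y(1) by blast+
  have xc: "x' = S i ((S j ^^ m) (p k))"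
  proof (rule bc_eqI[OF xV'(1) V1(1)])
    fix l assume l: "l \<in> I"
    show "bc l x' = bc l (S i ((S j ^^ m) (p k)))"
      unfolding bc_cross[OF t(1) l] z[OF l] \<epsilon>_def[symmetric]
      using z0[OF l] zk zeq half k by (auto simp: left_diff_distrib)
  qed
  have yc: "y' = S j ((S i ^^ m) (p k))"
  proof (rule bc_eqI[OF xV'(2) V1(2)])
    fix l assume l: "l \<in> I"
    show "bc l y' = bc l (S j ((S i ^^ m) (p k)))"
      unfolding bc_cross[OF t(2) l] w[OF l] \<epsilon>_def[symmetric]
      using z0[OF l] zk zeq half zw[OF l] ij k by (auto simp: left_diff_distrib)
  qed
  \<comment> \<open>For \<open>m = 0\<close> the two points are \<open>S k (p i)\<close> and
    \<open>S k (p j)\<close>, an edge of cell \<open>k\<close>.\<close>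
  have "m \<noteq> 0"
  proof
    assume "m = 0"
    then have "x' = S k (p i)" "y' = S k (p j)" using xc yc S_comm by auto
    then show False using False kI p_in_vert x(1) y(1) by blast
  qed
  then show ?thesis using xc yc t by (auto simp: cross_def intro!: bexI[of _ "(i, j, k)"])
qed

lemma cross_edge: assumes "t \<in> triples" shows "cross m t \<in> edges (Suc m)"
proof -
  obtain i j k where t: "t = (i, j, k)" by (metis prod_cases3)
  have ijk: "i \<in> I" "j \<in> I" "k \<in> I" "i \<noteq> j" "k \<noteq> i" "k \<noteq> j" using assms t by (auto simp: triples_def)
  have t2: "(i, j, k) \<in> triples" "(j, i, k) \<in> triples" using ijk by (auto simp: triples_def)
  let ?x = "S i ((S j ^^ m) (p k))" and ?y = "S j ((S i ^^ m) (p k))"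
  have v: "?x \<in> vert (Suc m)" "?y \<in> vert (Suc m)"
    unfolding vert_Suc_UN using S_pow_vert[of j k m] S_pow_vert[of i k m] ijk by blast+
  have "(norm (?x - ?y))\<^sup>2 = (\<Sum>l\<in>I. (bc l ?x - bc l ?y)\<^sup>2) / 2"
    using v vert_in_V by (intro norm_bc) blast+
  also have "(\<Sum>l\<in>I. (bc l ?x - bc l ?y)\<^sup>2) = (\<Sum>l\<in>I. (if l = i then ((1/2) ^ Suc m)\<^sup>2 else 0) + (if l = j then ((1/2) ^ Suc m)\<^sup>2 else 0))"
    using ijk by (intro sum.cong refl) (auto simp: bc_cross[OF t2(1)] bc_cross[OF t2(2)])
  also have "\<dots> = 2 * ((1/2) ^ Suc m)\<^sup>2" using ijk by (simp add: sum.distrib)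
  finally have "norm (?x - ?y) = (1/2) ^ Suc m"
    by (simp add: power2_eq_iff_nonneg del: power_Suc)
  then show ?thesis using v by (simp add: t cross_def edge_iff del: vert_Suc_UN power_Suc)
qed

text \<open>The recursion behind all level energies. At \<open>m = 0\<close> the cross pairs are
  edges of the third cell and already counted.\<close>

lemma sum_edges_Suc:
  fixes \<phi> :: "'a \<times> 'a \<Rightarrow> real"
  shows "(\<Sum>e\<in>edges (Suc m). \<phi> e) = (\<Sum>i\<in>I. \<Sum>(x, y)\<in>edges m. \<phi> (S i x, S i y)) +
     (if m = 0 then 0 else \<Sum>t\<in>triples. \<phi> (cross m t))"
proof -
  define Sm where "Sm i = map_prod (S i) (S i)" for i
  define D where "D = (\<Union>i\<in>I. Sm i ` edges m)"
  define X where "X = (if m = 0 then {} else cross m ` triples)"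
  have "edges (Suc m) = D \<union> X"
  proof (intro equalityI subsetI)
    fix e assume "e \<in> edges (Suc m)"
    then obtain x y where e: "e = (x, y)" "(x, y) \<in> edges (Suc m)" by (cases e) auto
    from edge_Suc_cases[OF e(2)] show "e \<in> D \<union> X"
    proof
      assume "\<exists>l\<in>I. \<exists>a b. (a, b) \<in> edges m \<and> x = S l a \<and> y = S l b"
      then show ?thesis unfolding D_def Sm_def e by (force intro!: image_eqI)
    next
      assume "m \<noteq> 0 \<and> (\<exists>t\<in>triples. (x, y) = cross m t)"
      then show ?thesis by (auto simp: X_def e)
    qed
  next
    fix e assume "e \<in> D \<union> X"
    then show "e \<in> edges (Suc m)"
    proof
      assume "e \<in> D"
      then obtain i x y where "i \<in> I" "(x, y) \<in> edges m" "e = (S i x, S i y)" by (auto simp: D_def Sm_def)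
      then show ?thesis by (auto simp: edge_iff S_diff)
    qed (auto simp: X_def cross_edge split: if_splits)
  qed
  \<comment> \<open>Both ends of a pair in cell \<open>l\<close> have \<open>l\<close>-th coordinate
    at least 1/2; for a cross pair this forces \<open>l = i\<close> and
    \<open>l = j\<close>.\<close>
  moreover have "D \<inter> X = {}"
  proof (rule ccontr)
    assume "D \<inter> X \<noteq> {}"
    then obtain l x y t where l: "l \<in> I" "(x, y) \<in> edges m" and t: "t \<in> triples" "m \<noteq> 0"
      and eq: "(S l x, S l y) = cross m t" by (auto simp: D_def Sm_def X_def split: if_splits)
    obtain i j k where tt: "t = (i, j, k)" by (metis prod_cases3)
    have ijk: "(i, j, k) \<in> triples" "(j, i, k) \<in> triples" "i \<noteq> j" using t tt by (auto simp: triples_def)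
    have "(1/2::real) ^ Suc m < (1/2) ^ 1" using t by (intro power_strict_decreasing) auto
    moreover define \<epsilon> :: real where "\<epsilon> = (1/2) ^ Suc m"
    ultimately have small: "\<epsilon> < 1/2" "0 < \<epsilon>" by (simp, simp add: \<epsilon>_def)
    have xy: "x \<in> V" "y \<in> V" using l vert_in_V by (auto simp: edge_iff)
    have "1/2 \<le> bc l (S l x)" "1/2 \<le> bc l (S l y)" using bc_S l bc_nonneg xy by auto
    then have "l = i" "l = j"
      using eq bc_cross[OF ijk(1) l(1), of m, folded \<epsilon>_def] bc_cross[OF ijk(2) l(1), of m, folded \<epsilon>_def] small
      by (auto simp: cross_def tt split: if_splits)
    then show False using ijk by simp
  qed
  moreover have "finite D" "finite X" by (auto simp: D_def X_def finite_edges finite_triples)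
  ultimately have "(\<Sum>e\<in>edges (Suc m). \<phi> e) = (\<Sum>e\<in>D. \<phi> e) + (\<Sum>e\<in>X. \<phi> e)"
    by (simp add: sum.union_disjoint)
  also have "(\<Sum>e\<in>D. \<phi> e) = (\<Sum>i\<in>I. \<Sum>e\<in>Sm i ` edges m. \<phi> e)"
    unfolding D_def
  proof (rule sum.UNION_disjoint)
    show "\<forall>i\<in>I. \<forall>j\<in>I. i \<noteq> j \<longrightarrow> Sm i ` edges m \<inter> Sm j ` edges m = {}"
    proof (intro ballI impI, rule ccontr)
      fix i j assume ij: "i \<in> I" "j \<in> I" "i \<noteq> j" "Sm i ` edges m \<inter> Sm j ` edges m \<noteq> {}"
      then obtain x y x2 y2 where e: "(x, y) \<in> edges m" "(x2, y2) \<in> edges m" "S i x = S j x2" "S i y = S j y2"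
        by (auto simp: Sm_def)
      then have "x \<in> V" "y \<in> V" "x2 \<in> V" "y2 \<in> V" using vert_in_V by (auto simp: edge_iff)
      \<comment> \<open>An edge shared by two cells would have both ends at their single
        junction.\<close>
      then have "x = p j" "y = p j" using overlap[OF ij(1-3)] e by blast+
      then show False using e(1) by (simp add: edge_iff)
    qed
  qed (auto simp: finite_edges)
  also have "\<dots> = (\<Sum>i\<in>I. \<Sum>(x, y)\<in>edges m. \<phi> (S i x, S i y))"
  proof (rule sum.cong[OF refl])
    fix i
    have "inj_on (Sm i) (edges m)" by (auto simp: inj_on_def Sm_def)
    then show "(\<Sum>e\<in>Sm i ` edges m. \<phi> e) = (\<Sum>(x, y)\<in>edges m. \<phi> (S i x, S i y))"
      by (simp add: sum.reindex Sm_def case_prod_unfold map_prod_def)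
  qed
  also have "(\<Sum>e\<in>X. \<phi> e) = (if m = 0 then 0 else \<Sum>t\<in>triples. \<phi> (cross m t))"
  proof (cases "m = 0")
    case False
    have "inj_on (cross m) triples"
    proof (rule inj_onI)
      fix t t' assume t: "t \<in> triples" "t' \<in> triples" and eq: "cross m t = cross m t'"
      obtain i j k i' j' k' where tt: "t = (i, j, k)" "t' = (i', j', k')" by (metis prod_cases3)
      have tr: "(i, j, k) \<in> triples" "(j, i, k) \<in> triples" "(i', j', k') \<in> triples" "(j', i', k') \<in> triples"
        using t tt by (auto simp: triples_def)
      have "(1/2::real) ^ Suc m < (1/2) ^ 1" using False by (intro power_strict_decreasing) auto
      then have small: "(1/2::real) ^ Suc m < 1/2" by simp
      have pos: "(0::real) < (1/2) ^ Suc m" by simp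
      have dI: "i \<in> I" "j \<in> I" "k \<in> I" "k \<noteq> i" "k \<noteq> j" "i \<noteq> j" using t tt by (auto simp: triples_def)
      have e1: "S i ((S j ^^ m) (p k)) = S i' ((S j' ^^ m) (p k'))" "S j ((S i ^^ m) (p k)) = S j' ((S i' ^^ m) (p k'))"
        using eq by (auto simp: cross_def tt)
      have "i = i'" using bc_cross[OF tr(1) dI(1), of m] bc_cross[OF tr(3) dI(1), of m] e1 small pos
        by (auto simp del: power_Suc split: if_splits)
      moreover have "j = j'" using bc_cross[OF tr(2) dI(2), of m] bc_cross[OF tr(4) dI(2), of m] e1 small pos
        by (auto simp del: power_Suc split: if_splits)
      moreover have "k = k'"
        using bc_cross[OF tr(1) dI(3), of m] bc_cross[OF tr(3) dI(3), of m] e1 pos dI calculation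
        by (auto simp del: power_Suc split: if_splits)
      ultimately show "t = t'" by (simp add: tt)
    qed
    then show ?thesis using False by (simp add: X_def sum.reindex)
  qed (simp add: X_def)
  finally show ?thesis .
qed

end

section \<open>The energy form\<close>

lemma sq_diff_le: "((a::real) - b)\<^sup>2 \<le> 2 * (a - c)\<^sup>2 + 2 * (b - c)\<^sup>2"
proof -
  have "0 \<le> ((a - c) + (b - c))\<^sup>2" by simp
  then show ?thesis by (simp add: power2_eq_square algebra_simps)
qed

context simplex_gasket
begin

section \<open>Self-similar energy and level energies\<close>

definition rho :: real where "rho = (real N + 2) / real N"

lemma rho_gt1: "1 < rho" using N_pos by (simp add: rho_def)

lemma rho_pos: "0 < rho" using rho_gt1 by simp

text \<open>The usual energy: ordered pairs inside a common cell of level \<open>m\<close>,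
  renormalised by \<open>rho\<close> at each level. Recursion over the first-level cells replaces a
  sum over a graph.\<close>

primrec EN :: "nat \<Rightarrow> ('a \<Rightarrow> real) \<Rightarrow> ('a \<Rightarrow> real) \<Rightarrow> real" where
  "EN 0 u v = (\<Sum>i\<in>I. \<Sum>j\<in>I. (u (p i) - u (p j)) * (v (p i) - v (p j)))"
| "EN (Suc m) u v = rho * (\<Sum>i\<in>I. EN m (\<lambda>x. u (S i x)) (\<lambda>x. v (S i x)))"

lemma EN_cong:
  "(\<And>x. x \<in> V \<Longrightarrow> u x = u' x) \<Longrightarrow> (\<And>x. x \<in> V \<Longrightarrow> v x = v' x) \<Longrightarrow> EN m u v = EN m u' v'"
proof (induction m arbitrary: u u' v v')
  case 0
  then show ?case using p_in_V by (auto intro!: sum.cong)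
next
  case (Suc m)
  have "EN m (\<lambda>x. u (S i x)) (\<lambda>x. v (S i x)) = EN m (\<lambda>x. u' (S i x)) (\<lambda>x. v' (S i x))" if "i \<in> I" for i
    by (rule Suc.IH) (use Suc.prems S_in_V that in auto)
  then show ?case by simp
qed

lemma EN_lin: "EN m (\<lambda>x. a * u x + b * v x) w = a * EN m u w + b * EN m v w"
proof (induction m arbitrary: u v w)
  case 0
  show ?case
    by (simp add: sum_distrib_left flip: sum.distrib) (intro sum.cong refl, simp add: algebra_simps)
next
  case (Suc m)
  show ?case by (simp add: Suc.IH sum.distrib sum_distrib_left algebra_simps)
qed

lemma EN_sym: "EN m u v = EN m v u"
proof (induction m arbitrary: u v)
  case (Suc m)
  show ?case unfolding EN.simps by (subst Suc.IH) (rule refl)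
qed (simp add: mult.commute)

lemma EN_lin_right: "EN m w (\<lambda>x. a * u x + b * v x) = a * EN m w u + b * EN m w v"
  by (simp add: EN_sym[of m w] EN_lin)

lemma EN_nonneg: "0 \<le> EN m u u"
proof (induction m arbitrary: u)
  case (Suc m)
  then show ?case using rho_pos by (simp add: sum_nonneg)
qed (simp add: sum_nonneg)

lemma EN_add_le: "EN m (\<lambda>x. a * u x + b * v x) (\<lambda>x. a * u x + b * v x) \<le> 2 * a\<^sup>2 * EN m u u + 2 * b\<^sup>2 * EN m v v"
proof -
  have "0 \<le> EN m (\<lambda>x. a * u x + (-b) * v x) (\<lambda>x. a * u x + (-b) * v x)" by (rule EN_nonneg)
  then show ?thesis unfolding EN_lin EN_lin_right using EN_sym[of m u v] by (simp add: power2_eq_square algebra_simps)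
qed

definition WN :: "nat \<Rightarrow> ('a \<Rightarrow> real) \<Rightarrow> ('a \<Rightarrow> real) \<Rightarrow> real" where
  "WN m u v = rho ^ m * (\<Sum>(x, y)\<in>edges m. (u x - u y) * (v x - v y))"

lemma level_WN: "gasket_energy_level N p m u = WN m u u"
  by (simp add: gasket_energy_level_def WN_def rho_def power2_eq_square)

lemma inner_WN: "gasket_inner N p u v = lim (\<lambda>m. WN m u v)"
  by (simp add: gasket_inner_def WN_def rho_def)

lemma WN_cong:
  "(\<And>x. x \<in> V \<Longrightarrow> u x = u' x) \<Longrightarrow> (\<And>x. x \<in> V \<Longrightarrow> v x = v' x) \<Longrightarrow> WN m u v = WN m u' v'"
  unfolding WN_def using vert_in_V by (auto simp: edge_iff subset_iff intro!: sum.cong)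

lemma WN_nonneg: "0 \<le> WN m u u"
  unfolding WN_def by (intro mult_nonneg_nonneg sum_nonneg) (use rho_pos in auto)

lemma p_inj: "i \<in> I \<Longrightarrow> j \<in> I \<Longrightarrow> p i = p j \<longleftrightarrow> i = j"
  by (cases "i = j") (use dist_pI[of i j] in auto)

lemma WN_0: "WN 0 u v = EN 0 u v"
proof -
  have e: "edges 0 = (\<lambda>(i, j). (p i, p j)) ` {(i, j). i \<in> I \<and> j \<in> I \<and> i \<noteq> j}"
    using p_inj dist_pI by (fastforce simp: gasket_edges_def)
  have inj: "inj_on (\<lambda>(i, j). (p i, p j)) {(i, j). i \<in> I \<and> j \<in> I \<and> i \<noteq> j}"
    using p_inj by (auto simp: inj_on_def)
  have "WN 0 u v = (\<Sum>(i, j)\<in>{(i, j). i \<in> I \<and> j \<in> I \<and> i \<noteq> j}. (u (p i) - u (p j)) * (v (p i) - v (p j)))"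
    unfolding WN_def e sum.reindex[OF inj] by (simp add: case_prod_unfold)
  also have "\<dots> = (\<Sum>(i, j)\<in>I \<times> I. (u (p i) - u (p j)) * (v (p i) - v (p j)))"
    by (rule sum.mono_neutral_left) auto
  finally show ?thesis by (simp add: sum.cartesian_product)
qed

text \<open>The part of \<open>WN (Suc m) u u\<close> that comes from pairs across first-level
  cells. It is 0 for \<open>m = 0\<close>, where these pairs lie in a common cell.\<close>

definition crossE :: "nat \<Rightarrow> ('a \<Rightarrow> real) \<Rightarrow> real" where
  "crossE m u = (if m = 0 then 0 else rho ^ Suc m *
     (\<Sum>(i, j, k)\<in>triples. (u (S i ((S j ^^ m) (p k))) - u (S j ((S i ^^ m) (p k))))\<^sup>2))"

lemma crossE_nonneg: "0 \<le> crossE m u"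
  unfolding crossE_def using rho_pos
  by (simp only: split: if_split) (intro conjI impI order_refl mult_nonneg_nonneg sum_nonneg, auto)

lemma WN_Suc: "WN (Suc m) u u = rho * (\<Sum>i\<in>I. WN m (\<lambda>x. u (S i x)) (\<lambda>x. u (S i x))) + crossE m u"
  unfolding WN_def sum_edges_Suc crossE_def
  by (simp add: cross_def case_prod_unfold power2_eq_square sum_distrib_left algebra_simps)

lemma EN_le_WN: "EN m u u \<le> WN m u u"
proof (induction m arbitrary: u)
  case (Suc m)
  have "EN (Suc m) u u \<le> rho * (\<Sum>i\<in>I. WN m (\<lambda>x. u (S i x)) (\<lambda>x. u (S i x)))"
    using rho_pos by (simp add: sum_mono Suc)
  then show ?case using crossE_nonneg[of m u] unfolding WN_Suc by simp
qed (simp add: WN_0)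

text \<open>Each additional pair is charged to edges at the corners of first-level cells; only corners that are
  junctions are used, so the corner energy of the whole gasket can be subtracted in the induction.\<close>

definition corner :: "nat \<Rightarrow> ('a \<Rightarrow> real) \<Rightarrow> real" where
  "corner m u = rho ^ m * (\<Sum>j\<in>I. \<Sum>k\<in>I. (u ((S j ^^ m) (p k)) - u (p j))\<^sup>2)"

lemma corner_nonneg: "0 \<le> corner m u"
  unfolding corner_def by (intro mult_nonneg_nonneg sum_nonneg) (use rho_pos in auto)

lemma sum_triples_le:
  fixes \<phi> :: "nat \<Rightarrow> nat \<Rightarrow> nat \<Rightarrow> real"
  assumes "\<And>i j k. 0 \<le> \<phi> i j k"
  shows "(\<Sum>(i, j, k)\<in>triples. \<phi> i j k) + (\<Sum>i\<in>I. \<Sum>k\<in>I. \<phi> i i k) \<le> (\<Sum>i\<in>I. \<Sum>j\<in>I. \<Sum>k\<in>I. \<phi> i j k)"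
proof -
  define D where "D = (\<lambda>(i, k). (i, i, k)) ` (I \<times> I)"
  have inj: "inj_on (\<lambda>(i, k). (i, i, k)) (I \<times> I)" by (auto simp: inj_on_def)
  have "(\<Sum>i\<in>I. \<Sum>k\<in>I. \<phi> i i k) = (\<Sum>(i, j, k)\<in>D. \<phi> i j k)"
    unfolding D_def sum.reindex[OF inj] by (simp add: sum.cartesian_product case_prod_unfold)
  then have "(\<Sum>(i, j, k)\<in>triples. \<phi> i j k) + (\<Sum>i\<in>I. \<Sum>k\<in>I. \<phi> i i k) = (\<Sum>(i, j, k)\<in>triples \<union> D. \<phi> i j k)"
    by (subst sum.union_disjoint) (simp add: finite_triples, auto simp: D_def triples_def)
  also have "\<dots> \<le> (\<Sum>(i, j, k)\<in>I \<times> I \<times> I. \<phi> i j k)"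
    using assms by (intro sum_mono2) (auto simp: triples_def D_def)
  finally show ?thesis by (simp add: sum.cartesian_product)
qed

lemma sum_triples_swap:
  fixes \<phi> :: "nat \<Rightarrow> nat \<Rightarrow> nat \<Rightarrow> real"
  shows "(\<Sum>(i, j, k)\<in>triples. \<phi> j i k) = (\<Sum>(i, j, k)\<in>triples. \<phi> i j k)"
  by (rule sum.reindex_bij_witness[of _ "\<lambda>(i, j, k). (j, i, k)" "\<lambda>(i, j, k). (j, i, k)"])
     (auto simp: triples_def case_prod_unfold)

text \<open>Both ends are compared with the junction between them. One factor 2 comes from
  \<open>sq_diff_le\<close>, the other from exchanging \<open>i\<close> and \<open>j\<close>; the
  terms with \<open>i = j\<close> are left over and form the corner energy of the whole
  gasket.\<close>

lemma crossE_le: "crossE m u \<le> 4 * (rho * (\<Sum>i\<in>I. corner m (\<lambda>x. u (S i x))) - corner (Suc m) u)"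
proof -
  define \<phi> where "\<phi> i j k = (u (S i ((S j ^^ m) (p k))) - u (S i (p j)))\<^sup>2" for i j k
  have nn: "0 \<le> \<phi> i j k" for i j k by (simp add: \<phi>_def)
  have "(\<Sum>(i, j, k)\<in>triples. (u (S i ((S j ^^ m) (p k))) - u (S j ((S i ^^ m) (p k))))\<^sup>2)
      \<le> (\<Sum>(i, j, k)\<in>triples. 2 * \<phi> i j k + 2 * \<phi> j i k)"
    unfolding \<phi>_def by (intro sum_mono) (auto simp: S_comm[of _ "_"] intro!: sq_diff_le)
  also have "\<dots> = 4 * (\<Sum>(i, j, k)\<in>triples. \<phi> i j k)"
    using sum_triples_swap[of \<phi>] by (simp add: case_prod_unfold sum.distrib sum_distrib_left[symmetric])
  also have "\<dots> \<le> 4 * ((\<Sum>i\<in>I. \<Sum>j\<in>I. \<Sum>k\<in>I. \<phi> i j k) - (\<Sum>i\<in>I. \<Sum>k\<in>I. \<phi> i i k))"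
    using sum_triples_le[of \<phi>, OF nn] by simp
  finally have *: "rho ^ Suc m * (\<Sum>(i, j, k)\<in>triples. (u (S i ((S j ^^ m) (p k))) - u (S j ((S i ^^ m) (p k))))\<^sup>2)
     \<le> rho ^ Suc m * (4 * ((\<Sum>i\<in>I. \<Sum>j\<in>I. \<Sum>k\<in>I. \<phi> i j k) - (\<Sum>i\<in>I. \<Sum>k\<in>I. \<phi> i i k)))"
    using rho_pos by (intro mult_left_mono) auto
  have eq: "rho ^ Suc m * (4 * ((\<Sum>i\<in>I. \<Sum>j\<in>I. \<Sum>k\<in>I. \<phi> i j k) - (\<Sum>i\<in>I. \<Sum>k\<in>I. \<phi> i i k)))
     = 4 * (rho * (\<Sum>i\<in>I. corner m (\<lambda>x. u (S i x))) - corner (Suc m) u)"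
    unfolding corner_def \<phi>_def by (simp add: sum_distrib_left[symmetric] algebra_simps)
  \<comment> \<open>Covers \<open>m = 0\<close>, where \<open>crossE\<close> is 0 by
    definition.\<close>
  have "0 \<le> rho ^ Suc m * (4 * ((\<Sum>i\<in>I. \<Sum>j\<in>I. \<Sum>k\<in>I. \<phi> i j k) - (\<Sum>i\<in>I. \<Sum>k\<in>I. \<phi> i i k)))"
  proof -
    have "0 \<le> (\<Sum>(i, j, k)\<in>triples. \<phi> i j k)" using nn by (intro sum_nonneg) auto
    then show ?thesis using sum_triples_le[of \<phi>, OF nn] rho_pos by (intro mult_nonneg_nonneg) auto
  qed
  note r = this[unfolded eq]
  have "crossE m u = 0 \<or> crossE m u = rho ^ Suc m *
     (\<Sum>(i, j, k)\<in>triples. (u (S i ((S j ^^ m) (p k))) - u (S j ((S i ^^ m) (p k))))\<^sup>2)"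
    by (simp add: crossE_def)
  then show ?thesis using r *[unfolded eq] by (elim disjE) (simp_all only:)
qed

lemma WN_le_aux: "WN m u u \<le> 5 * EN m u u - 4 * corner m u"
proof (induction m arbitrary: u)
  case 0
  \<comment> \<open>At level 0 every edge ends at a corner of the gasket, which gives equality: 5 -
    4 = 1.\<close>
  have "corner 0 u = EN 0 u u"
    unfolding corner_def by (simp add: power2_eq_square) (subst sum.swap, rule refl)
  then show ?case by (simp add: WN_0)
next
  case (Suc m)
  have "rho * (\<Sum>i\<in>I. WN m (\<lambda>x. u (S i x)) (\<lambda>x. u (S i x))) \<le>
     rho * (\<Sum>i\<in>I. 5 * EN m (\<lambda>x. u (S i x)) (\<lambda>x. u (S i x)) - 4 * corner m (\<lambda>x. u (S i x)))"
    using rho_pos by (intro mult_left_mono sum_mono Suc.IH) auto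
  also have "\<dots> = 5 * EN (Suc m) u u - 4 * (rho * (\<Sum>i\<in>I. corner m (\<lambda>x. u (S i x))))"
    by (simp add: sum_subtractf sum_distrib_left[symmetric] algebra_simps)
  finally show ?case using crossE_le[of m u] unfolding WN_Suc by simp
qed

lemma WN_le: "WN m u u \<le> 5 * EN m u u"
  using WN_le_aux[of m u] corner_nonneg[of m u] by simp

text \<open>\<open>2 *\<^sub>R x - p i\<close> inverts \<open>S i\<close>. At a junction an
  unspecified cell is chosen, which is harmless once the pieces agree there.\<close>

definition glue :: "(nat \<Rightarrow> 'a \<Rightarrow> real) \<Rightarrow> 'a \<Rightarrow> real" where
  "glue v x = (let i = (SOME i. i \<in> I \<and> x \<in> S i ` V) in v i (2 *\<^sub>R x - p i))"

lemma S_inverse: "2 *\<^sub>R S i x - p i = x"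
  by (simp add: gasket_map_def scaleR_add_right)

lemma glue_S:
  assumes "\<And>i j. i \<in> I \<Longrightarrow> j \<in> I \<Longrightarrow> v i (p j) = v j (p i)" "i \<in> I" "x \<in> V"
  shows "glue v (S i x) = v i x"
proof -
  define j where "j = (SOME j. j \<in> I \<and> S i x \<in> S j ` V)"
  have "j \<in> I \<and> S i x \<in> S j ` V" unfolding j_def by (rule someI[of _ i]) (use assms in auto)
  then obtain y where y: "j \<in> I" "y \<in> V" "S i x = S j y" by auto
  have "glue v (S i x) = v j (2 *\<^sub>R S i x - p j)" by (simp add: glue_def j_def Let_def)
  also have "\<dots> = v j y" by (simp add: y(3) S_inverse)
  also have "\<dots> = v i x"
  proof (cases "i = j")
    case True
    then show ?thesis using y(3) by simp
  next
    case False
    have "x = p j" using overlap[OF assms(2) y(1) False assms(3) y(2,3)] .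
    moreover have "y = p i" using overlap[OF y(1) assms(2) _ y(2) assms(3)] False y(3) by simp
    ultimately show ?thesis using assms(1)[OF assms(2) y(1)] by simp
  qed
  finally show ?thesis .
qed

lemma cell_closed: "closed (S i ` V)"
  by (intro compact_imp_closed compact_continuous_image cont_S gasket_props)

lemma V_UN: "V = (\<Union>i\<in>I. S i ` V)"
  using gasket_props(3) by (simp add: hutch_def)

lemma cont_if_cells:
  assumes "\<And>i. i \<in> I \<Longrightarrow> continuous_on V (\<lambda>x. w (S i x))"
  shows "continuous_on V w"
proof -
  have "continuous_on (\<Union>i\<in>I. S i ` V) w"
  proof (rule continuous_on_closed_Union)
    fix i assume i: "i \<in> I"
    have "continuous_on (S i ` V) (\<lambda>y. w (S i (2 *\<^sub>R y - p i)))"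
      by (rule continuous_on_compose2[OF assms[OF i]]) (auto intro!: continuous_intros simp: S_inverse)
    then show "continuous_on (S i ` V) w"
      by (rule continuous_on_cong[THEN iffD1, rotated -1]) (auto simp: S_inverse)
  qed (auto simp: cell_closed)
  then show ?thesis using V_UN by simp
qed

lemma glue_cont:
  assumes "\<And>i j. i \<in> I \<Longrightarrow> j \<in> I \<Longrightarrow> v i (p j) = v j (p i)" "\<And>i. i \<in> I \<Longrightarrow> continuous_on V (v i)"
  shows "continuous_on V (glue v)"
proof (rule cont_if_cells)
  fix i assume i: "i \<in> I"
  show "continuous_on V (\<lambda>x. glue v (S i x))"
    by (rule continuous_on_cong[THEN iffD1, OF refl _ assms(2)[OF i]]) (simp add: glue_S[of v, OF assms(1) i])
qed

subsection \<open>Harmonic extension\<close>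

text \<open>The harmonic extension at the corners \<open>S i (p j)\<close> of cell \<open>i\<close>;
  for \<open>N = 3\<close> it is the rule with weights 2/5, 2/5, 1/5.\<close>

definition hstep :: "nat \<Rightarrow> (nat \<Rightarrow> real) \<Rightarrow> nat \<Rightarrow> real" where
  "hstep i b j = (if j = i then b i else (b i + b j + (\<Sum>k\<in>I. b k)) / (real N + 2))"

lemma hstep_sym: "hstep i b j = hstep j b i"
  by (simp add: hstep_def add_ac)

definition e0 :: "(nat \<Rightarrow> real) \<Rightarrow> (nat \<Rightarrow> real) \<Rightarrow> real" where
  "e0 b v = (\<Sum>i\<in>I. \<Sum>j\<in>I. (b i - b j) * (v i - v j))"

lemma EN_0_e0: "EN 0 u v = e0 (\<lambda>i. u (p i)) (\<lambda>i. v (p i))"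
  by (simp add: e0_def)

text \<open>The factor of \<open>v i\<close> is the discrete normal derivative at corner
  \<open>i\<close>.\<close>

lemma e0_eq: "e0 b v = 2 * (\<Sum>i\<in>I. (real N * b i - (\<Sum>k\<in>I. b k)) * v i)"
proof -
  have "e0 b v = (\<Sum>i\<in>I. \<Sum>j\<in>I. b i * v i) + (\<Sum>i\<in>I. \<Sum>j\<in>I. b j * v j) - (\<Sum>i\<in>I. \<Sum>j\<in>I. b i * v j) - (\<Sum>i\<in>I. \<Sum>j\<in>I. b j * v i)"
    unfolding e0_def by (simp add: algebra_simps sum.distrib sum_subtractf)
  also have "(\<Sum>i\<in>I. \<Sum>j\<in>I. b i * v i) = real N * (\<Sum>i\<in>I. b i * v i)" by (simp add: sum_distrib_left)
  also have "(\<Sum>i\<in>I. \<Sum>j\<in>I. b j * v j) = real N * (\<Sum>i\<in>I. b i * v i)" by simp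
  also have "(\<Sum>i\<in>I. \<Sum>j\<in>I. b i * v j) = (\<Sum>k\<in>I. b k) * (\<Sum>i\<in>I. v i)" by (simp add: sum_product)
  also have "(\<Sum>i\<in>I. \<Sum>j\<in>I. b j * v i) = (\<Sum>k\<in>I. b k) * (\<Sum>i\<in>I. v i)"
    by (simp add: sum_distrib_left sum_distrib_right)
  finally show ?thesis by (simp add: sum_subtractf left_diff_distrib sum_distrib_left algebra_simps)
qed

lemma sum_hstep: assumes "i \<in> I" shows "(\<Sum>j\<in>I. hstep i b j) = real N * (2 * b i + (\<Sum>k\<in>I. b k)) / (real N + 2)"
proof -
  have "(\<Sum>j\<in>I. hstep i b j) = b i + (\<Sum>j\<in>I - {i}. (b i + b j + (\<Sum>k\<in>I. b k)) / (real N + 2))"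
    using assms by (simp add: sum.remove[of I i] hstep_def)
  also have "(\<Sum>j\<in>I - {i}. (b i + b j + (\<Sum>k\<in>I. b k)) / (real N + 2)) =
     ((real N - 1) * b i + (\<Sum>j\<in>I - {i}. b j) + (real N - 1) * (\<Sum>k\<in>I. b k)) / (real N + 2)"
    using assms N2 by (simp add: sum_divide_distrib[symmetric] sum.distrib of_nat_diff)
  also have "(\<Sum>j\<in>I - {i}. b j) = (\<Sum>k\<in>I. b k) - b i" using assms by (simp add: sum_diff1)
  finally show ?thesis by (simp add: field_simps)
qed

text \<open>The matching condition that makes \<open>hstep\<close> energy minimising: off the diagonal the discrete normal
  derivatives from the two cells meeting at a junction cancel.\<close>

lemma e0_hstep:
  assumes sym: "\<And>i j. i \<in> I \<Longrightarrow> j \<in> I \<Longrightarrow> v i j = v j i"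
  shows "rho * (\<Sum>i\<in>I. e0 (hstep i b) (v i)) = e0 b (\<lambda>i. v i i)"
proof -
  define s where "s = (\<Sum>k\<in>I. b k)"
  define c where "c i j = (if j = i then real N * (real N * b i - s) / (real N + 2) else 0) + real N * (b j - b i) / (real N + 2)" for i j
  have c: "real N * hstep i b j - (\<Sum>k\<in>I. hstep i b k) = c i j" if "i \<in> I" for i j
  proof -
    define D where "D = real N + 2"
    have D: "real N = D - 2" "D \<noteq> 0" using N_pos by (auto simp: D_def)
    show ?thesis
      unfolding sum_hstep[OF that] unfolding c_def hstep_def s_def[symmetric] D_def[symmetric] D(1) using D(2)
      by (auto simp: field_simps)
  qed
  have anti: "(\<Sum>i\<in>I. \<Sum>j\<in>I. real N * (b j - b i) / (real N + 2) * v i j) = 0"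
  proof -
    let ?x = "\<Sum>i\<in>I. \<Sum>j\<in>I. real N * (b j - b i) / (real N + 2) * v i j"
    have "?x = (\<Sum>j\<in>I. \<Sum>i\<in>I. real N * (b j - b i) / (real N + 2) * v i j)" by (rule sum.swap)
    also have "\<dots> = (\<Sum>j\<in>I. \<Sum>i\<in>I. - (real N * (b i - b j) / (real N + 2) * v j i))"
      by (intro sum.cong refl) (simp add: sym field_simps)
    also have "\<dots> = - ?x" by (simp add: sum_negf)
    finally show ?thesis by simp
  qed
  have "(\<Sum>i\<in>I. e0 (hstep i b) (v i)) = 2 * (\<Sum>i\<in>I. \<Sum>j\<in>I. c i j * v i j)"
    unfolding e0_eq by (simp add: sum_distrib_left c cong: sum.cong)
  also have "(\<Sum>i\<in>I. \<Sum>j\<in>I. c i j * v i j) =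
     (\<Sum>i\<in>I. \<Sum>j\<in>I. (if j = i then real N * (real N * b i - s) / (real N + 2) * v i j else 0)) +
     (\<Sum>i\<in>I. \<Sum>j\<in>I. real N * (b j - b i) / (real N + 2) * v i j)"
    unfolding sum.distrib[symmetric] by (intro sum.cong refl) (simp add: c_def distrib_right)
  also have "\<dots> = real N / (real N + 2) * (\<Sum>i\<in>I. (real N * b i - s) * v i i)"
    unfolding anti by (simp add: sum_distrib_left mult.assoc cong: sum.cong)
  finally show ?thesis unfolding e0_eq s_def[symmetric] rho_def using N_pos by simp
qed

text \<open>\<open>1 / rho\<close>, and also the factor by which \<open>hstep\<close> shrinks
  oscillations. Since \<open>rho ^ m * (theta ^ m)\<^sup>2\<close> tends to 0, squared oscillations
  decay faster than the renormalisation grows.\<close>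

definition theta :: real where "theta = real N / (real N + 2)"

lemma theta: "0 < theta" "theta < 1" "rho * theta = 1"
  using N_pos by (auto simp: theta_def rho_def)

definition osc_le :: "(nat \<Rightarrow> real) \<Rightarrow> real \<Rightarrow> bool" where
  "osc_le b d \<longleftrightarrow> (\<forall>i\<in>I. \<forall>j\<in>I. \<bar>b i - b j\<bar> \<le> d)"

lemma osc_exists: "\<exists>d\<ge>0. osc_le b d"
proof -
  define d where "d = 2 * (\<Sum>k\<in>I. \<bar>b k\<bar>)"
  have "\<bar>b i\<bar> \<le> (\<Sum>k\<in>I. \<bar>b k\<bar>)" if "i \<in> I" for i by (rule member_le_sum) (use that in auto)
  then have "osc_le b d" unfolding osc_le_def d_def by (smt (verit))
  moreover have "0 \<le> d" unfolding d_def by (auto intro: sum_nonneg)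
  ultimately show ?thesis by blast
qed

lemma hstep_diff: assumes "j \<noteq> l" "l \<in> I"
  shows "hstep l b j - b l = ((b j - b l) + (\<Sum>k\<in>I. b k - b l)) / (real N + 2)"
  using assms N_pos by (simp add: hstep_def sum_subtractf field_simps)

text \<open>The deviation from the corner value \<open>b l\<close> is a sum of \<open>N\<close>
  differences, each at most \<open>d\<close>, divided by \<open>N + 2\<close>. Two values at other
  corners differ by even less.\<close>

lemma osc_hstep: assumes "osc_le b d" "l \<in> I" shows "osc_le (hstep l b) (theta * d)"
proof -
  have d: "0 \<le> d" using assms by (auto simp: osc_le_def dest!: bspec[of _ _ l])
  have b: "\<bar>b i - b j\<bar> \<le> d" if "i \<in> I" "j \<in> I" for i j using assms that by (auto simp: osc_le_def)
  have 1: "\<bar>hstep l b j - b l\<bar> \<le> theta * d" if j: "j \<in> I" for j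
  proof (cases "j = l")
    case True
    then show ?thesis using theta d by (simp add: hstep_def)
  next
    case False
    have "\<bar>\<Sum>k\<in>I. b k - b l\<bar> = \<bar>\<Sum>k\<in>I - {l}. b k - b l\<bar>" using assms(2) by (simp add: sum.remove)
    also have "\<dots> \<le> (\<Sum>k\<in>I - {l}. d)" using b assms(2) by (intro sum_abs[THEN order_trans] sum_mono) auto
    also have "\<dots> = (real N - 1) * d" using assms(2) N2 by (simp add: of_nat_diff)
    finally have "\<bar>(b j - b l) + (\<Sum>k\<in>I. b k - b l)\<bar> \<le> real N * d" using b[OF j assms(2)] by (simp add: algebra_simps)
    then show ?thesis unfolding hstep_diff[OF False assms(2)] theta_def using N_pos by (simp add: abs_divide divide_right_mono)
  qed
  have "\<bar>hstep l b i - hstep l b j\<bar> \<le> theta * d" if ij: "i \<in> I" "j \<in> I" for i j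
  proof (cases "i = l \<or> j = l")
    case True
    then show ?thesis using 1[OF ij(1)] 1[OF ij(2)] by (auto simp: hstep_def abs_minus_commute)
  next
    case False
    then have "hstep l b i - hstep l b j = (b i - b j) / (real N + 2)" by (simp add: hstep_def diff_divide_distrib[symmetric])
    then have "\<bar>hstep l b i - hstep l b j\<bar> \<le> d / (real N + 2)"
      using b[OF ij] N_pos by (simp add: abs_divide divide_right_mono)
    also have "\<dots> \<le> theta * d" unfolding theta_def using d N_pos N2
      by (simp add: divide_right_mono mult_le_cancel_right1)
    finally show ?thesis .
  qed
  then show ?thesis by (simp add: osc_le_def)
qed

text \<open>Approximants of the harmonic function: its values at the vertices of level
  \<open>m\<close>, affine on each cell of level \<open>m\<close>.\<close>

primrec harm :: "nat \<Rightarrow> (nat \<Rightarrow> real) \<Rightarrow> 'a \<Rightarrow> real" where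
  "harm 0 b = (\<lambda>x. \<Sum>i\<in>I. b i * bc i x)"
| "harm (Suc m) b = glue (\<lambda>i. harm m (hstep i b))"

text \<open>Proved together: gluing needs the corner values at level \<open>m\<close>, and the
  corner values at level \<open>m + 1\<close> need the rule on cells.\<close>

lemma harm_p_S: "(\<forall>i\<in>I. harm m b (p i) = b i) \<and> (\<forall>i\<in>I. \<forall>x\<in>V. harm (Suc m) b (S i x) = harm m (hstep i b) x)"
proof (induction m arbitrary: b)
  case 0
  have 1: "harm 0 b (p i) = b i" if "i \<in> I" for i b
  proof -
    have "harm 0 b (p i) = (\<Sum>j\<in>I. if j = i then b j else 0)"
      unfolding harm.simps by (rule sum.cong) (use that in \<open>auto simp: bc_p\<close>)
    then show ?thesis using that by simp
  qed
  have "harm (Suc 0) b (S i x) = harm 0 (hstep i b) x" if "i \<in> I" "x \<in> V" for i x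
    unfolding harm.simps(2) by (rule glue_S) (use that 1 hstep_sym in auto)
  then show ?case using 1 by blast
next
  case (Suc m)
  have 1: "harm (Suc m) b (p i) = b i" if "i \<in> I" for i b
    using Suc.IH[of b] Suc.IH[of "hstep i b"] that p_in_V[OF that] S_fix[of i] by (metis hstep_def)
  have "harm (Suc (Suc m)) b (S i x) = harm (Suc m) (hstep i b) x" if "i \<in> I" "x \<in> V" for i x
    unfolding harm.simps(2)[of "Suc m"] by (rule glue_S) (use that 1 hstep_sym in auto)
  then show ?case using 1 by blast
qed

lemma harm_cont: "continuous_on V (harm m b)"
proof (induction m arbitrary: b)
  case 0
  show ?case unfolding harm.simps bc_def by (intro continuous_intros)
next
  case (Suc m)
  show ?case unfolding harm.simps by (intro glue_cont Suc) (use harm_p_S hstep_sym in auto)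
qed

lemma harm_0_near: assumes "osc_le b d" "x \<in> V" "i \<in> I" shows "\<bar>harm 0 b x - b i\<bar> \<le> d"
proof -
  have "harm 0 b x - b i = (\<Sum>j\<in>I. (b j - b i) * bc j x)"
    by (simp add: left_diff_distrib sum_subtractf sum_distrib_left[symmetric] sum_bc)
  also have "\<bar>\<dots>\<bar> \<le> (\<Sum>j\<in>I. d * bc j x)"
    using assms bc_nonneg by (intro sum_abs[THEN order_trans] sum_mono) (auto simp: abs_mult osc_le_def intro!: mult_right_mono)
  also have "\<dots> = d" by (simp add: sum_distrib_left[symmetric] sum_bc)
  finally show ?thesis .
qed

text \<open>Passing to a cell shrinks the oscillation by \<open>theta\<close>; this supplies the
  summable bound for the Weierstrass test.\<close>

lemma harm_diff: "osc_le b d \<Longrightarrow> x \<in> V \<Longrightarrow> \<bar>harm (Suc m) b x - harm m b x\<bar> \<le> 2 * d * theta ^ m"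
proof (induction m arbitrary: b d x)
  case 0
  have d: "0 \<le> d" using 0 one_in_I by (auto simp: osc_le_def dest!: bspec[of _ _ 1])
  obtain i y where y: "i \<in> I" "y \<in> V" "x = S i y" using V_cases[OF 0(2)] .
  have "harm (Suc 0) b x = harm 0 (hstep i b) y" using harm_p_S y by blast
  moreover have "\<bar>harm 0 (hstep i b) y - hstep i b i\<bar> \<le> theta * d" by (rule harm_0_near) (use osc_hstep 0 y in auto)
  moreover have "hstep i b i = b i" by (simp add: hstep_def)
  moreover have "\<bar>harm 0 b x - b i\<bar> \<le> d" by (rule harm_0_near) (use 0 y in auto)
  moreover have "theta * d \<le> 1 * d" using theta d by (intro mult_right_mono) auto
  ultimately show ?case by (simp del: harm.simps)
next
  case (Suc m)
  obtain i y where y: "i \<in> I" "y \<in> V" "x = S i y" using V_cases[OF Suc.prems(2)] .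
  have "harm (Suc (Suc m)) b x = harm (Suc m) (hstep i b) y" "harm (Suc m) b x = harm m (hstep i b) y"
    using harm_p_S y by blast+
  then show ?case using Suc.IH[OF osc_hstep[OF Suc.prems(1) y(1)] y(2)] by (simp add: mult_ac del: harm.simps)
qed

definition Hm :: "(nat \<Rightarrow> real) \<Rightarrow> 'a \<Rightarrow> real" where "Hm b x = lim (\<lambda>m. harm m b x)"

lemma harm_uniform: "uniform_limit V (\<lambda>m. harm m b) (Hm b) sequentially"
proof -
  obtain d where d: "0 \<le> d" "osc_le b d" using osc_exists by blast
  let ?f = "\<lambda>m x. harm (Suc m) b x - harm m b x"
  have "uniform_limit V (\<lambda>n x. \<Sum>i<n. ?f i x) (\<lambda>x. suminf (\<lambda>i. ?f i x)) sequentially"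
  proof (rule Weierstrass_m_test)
    show "norm (?f n x) \<le> 2 * d * theta ^ n" if "x \<in> V" for n x using harm_diff[OF d(2) that] by simp
    show "summable (\<lambda>n. 2 * d * theta ^ n)" using theta by (intro summable_mult summable_geometric) auto
  qed
  moreover have "(\<Sum>i<n. ?f i x) = harm n b x - harm 0 b x" for n x by (rule sum_lessThan_telescope)
  ultimately have "uniform_limit V (\<lambda>n x. harm n b x - harm 0 b x) (\<lambda>x. suminf (\<lambda>i. ?f i x)) sequentially"
    by (simp del: harm.simps)
  from uniform_limit_add[OF this uniform_limit_const, of "harm 0 b"]
  have ul: "uniform_limit V (\<lambda>n. harm n b) (\<lambda>x. suminf (\<lambda>i. ?f i x) + harm 0 b x) sequentially"
    by (simp del: harm.simps)
  have "Hm b x = suminf (\<lambda>i. ?f i x) + harm 0 b x" if "x \<in> V" for x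
    unfolding Hm_def by (rule limI) (rule tendsto_uniform_limitI[OF ul that])
  then show ?thesis using uniform_limit_cong'[of V "\<lambda>n. harm n b" "\<lambda>n. harm n b" "Hm b"] ul by auto
qed

lemma harm_lim: "x \<in> V \<Longrightarrow> (\<lambda>m. harm m b x) \<longlonglongrightarrow> Hm b x"
  by (rule tendsto_uniform_limitI[OF harm_uniform])

lemma Hm_cont: "continuous_on V (Hm b)"
  by (rule uniform_limit_theorem[OF _ harm_uniform]) (auto simp: harm_cont simp del: harm.simps)

lemma Hm_p: assumes "i \<in> I" shows "Hm b (p i) = b i"
proof -
  have "(\<lambda>m. harm m b (p i)) = (\<lambda>m. b i)" using harm_p_S assms by blast
  then show ?thesis using harm_lim[OF p_in_V[OF assms], of b] by (simp add: LIMSEQ_const_iff)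
qed

lemma Hm_S: assumes "i \<in> I" "x \<in> V" shows "Hm b (S i x) = Hm (hstep i b) x"
proof -
  have "(\<lambda>m. harm (Suc m) b (S i x)) \<longlonglongrightarrow> Hm b (S i x)"
    by (rule LIMSEQ_Suc[OF harm_lim]) (use S_in_V assms in auto)
  moreover have "(\<lambda>m. harm (Suc m) b (S i x)) = (\<lambda>m. harm m (hstep i b) x)" using harm_p_S assms by blast
  ultimately show ?thesis using harm_lim[OF assms(2), of "hstep i b"] LIMSEQ_unique by auto
qed

text \<open>Against a harmonic function only the boundary values of \<open>v\<close> count, at every
  level. The orthogonality relations for splines rest on this.\<close>

lemma EN_Hm: "EN m (Hm b) v = e0 b (\<lambda>i. v (p i))"
proof (induction m arbitrary: b v)
  case 0
  show ?case unfolding EN_0_e0 e0_def by (intro sum.cong refl) (simp add: Hm_p)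
next
  case (Suc m)
  have "EN (Suc m) (Hm b) v = rho * (\<Sum>i\<in>I. EN m (Hm (hstep i b)) (\<lambda>x. v (S i x)))"
    unfolding EN.simps by (intro arg_cong[where f = "(*) rho"] sum.cong refl EN_cong) (auto simp: Hm_S)
  also have "\<dots> = rho * (\<Sum>i\<in>I. e0 (hstep i b) (\<lambda>j. v (S i (p j))))" by (simp only: Suc.IH)
  also have "\<dots> = e0 b (\<lambda>i. v (S i (p i)))" by (rule e0_hstep) (simp add: S_comm)
  finally show ?case by simp
qed

subsection \<open>Harmonic splines\<close>

text \<open>Harmonic on every cell of level \<open>k\<close>, with the values of \<open>u\<close> at
  the vertices of level \<open>k\<close>.\<close>

primrec spline :: "nat \<Rightarrow> ('a \<Rightarrow> real) \<Rightarrow> 'a \<Rightarrow> real" where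
  "spline 0 u = Hm (\<lambda>i. u (p i))"
| "spline (Suc k) u = glue (\<lambda>i. spline k (\<lambda>x. u (S i x)))"

lemma spline_p_S: "(\<forall>i\<in>I. spline k u (p i) = u (p i)) \<and> (\<forall>i\<in>I. \<forall>x\<in>V. spline (Suc k) u (S i x) = spline k (\<lambda>x. u (S i x)) x)"
proof (induction k arbitrary: u)
  case 0
  have 1: "spline 0 u (p i) = u (p i)" if "i \<in> I" for i u using that by (simp add: Hm_p)
  have "spline (Suc 0) u (S i x) = spline 0 (\<lambda>x. u (S i x)) x" if "i \<in> I" "x \<in> V" for i x
    unfolding spline.simps(2) by (rule glue_S) (use that 1 in \<open>auto simp: S_comm simp del: spline.simps\<close>)
  then show ?case using 1 by blast
next
  case (Suc k)
  have 1: "spline (Suc k) u (p i) = u (p i)" if "i \<in> I" for i u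
    using Suc.IH[of u] Suc.IH[of "\<lambda>x. u (S i x)"] that p_in_V[OF that] S_fix[of i] by metis
  have "spline (Suc (Suc k)) u (S i x) = spline (Suc k) (\<lambda>x. u (S i x)) x" if "i \<in> I" "x \<in> V" for i x
    unfolding spline.simps(2)[of "Suc k"] by (rule glue_S) (use that 1 in \<open>auto simp: S_comm simp del: spline.simps\<close>)
  then show ?case using 1 by blast
qed

lemma spline_S: "i \<in> I \<Longrightarrow> x \<in> V \<Longrightarrow> spline (Suc k) u (S i x) = spline k (\<lambda>x. u (S i x)) x"
  and spline_p: "i \<in> I \<Longrightarrow> spline k u (p i) = u (p i)"
  using spline_p_S by blast+

lemma spline_cont: "continuous_on V (spline k u)"
proof (induction k arbitrary: u)
  case 0
  show ?case by (simp add: Hm_cont)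
next
  case (Suc k)
  show ?case unfolding spline.simps by (intro glue_cont Suc) (auto simp: spline_p S_comm)
qed

text \<open>The spline is the energy projection of \<open>u\<close>: its pairing with
  \<open>v\<close> sees only the values of both at level \<open>k\<close>. Pythagoras and
  monotonicity in the level follow.\<close>

lemma EN_spline: "EN (k + m) (spline k u) v = EN k u v"
proof (induction k arbitrary: u v)
  case 0
  show ?case by (simp add: EN_Hm EN_0_e0 del: EN.simps)
next
  case (Suc k)
  have "EN (Suc k + m) (spline (Suc k) u) v = rho * (\<Sum>i\<in>I. EN (k + m) (spline k (\<lambda>x. u (S i x))) (\<lambda>x. v (S i x)))"
    unfolding add_Suc EN.simps
    by (intro arg_cong[where f = "(*) rho"] sum.cong refl EN_cong) (auto simp: spline_S simp del: spline.simps)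
  also have "\<dots> = EN (Suc k) u v" by (simp add: Suc.IH)
  finally show ?case .
qed

lemma EN_spline_spline: "EN (k + m) (spline k u) (spline k u) = EN k u u"
  using EN_spline[of k m u "spline k u"] EN_spline[of k 0 u u] EN_sym by simp

lemma EN_diff_spline: "EN (k + m) (\<lambda>x. 1 * u x + (-1) * spline k u x) (\<lambda>x. 1 * u x + (-1) * spline k u x) = EN (k + m) u u - EN k u u"
  unfolding EN_lin EN_lin_right using EN_spline[of k m u u] EN_spline_spline[of k m u] EN_sym[of "k + m" u "spline k u"] by simp

lemma EN_mono: "k \<le> m \<Longrightarrow> EN k u u \<le> EN m u u"
  using EN_diff_spline[of k "m - k" u] EN_nonneg[of m "\<lambda>x. 1 * u x + (-1) * spline k u x"] by simp

subsection \<open>Convergence of the level energies\<close>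

text \<open>Iteration towards corner \<open>j\<close> treats the other corners alike: differences to
  the value at \<open>j\<close> that sum to 0 are divided by \<open>N + 2\<close>, and the sum of
  the differences is multiplied by \<open>theta\<close>. The order of quantifiers is the point:
  \<open>a\<close> and \<open>b\<close> depend on \<open>m\<close> alone.\<close>

lemma hstep_pow: "\<exists>a b. \<forall>j\<in>I. \<forall>c. \<forall>k\<in>I. k \<noteq> j \<longrightarrow>
  (hstep j ^^ m) c k = c j + a * (c k - c j) + b * (\<Sum>l\<in>I. c l - c j)"
proof (induction m)
  case 0
  show ?case by (rule exI[of _ 1], rule exI[of _ 0]) simp
next
  case (Suc m)
  then obtain a b where ab: "\<And>j c k. j \<in> I \<Longrightarrow> k \<in> I \<Longrightarrow> k \<noteq> j \<Longrightarrow>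
    (hstep j ^^ m) c k = c j + a * (c k - c j) + b * (\<Sum>l\<in>I. c l - c j)" by metis
  have "(hstep j ^^ Suc m) c k = c j + a / (real N + 2) * (c k - c j) +
     (a / (real N + 2) + b * theta) * (\<Sum>l\<in>I. c l - c j)" if jk: "j \<in> I" "k \<in> I" "k \<noteq> j" for j c k
  proof -
    define s where "s = (\<Sum>l\<in>I. c l - c j)"
    have Ajj: "hstep j c j = c j" by (simp add: hstep_def)
    have Ak: "hstep j c k - c j = ((c k - c j) + s) / (real N + 2)"
      using hstep_diff[OF jk(3,1), of c] by (simp add: s_def)
    have "(\<Sum>l\<in>I. hstep j c l - c j) = real N * (2 * c j + (\<Sum>k\<in>I. c k)) / (real N + 2) - real N * c j"
      by (simp add: sum_subtractf sum_hstep[OF jk(1)])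
    also have "(\<Sum>k\<in>I. c k) = s + real N * c j" by (simp add: s_def sum_subtractf)
    finally have sA: "(\<Sum>l\<in>I. hstep j c l - c j) = theta * s"
      using N_pos by (simp add: theta_def field_simps)
    have "(hstep j ^^ Suc m) c k = (hstep j ^^ m) (hstep j c) k" by (simp add: funpow_swap1)
    also have "\<dots> = c j + a * (hstep j c k - c j) + b * (\<Sum>l\<in>I. hstep j c l - c j)"
      using ab[OF jk, of "hstep j c"] by (simp add: Ajj)
    also have "\<dots> = c j + a / (real N + 2) * (c k - c j) + (a / (real N + 2) + b * theta) * s"
    proof -
      have "a * ((y + s) / D) + b * (theta * s) = a / D * y + (a / D + b * theta) * s" for y D
        by (simp add: add_divide_distrib distrib_left distrib_right)
      then show ?thesis unfolding sA Ak by simp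
    qed
    finally show ?thesis by (simp add: s_def)
  qed
  then show ?case by blast
qed

lemma Hm_pow: "j \<in> I \<Longrightarrow> x \<in> V \<Longrightarrow> Hm c ((S j ^^ m) x) = Hm ((hstep j ^^ m) c) x"
proof (induction m arbitrary: c)
  case (Suc m)
  have "(S j ^^ m) x \<in> V" by (induction m) (use Suc.prems S_in_V in auto)
  then have "Hm c ((S j ^^ Suc m) x) = Hm (hstep j c) ((S j ^^ m) x)" using Suc.prems by (simp add: Hm_S)
  also have "\<dots> = Hm ((hstep j ^^ Suc m) c) x" using Suc.IH[of "hstep j c"] Suc.prems by (simp add: funpow_swap1)
  finally show ?case .
qed simp

lemma S_pow_V: "j \<in> I \<Longrightarrow> x \<in> V \<Longrightarrow> (S j ^^ m) x \<in> V"
  by (induction m) (auto simp: S_in_V)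

lemma sum_triples_pairs:
  fixes \<phi> :: "nat \<Rightarrow> nat \<Rightarrow> real"
  assumes "\<And>i. \<phi> i i = 0"
  shows "(\<Sum>(i, j, k)\<in>triples. \<phi> i j) = (real N - 2) * (\<Sum>i\<in>I. \<Sum>j\<in>I. \<phi> i j)"
proof -
  have t: "triples = (SIGMA i:I. SIGMA j:I - {i}. I - {i, j})" by (auto simp: triples_def)
  have "(\<Sum>(i, j, k)\<in>triples. \<phi> i j) = (\<Sum>i\<in>I. \<Sum>j\<in>I - {i}. \<Sum>k\<in>I - {i, j}. \<phi> i j)"
  proof -
    have "(\<Sum>(i, j, k)\<in>triples. \<phi> i j) = (\<Sum>i\<in>I. \<Sum>(j, k)\<in>(SIGMA j:I - {i}. I - {i, j}). \<phi> i j)"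
      unfolding t by (subst sum.Sigma) (auto simp: split_def)
    also have "\<dots> = (\<Sum>i\<in>I. \<Sum>j\<in>I - {i}. \<Sum>k\<in>I - {i, j}. \<phi> i j)"
      by (intro sum.cong[OF refl], subst sum.Sigma) auto
    finally show ?thesis .
  qed
  also have "\<dots> = (\<Sum>i\<in>I. \<Sum>j\<in>I - {i}. (real N - 2) * \<phi> i j)"
  proof (intro sum.cong refl)
    fix i j assume ij: "i \<in> I" "j \<in> I - {i}"
    then have "card (I - {i, j}) = N - 2" by (simp add: card_Diff_subset)
    then show "(\<Sum>k\<in>I - {i, j}. \<phi> i j) = (real N - 2) * \<phi> i j" using N2 by (simp add: of_nat_diff)
  qed
  also have "\<dots> = (\<Sum>i\<in>I. \<Sum>j\<in>I. (real N - 2) * \<phi> i j)"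
  proof (rule sum.cong[OF refl])
    fix i assume "i \<in> I"
    then show "(\<Sum>j\<in>I - {i}. (real N - 2) * \<phi> i j) = (\<Sum>j\<in>I. (real N - 2) * \<phi> i j)"
      by (simp add: sum.remove[of I i] assms)
  qed
  finally show ?thesis by (simp add: sum_distrib_left)
qed

text \<open>The jump across a junction is \<open>\<gamma> * (b i - b j)\<close> for every
  \<open>k\<close>, because \<open>b k\<close> cancels; each pair \<open>i\<close>, \<open>j\<close>
  therefore counts \<open>N - 2\<close> times.\<close>

lemma crossE_Hm: "\<exists>\<zeta>\<ge>0. \<forall>b. crossE m (Hm b) = \<zeta> * e0 b b"
proof (cases "m = 0")
  case True
  then show ?thesis by (auto simp: crossE_def)
next
  case False
  obtain a a' where aa: "\<And>j c k. j \<in> I \<Longrightarrow> k \<in> I \<Longrightarrow> k \<noteq> j \<Longrightarrow>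
    (hstep j ^^ m) c k = c j + a * (c k - c j) + a' * (\<Sum>l\<in>I. c l - c j)" using hstep_pow[of m] by metis
  define \<gamma> where "\<gamma> = (a + 2 * real N * a') / (real N + 2)"
  have cr: "Hm b (S i ((S j ^^ m) (p k))) - Hm b (S j ((S i ^^ m) (p k))) = \<gamma> * (b i - b j)"
    if t: "(i, j, k) \<in> triples" for b i j k
  proof -
    have ijk: "i \<in> I" "j \<in> I" "k \<in> I" "i \<noteq> j" "k \<noteq> i" "k \<noteq> j" using t by (auto simp: triples_def)
    have v: "Hm b (S i ((S j ^^ m) (p k))) = hstep i b j + a * (hstep i b k - hstep i b j) + a' * (\<Sum>l\<in>I. hstep i b l - hstep i b j)"
      if "i \<in> I" "j \<in> I" "k \<in> I" "k \<noteq> j" for i j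
      using that aa[OF that(2,3,4), of "hstep i b"]
      by (simp add: Hm_S S_pow_V p_in_V Hm_pow Hm_p)
    have "Hm b (S i ((S j ^^ m) (p k))) - Hm b (S j ((S i ^^ m) (p k))) =
       a * (hstep i b k - hstep j b k) + a' * ((\<Sum>l\<in>I. hstep i b l) - (\<Sum>l\<in>I. hstep j b l))"
      unfolding v[OF ijk(1,2,3,6)] v[OF ijk(2,1,3,5)] hstep_sym[of j b i] by (simp add: sum_subtractf algebra_simps)
    also have "hstep i b k - hstep j b k = (b i - b j) / (real N + 2)"
      using ijk by (simp add: hstep_def diff_divide_distrib[symmetric])
    also have "(\<Sum>l\<in>I. hstep i b l) - (\<Sum>l\<in>I. hstep j b l) = 2 * real N * (b i - b j) / (real N + 2)"
      unfolding sum_hstep[OF ijk(1)] sum_hstep[OF ijk(2)] by (simp add: diff_divide_distrib[symmetric] algebra_simps)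
    also have "a * ((b i - b j) / (real N + 2)) + a' * (2 * real N * (b i - b j) / (real N + 2)) = \<gamma> * (b i - b j)"
    proof -
      have "a * (x / D) + a' * (2 * real N * x / D) = (a + 2 * real N * a') / D * x" for x D
        by (simp add: add_divide_distrib distrib_right distrib_left mult_ac)
      then show ?thesis unfolding \<gamma>_def .
    qed
    finally show ?thesis .
  qed
  have "crossE m (Hm b) = (rho ^ Suc m * (\<gamma>\<^sup>2 * (real N - 2))) * e0 b b" for b
  proof -
    have "(\<Sum>(i, j, k)\<in>triples. (Hm b (S i ((S j ^^ m) (p k))) - Hm b (S j ((S i ^^ m) (p k))))\<^sup>2)
       = (\<Sum>(i, j, k)\<in>triples. \<gamma>\<^sup>2 * (b i - b j)\<^sup>2)"
      by (intro sum.cong refl) (auto simp: cr power_mult_distrib)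
    also have "\<dots> = (real N - 2) * (\<Sum>i\<in>I. \<Sum>j\<in>I. \<gamma>\<^sup>2 * (b i - b j)\<^sup>2)" by (rule sum_triples_pairs) simp
    also have "\<dots> = (real N - 2) * (\<gamma>\<^sup>2 * e0 b b)" by (simp add: e0_def sum_distrib_left power2_eq_square)
    finally show ?thesis using False by (simp add: crossE_def)
  qed
  moreover have "0 \<le> rho ^ Suc m * (\<gamma>\<^sup>2 * (real N - 2))" using rho_pos N2 by simp
  ultimately show ?thesis by blast
qed

lemma kappa_exists: "\<exists>\<kappa> c. 1 \<le> \<kappa> \<and> c \<longlonglongrightarrow> \<kappa> \<and> (\<forall>m b. WN m (Hm b) (Hm b) = c m * e0 b b)"
proof -
  obtain \<zeta> where \<zeta>: "\<And>m. 0 \<le> \<zeta> m" "\<And>m b. crossE m (Hm b) = \<zeta> m * e0 b b" using crossE_Hm by metis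
  define c where "c m = 1 + (\<Sum>k<m. \<zeta> k)" for m :: nat
  have W: "WN m (Hm b) (Hm b) = c m * e0 b b" for m b
  proof (induction m arbitrary: b)
    case 0
    show ?case using EN_Hm[of 0 b "Hm b"] by (simp add: WN_0 c_def Hm_p e0_def cong: sum.cong)
  next
    case (Suc m)
    have "WN (Suc m) (Hm b) (Hm b) = rho * (\<Sum>i\<in>I. WN m (Hm (hstep i b)) (Hm (hstep i b))) + \<zeta> m * e0 b b"
      unfolding WN_Suc \<zeta>(2)[symmetric]
      by (intro arg_cong2[where f = "(+)"] arg_cong[where f = "(*) rho"] sum.cong refl WN_cong) (auto simp: Hm_S)
    also have "rho * (\<Sum>i\<in>I. WN m (Hm (hstep i b)) (Hm (hstep i b))) = c m * (rho * (\<Sum>i\<in>I. e0 (hstep i b) (hstep i b)))"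
      by (simp add: Suc.IH sum_distrib_left mult_ac)
    also have "rho * (\<Sum>i\<in>I. e0 (hstep i b) (hstep i b)) = e0 b (\<lambda>i. hstep i b i)" by (rule e0_hstep) (rule hstep_sym)
    also have "(\<lambda>i. hstep i b i) = b" by (auto simp: hstep_def)
    finally show ?case by (simp add: c_def algebra_simps)
  qed
  have inc: "incseq c" by (rule incseq_SucI) (simp add: c_def \<zeta>)
  \<comment> \<open>Boundary values of positive energy, which turn \<open>WN_le\<close> into the
    bound 5 for \<open>c\<close>.\<close>
  define b where "b i = (if i = 1 then 1 else 0 :: real)" for i :: nat
  have "0 < e0 b b"
  proof -
    have "2 \<in> I" using N2 by (simp add: I_def)
    then have "(b 1 - b 2) * (b 1 - b 2) \<le> (\<Sum>j\<in>I. (b 1 - b j) * (b 1 - b j))" by (intro member_le_sum) auto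
    also have "\<dots> \<le> e0 b b" unfolding e0_def using one_in_I
      by (intro member_le_sum[of 1 I "\<lambda>i. \<Sum>j\<in>I. (b i - b j) * (b i - b j)"]) (auto intro: sum_nonneg)
    finally show ?thesis by (simp add: b_def)
  qed
  have "c m \<le> 5" for m
  proof -
    have "c m * e0 b b \<le> 5 * e0 b b"
      using WN_le[of m "Hm b"] EN_Hm[of m b "Hm b"] by (simp add: W Hm_p e0_def cong: sum.cong)
    then show ?thesis using \<open>0 < e0 b b\<close> by simp
  qed
  then obtain \<kappa> where \<kappa>: "c \<longlonglongrightarrow> \<kappa>" using incseq_convergent[OF inc, of 5] by blast
  moreover have "1 \<le> \<kappa>" using incseq_le[OF inc \<kappa>, of 0] by (simp add: c_def)
  ultimately show ?thesis using W by blast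
qed

definition kappa :: real where
  "kappa = (SOME \<kappa>. 1 \<le> \<kappa> \<and> (\<exists>c. c \<longlonglongrightarrow> \<kappa> \<and> (\<forall>m b. WN m (Hm b) (Hm b) = c m * e0 b b)))"

lemma kappa: "1 \<le> kappa" "(\<lambda>m. WN m (Hm b) (Hm b)) \<longlonglongrightarrow> kappa * e0 b b"
proof -
  have ex: "\<exists>\<kappa>. 1 \<le> \<kappa> \<and> (\<exists>c. c \<longlonglongrightarrow> \<kappa> \<and> (\<forall>m b. WN m (Hm b) (Hm b) = c m * e0 b b))"
    using kappa_exists by blast
  note k = someI_ex[OF ex, folded kappa_def]
  then obtain c where "c \<longlonglongrightarrow> kappa" "\<forall>m b. WN m (Hm b) (Hm b) = c m * e0 b b" by blast
  then show "(\<lambda>m. WN m (Hm b) (Hm b)) \<longlonglongrightarrow> kappa * e0 b b" by (simp add: tendsto_mult_right)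
  show "1 \<le> kappa" using k by blast
qed

lemma osc_hstep_pow: "osc_le b d \<Longrightarrow> j \<in> I \<Longrightarrow> osc_le ((hstep j ^^ m) b) (theta ^ m * d)"
  by (induction m) (auto dest: osc_hstep simp: mult_ac)

text \<open>Close to corner \<open>j\<close> a spline is harmonic, so the squared difference decays
  like \<open>theta ^ (2 * m)\<close> and beats \<open>rho ^ m\<close>. Since
  \<open>S j (p j) = p j\<close>, the induction only shifts \<open>m\<close>.\<close>

lemma spline_corner: "l \<in> I \<Longrightarrow> j \<in> I \<Longrightarrow> (\<lambda>m. rho ^ m * (spline k u ((S j ^^ m) (p l)) - u (p j))\<^sup>2) \<longlonglongrightarrow> 0"
proof (induction k arbitrary: u)
  case 0
  define b where "b = (\<lambda>i. u (p i))"
  obtain d where d: "0 \<le> d" "osc_le b d" using osc_exists by blast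
  show ?case
  proof (rule Lim_null_comparison)
    have "rho ^ m * (spline 0 u ((S j ^^ m) (p l)) - u (p j))\<^sup>2 \<le> theta ^ m * d\<^sup>2" for m
    proof -
      have "spline 0 u ((S j ^^ m) (p l)) = (hstep j ^^ m) b l" "(hstep j ^^ m) b j = u (p j)"
        using 0 by (auto simp: b_def Hm_pow p_in_V Hm_p) (induction m, auto simp: hstep_def)
      moreover have "\<bar>(hstep j ^^ m) b l - (hstep j ^^ m) b j\<bar> \<le> theta ^ m * d"
        using osc_hstep_pow[OF d(2) 0(2), of m] 0 by (auto simp: osc_le_def)
      ultimately have "\<bar>spline 0 u ((S j ^^ m) (p l)) - u (p j)\<bar> \<le> theta ^ m * d" by simp
      then have "\<bar>spline 0 u ((S j ^^ m) (p l)) - u (p j)\<bar>\<^sup>2 \<le> (theta ^ m * d)\<^sup>2" by (intro power_mono) auto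
      then have "(spline 0 u ((S j ^^ m) (p l)) - u (p j))\<^sup>2 \<le> (theta ^ m * d)\<^sup>2" by simp
      then have "rho ^ m * (spline 0 u ((S j ^^ m) (p l)) - u (p j))\<^sup>2 \<le> rho ^ m * (theta ^ m * d)\<^sup>2"
        using rho_pos by (intro mult_left_mono) auto
      also have "\<dots> = (rho * theta) ^ m * (theta ^ m * d\<^sup>2)"
        by (simp add: power_mult_distrib power2_eq_square)
      finally show ?thesis by (simp add: theta)
    qed
    then show "\<forall>\<^sub>F m in sequentially. norm (rho ^ m * (spline 0 u ((S j ^^ m) (p l)) - u (p j))\<^sup>2) \<le> theta ^ m * d\<^sup>2"
      using rho_pos by (intro always_eventually) (auto simp: abs_mult)
    have "(\<lambda>m. theta ^ m * d\<^sup>2) \<longlonglongrightarrow> 0 * d\<^sup>2"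
      using theta by (intro tendsto_mult tendsto_const LIMSEQ_power_zero) auto
    then show "(\<lambda>m. theta ^ m * d\<^sup>2) \<longlonglongrightarrow> 0" by simp
  qed
next
  case (Suc k)
  have "rho ^ Suc m * (spline (Suc k) u ((S j ^^ Suc m) (p l)) - u (p j))\<^sup>2 =
     rho * (rho ^ m * (spline k (\<lambda>x. u (S j x)) ((S j ^^ m) (p l)) - u (S j (p j)))\<^sup>2)" for m
    using spline_S[OF Suc.prems(2) S_pow_V[OF Suc.prems(2) p_in_V[OF Suc.prems(1)]], of k u m] by (simp del: spline.simps)
  then have "(\<lambda>m. rho ^ Suc m * (spline (Suc k) u ((S j ^^ Suc m) (p l)) - u (p j))\<^sup>2) \<longlonglongrightarrow> rho * 0"
    using tendsto_mult[OF tendsto_const Suc.IH[OF Suc.prems, of "\<lambda>x. u (S j x)"], of rho] by presburger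
  then have "(\<lambda>m. rho ^ Suc m * (spline (Suc k) u ((S j ^^ Suc m) (p l)) - u (p j))\<^sup>2) \<longlonglongrightarrow> 0" by simp
  then show ?case by (rule LIMSEQ_imp_Suc)
qed

text \<open>The first-level junctions are corners of the pieces, where \<open>spline_corner\<close>
  applies. The cross pairs there vanish in the limit; those inside harmonic pieces are collected in
  \<open>kappa\<close>.\<close>

lemma crossE_spline: "(\<lambda>m. crossE m (spline (Suc k) u)) \<longlonglongrightarrow> 0"
proof (rule Lim_null_comparison)
  let ?f = "\<lambda>m i j l. 2 * rho * (rho ^ m * (spline k (\<lambda>x. u (S i x)) ((S j ^^ m) (p l)) - u (S i (p j)))\<^sup>2) +
     2 * rho * (rho ^ m * (spline k (\<lambda>x. u (S j x)) ((S i ^^ m) (p l)) - u (S j (p i)))\<^sup>2)"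
  have "crossE m (spline (Suc k) u) \<le> (\<Sum>(i, j, l)\<in>triples. ?f m i j l)" if "m \<noteq> 0" for m
  proof -
    have "(\<Sum>(i, j, l)\<in>triples. rho ^ Suc m * (spline (Suc k) u (S i ((S j ^^ m) (p l))) - spline (Suc k) u (S j ((S i ^^ m) (p l))))\<^sup>2)
       \<le> (\<Sum>(i, j, l)\<in>triples. ?f m i j l)"
    proof (intro sum_mono, clarify)
      fix i j l assume "(i, j, l) \<in> triples"
      then have ijl: "i \<in> I" "j \<in> I" "l \<in> I" by (auto simp: triples_def)
      have e: "spline (Suc k) u (S i ((S j ^^ m) (p l))) = spline k (\<lambda>x. u (S i x)) ((S j ^^ m) (p l))"
        "spline (Suc k) u (S j ((S i ^^ m) (p l))) = spline k (\<lambda>x. u (S j x)) ((S i ^^ m) (p l))"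
        using ijl by (simp_all add: spline_S S_pow_V p_in_V del: spline.simps)
      have "rho ^ Suc m * (spline (Suc k) u (S i ((S j ^^ m) (p l))) - spline (Suc k) u (S j ((S i ^^ m) (p l))))\<^sup>2 \<le>
         rho ^ Suc m * (2 * (spline (Suc k) u (S i ((S j ^^ m) (p l))) - u (S i (p j)))\<^sup>2 + 2 * (spline (Suc k) u (S j ((S i ^^ m) (p l))) - u (S i (p j)))\<^sup>2)"
        using rho_pos by (intro mult_left_mono sq_diff_le) auto
      also have "\<dots> = ?f m i j l" unfolding e S_comm[of j i] by (simp add: algebra_simps)
      finally show "rho ^ Suc m * (spline (Suc k) u (S i ((S j ^^ m) (p l))) - spline (Suc k) u (S j ((S i ^^ m) (p l))))\<^sup>2 \<le> ?f m i j l" .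
    qed
    then show ?thesis using that by (simp add: crossE_def sum_distrib_left case_prod_unfold del: spline.simps)
  qed
  then show "\<forall>\<^sub>F m in sequentially. norm (crossE m (spline (Suc k) u)) \<le> (\<Sum>(i, j, l)\<in>triples. ?f m i j l)"
    by (intro eventually_sequentiallyI[of 1]) (simp add: crossE_nonneg del: spline.simps)
  have "(\<lambda>m. \<Sum>(i, j, l)\<in>triples. ?f m i j l) \<longlonglongrightarrow> (\<Sum>(i, j, l)\<in>triples. 2 * rho * 0 + 2 * rho * 0)"
    unfolding case_prod_unfold
    by (intro tendsto_intros spline_corner) (auto simp: triples_def)
  then show "(\<lambda>m. \<Sum>(i, j, l)\<in>triples. ?f m i j l) \<longlonglongrightarrow> 0" by (simp add: case_prod_unfold)
qed

lemma WN_spline: "(\<lambda>m. WN m (spline k u) (spline k u)) \<longlonglongrightarrow> kappa * EN k u u"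
proof (induction k arbitrary: u)
  case 0
  show ?case using kappa(2)[of "\<lambda>i. u (p i)"] by (simp add: EN_0_e0 del: EN.simps)
next
  case (Suc k)
  have "WN (Suc m) (spline (Suc k) u) (spline (Suc k) u) =
      rho * (\<Sum>i\<in>I. WN m (spline k (\<lambda>x. u (S i x))) (spline k (\<lambda>x. u (S i x)))) + crossE m (spline (Suc k) u)" for m
    unfolding WN_Suc
    by (intro arg_cong2[where f = "(+)"] arg_cong[where f = "(*) rho"] sum.cong refl WN_cong) (auto simp: spline_S simp del: spline.simps)
  moreover have "(\<lambda>m. rho * (\<Sum>i\<in>I. WN m (spline k (\<lambda>x. u (S i x))) (spline k (\<lambda>x. u (S i x)))) + crossE m (spline (Suc k) u))
     \<longlonglongrightarrow> rho * (\<Sum>i\<in>I. kappa * EN k (\<lambda>x. u (S i x)) (\<lambda>x. u (S i x))) + 0"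
    by (intro tendsto_intros Suc.IH crossE_spline)
  ultimately have "(\<lambda>m. WN (Suc m) (spline (Suc k) u) (spline (Suc k) u)) \<longlonglongrightarrow>
     rho * (\<Sum>i\<in>I. kappa * EN k (\<lambda>x. u (S i x)) (\<lambda>x. u (S i x))) + 0" by presburger
  then have "(\<lambda>m. WN m (spline (Suc k) u) (spline (Suc k) u)) \<longlonglongrightarrow>
     rho * (\<Sum>i\<in>I. kappa * EN k (\<lambda>x. u (S i x)) (\<lambda>x. u (S i x))) + 0" by (rule LIMSEQ_imp_Suc)
  then show ?case by (simp add: sum_distrib_left mult_ac del: spline.simps)
qed

text \<open>\<open>WN m\<close> is a squared Euclidean norm of the edge differences.\<close>

lemma sqrt_WN_triangle:
  "\<bar>sqrt (WN m u u) - sqrt (WN m v v)\<bar> \<le> sqrt (WN m (\<lambda>x. 1 * u x + (-1) * v x) (\<lambda>x. 1 * u x + (-1) * v x))"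
proof -
  have e: "sqrt (WN m w w) = sqrt (rho ^ m) * L2_set (\<lambda>(x, y). w x - w y) (edges m)" for w
    by (simp add: WN_def L2_set_def real_sqrt_mult case_prod_unfold power2_eq_square)
  have tri: "sqrt (WN m (\<lambda>x. a x + b x) (\<lambda>x. a x + b x)) \<le> sqrt (WN m a a) + sqrt (WN m b b)" for a b
  proof -
    have "L2_set (\<lambda>(x, y). (a x + b x) - (a y + b y)) (edges m) = L2_set (\<lambda>e. (\<lambda>(x, y). a x - a y) e + (\<lambda>(x, y). b x - b y) e) (edges m)"
      by (intro L2_set_cong refl) auto
    also have "\<dots> \<le> L2_set (\<lambda>(x, y). a x - a y) (edges m) + L2_set (\<lambda>(x, y). b x - b y) (edges m)"
      by (rule L2_set_triangle_ineq)
    finally show ?thesis unfolding e distrib_left[symmetric] using rho_pos by (intro mult_left_mono) auto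
  qed
  let ?d = "\<lambda>x. 1 * u x + (-1) * v x"
  have "WN m (\<lambda>x. v x - u x) (\<lambda>x. v x - u x) = WN m ?d ?d"
    unfolding WN_def by (intro arg_cong[where f = "(*) (rho ^ m)"] sum.cong refl) (auto simp: algebra_simps)
  then show ?thesis using tri[of v ?d] tri[of u "\<lambda>x. v x - u x"] by simp
qed

text \<open>By \<open>WN_le\<close> and Pythagoras, replacing \<open>u\<close> by
  \<open>spline k u\<close> changes \<open>sqrt (WN m u u)\<close> by at most
  \<open>sqrt (5 * (e - EN k u u))\<close> for all \<open>m \<ge> k\<close>. This uniformity in
  \<open>m\<close> allows \<open>k\<close> to be fixed first.\<close>

lemma WN_tendsto:
  assumes "\<And>m. EN m u u \<le> B"
  shows "(\<lambda>m. WN m u u) \<longlonglongrightarrow> kappa * lim (\<lambda>m. EN m u u)" "(\<lambda>m. EN m u u) \<longlonglongrightarrow> lim (\<lambda>m. EN m u u)"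
proof -
  have inc: "incseq (\<lambda>m. EN m u u)" using EN_mono by (auto simp: incseq_def)
  obtain L where "(\<lambda>m. EN m u u) \<longlonglongrightarrow> L" using incseq_convergent[OF inc, of B] assms by blast
  then have "convergent (\<lambda>m. EN m u u)" by (rule convergentI)
  then show E: "(\<lambda>m. EN m u u) \<longlonglongrightarrow> lim (\<lambda>m. EN m u u)" by (simp add: convergent_LIMSEQ_iff)
  define e where "e = lim (\<lambda>m. EN m u u)"
  have E: "(\<lambda>m. EN m u u) \<longlonglongrightarrow> e" using E by (simp add: e_def)
  have le: "EN m u u \<le> e" for m by (rule incseq_le[OF inc E])
  have "(\<lambda>m. sqrt (WN m u u)) \<longlonglongrightarrow> sqrt (kappa * e)"
  proof (rule LIMSEQ_I)
    fix r :: real assume r: "0 < r"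
    have "(\<lambda>k. sqrt (5 * (e - EN k u u))) \<longlonglongrightarrow> sqrt (5 * (e - e))" by (intro tendsto_intros E)
    then have "(\<lambda>k. sqrt (5 * (e - EN k u u))) \<longlonglongrightarrow> 0" by simp
    then have ev1: "\<forall>\<^sub>F k in sequentially. sqrt (5 * (e - EN k u u)) < r / 3" by (rule order_tendstoD) (use r in simp)
    have "(\<lambda>k. sqrt (kappa * EN k u u)) \<longlonglongrightarrow> sqrt (kappa * e)" by (intro tendsto_intros E)
    then have ev2: "\<forall>\<^sub>F k in sequentially. dist (sqrt (kappa * EN k u u)) (sqrt (kappa * e)) < r / 3"
      using tendstoD r by (metis divide_pos_pos zero_less_numeral)
    obtain k where k: "sqrt (5 * (e - EN k u u)) < r / 3" "dist (sqrt (kappa * EN k u u)) (sqrt (kappa * e)) < r / 3"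
      using eventually_happens'[OF _ eventually_conj[OF ev1 ev2]] by auto
    have "(\<lambda>m. sqrt (WN m (spline k u) (spline k u))) \<longlonglongrightarrow> sqrt (kappa * EN k u u)" by (intro tendsto_intros WN_spline)
    then have "\<forall>\<^sub>F m in sequentially. dist (sqrt (WN m (spline k u) (spline k u))) (sqrt (kappa * EN k u u)) < r / 3"
      using tendstoD r by (metis divide_pos_pos zero_less_numeral)
    then obtain m0 where m0: "\<And>m. m \<ge> m0 \<Longrightarrow> dist (sqrt (WN m (spline k u) (spline k u))) (sqrt (kappa * EN k u u)) < r / 3"
      by (auto simp: eventually_sequentially)
    have "norm (sqrt (WN m u u) - sqrt (kappa * e)) < r" if m: "m \<ge> max m0 k" for m
    proof -
      let ?d = "\<lambda>x. 1 * u x + (-1) * spline k u x"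
      have "WN m ?d ?d \<le> 5 * EN m ?d ?d" by (rule WN_le)
      also have "EN m ?d ?d = EN m u u - EN k u u" using EN_diff_spline[of k "m - k" u] m by simp
      also have "\<dots> \<le> e - EN k u u" using le[of m] by simp
      finally have "sqrt (WN m ?d ?d) \<le> sqrt (5 * (e - EN k u u))" by simp
      then have "\<bar>sqrt (WN m u u) - sqrt (WN m (spline k u) (spline k u))\<bar> < r / 3"
        using sqrt_WN_triangle[of m u "spline k u"] k(1) by linarith
      moreover have "dist (sqrt (WN m (spline k u) (spline k u))) (sqrt (kappa * EN k u u)) < r / 3" using m0 m by simp
      ultimately show ?thesis using k(2) unfolding dist_real_def real_norm_def by linarith
    qed
    then show "\<exists>no. \<forall>n\<ge>no. norm (sqrt (WN n u u) - sqrt (kappa * e)) < r" by blast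
  qed
  then have "(\<lambda>m. (sqrt (WN m u u))\<^sup>2) \<longlonglongrightarrow> (sqrt (kappa * e))\<^sup>2" by (rule tendsto_power)
  moreover have "0 \<le> e" using le[of 0] EN_nonneg[of 0 u] by linarith
  then have "(sqrt (kappa * e))\<^sup>2 = kappa * e" using kappa(1) by simp
  moreover have "(sqrt (WN m u u))\<^sup>2 = WN m u u" for m using WN_nonneg by simp
  ultimately show "(\<lambda>m. WN m u u) \<longlonglongrightarrow> kappa * lim (\<lambda>m. EN m u u)"
    by (simp only: e_def)
qed

section \<open>Identification of the energy, the inner product and the space\<close>

definition EE :: "('a \<Rightarrow> real) \<Rightarrow> ('a \<Rightarrow> real) \<Rightarrow> real" where "EE u v = lim (\<lambda>m. EN m u v)"

definition EB :: "('a \<Rightarrow> real) \<Rightarrow> bool" where "EB u \<longleftrightarrow> (\<exists>B. \<forall>m. EN m u u \<le> B)"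

lemma energy_finite: assumes "EB u" shows "gasket_energy N p u = ennreal (kappa * EE u u)"
proof -
  obtain B where "\<And>m. EN m u u \<le> B" using assms by (auto simp: EB_def)
  from WN_tendsto(1)[OF this] have "(\<lambda>m. ennreal (WN m u u)) \<longlonglongrightarrow> ennreal (kappa * EE u u)"
    unfolding EE_def by (rule tendsto_ennrealI)
  then show ?thesis unfolding gasket_energy_def level_WN by (rule limI)
qed

text \<open>\<open>lim\<close> says nothing about a sequence without limit, so divergence to
  infinity has to be established. It follows from \<open>EN_le_WN\<close> and monotonicity of
  \<open>EN\<close>.\<close>

lemma energy_infinite: assumes "\<not> EB u" shows "gasket_energy N p u = \<infinity>"
proof -
  have "filterlim (\<lambda>m. WN m u u) at_top sequentially"
    unfolding filterlim_at_top
  proof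
    fix B
    obtain m where "B < EN m u u" using assms by (force simp: EB_def not_le)
    then have "B \<le> WN n u u" if "m \<le> n" for n using EN_mono[OF that, of u] EN_le_WN[of n u] by linarith
    then show "\<forall>\<^sub>F n in sequentially. B \<le> WN n u u" by (auto simp: eventually_sequentially)
  qed
  then have "(\<lambda>m. ennreal (WN m u u)) \<longlonglongrightarrow> \<infinity>"
    unfolding infinity_ennreal_def by (rule ennreal_tendsto_top_eq_at_top[THEN iffD2])
  then show ?thesis unfolding gasket_energy_def level_WN by (rule limI)
qed

lemma H01_iff: "u \<in> gasket_H01 N p \<longleftrightarrow> continuous_on V u \<and> (\<forall>i\<in>I. u (p i) = 0) \<and> EB u"
  using energy_finite[of u] energy_infinite[of u]
  by (cases "EB u") (auto simp: gasket_H01_def gasket_C0_def)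

lemma EB_lin: assumes "EB u" "EB v" shows "EB (\<lambda>x. a * u x + b * v x)"
proof -
  obtain B B' where B: "\<And>m. EN m u u \<le> B" "\<And>m. EN m v v \<le> B'" using assms by (auto simp: EB_def)
  have "EN m (\<lambda>x. a * u x + b * v x) (\<lambda>x. a * u x + b * v x) \<le> 2 * a\<^sup>2 * B + 2 * b\<^sup>2 * B'" for m
    by (rule order_trans[OF EN_add_le]) (intro add_mono mult_left_mono B, auto)
  then show ?thesis by (auto simp: EB_def)
qed

lemma EN_tendsto: assumes "EB u" "EB v" shows "(\<lambda>m. EN m u v) \<longlonglongrightarrow> EE u v"
proof -
  have pol: "EN m u v = (EN m (\<lambda>x. 1 * u x + 1 * v x) (\<lambda>x. 1 * u x + 1 * v x) - EN m (\<lambda>x. 1 * u x + (-1) * v x) (\<lambda>x. 1 * u x + (-1) * v x)) / 4" for m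
    unfolding EN_lin EN_lin_right by (simp add: EN_sym[of m v u])
  have L: "(\<lambda>m. EN m w w) \<longlonglongrightarrow> EE w w" if "EB w" for w
    using that WN_tendsto(2)[of w] by (auto simp: EB_def EE_def)
  have sd: "EB (\<lambda>x. 1 * u x + 1 * v x)" "EB (\<lambda>x. 1 * u x + (-1) * v x)" by (intro EB_lin assms)+
  have "convergent (\<lambda>m. EN m u v)" unfolding pol
    by (rule convergentI, rule tendsto_divide[OF tendsto_diff[OF L[OF sd(1)] L[OF sd(2)]] tendsto_const]) simp
  then show ?thesis by (simp add: EE_def convergent_LIMSEQ_iff)
qed

lemma WN_lin: "WN m (\<lambda>x. a * u x + b * v x) w = a * WN m u w + b * WN m v w"
proof -
  have "(\<Sum>(x, y)\<in>edges m. (a * u x + b * v x - (a * u y + b * v y)) * (w x - w y)) =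
    a * (\<Sum>(x, y)\<in>edges m. (u x - u y) * (w x - w y)) + b * (\<Sum>(x, y)\<in>edges m. (v x - v y) * (w x - w y))"
    unfolding sum_distrib_left sum.distrib[symmetric] by (intro sum.cong refl) (auto simp: algebra_simps)
  then show ?thesis unfolding WN_def by (simp add: algebra_simps)
qed

lemma WN_sym: "WN m u v = WN m v u"
  by (simp add: WN_def mult.commute)

text \<open>Polarisation reduces the mixed sums to squares and shows that the \<open>lim\<close> in
  \<open>gasket_inner\<close> exists.\<close>

lemma inner_EE: assumes "EB u" "EB v" shows "gasket_inner N p u v = kappa * EE u v"
proof -
  have pol: "F u v = (F (\<lambda>x. 1 * u x + 1 * v x) (\<lambda>x. 1 * u x + 1 * v x) - F (\<lambda>x. 1 * u x + (-1) * v x) (\<lambda>x. 1 * u x + (-1) * v x)) / 4"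
    if "\<And>u v w a b. F (\<lambda>x. a * u x + b * v x) w = a * F u w + b * F v w" "\<And>u v. F u v = F v u"
    for F :: "('a \<Rightarrow> real) \<Rightarrow> ('a \<Rightarrow> real) \<Rightarrow> real"
  proof -
    have r: "F w (\<lambda>x. a * u x + b * v x) = a * F w u + b * F w v" for u v w a b
      using that by metis
    show ?thesis unfolding that(1) r by (simp add: that(2)[of v u])
  qed
  have W: "(\<lambda>m. WN m w w) \<longlonglongrightarrow> kappa * EE w w" if "EB w" for w
    using that WN_tendsto(1)[of w] unfolding EE_def by (auto simp: EB_def)
  have E: "(\<lambda>m. EN m w w) \<longlonglongrightarrow> EE w w" if "EB w" for w by (rule EN_tendsto[OF that that])
  let ?s = "\<lambda>x. 1 * u x + 1 * v x" and ?d = "\<lambda>x. 1 * u x + (-1) * v x"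
  have sd: "EB ?s" "EB ?d" by (intro EB_lin assms)+
  have WNpol: "WN m u v = (WN m ?s ?s - WN m ?d ?d) / 4" for m by (rule pol[OF WN_lin WN_sym])
  have ENpol: "EN m u v = (EN m ?s ?s - EN m ?d ?d) / 4" for m by (rule pol[OF EN_lin EN_sym])
  have 1: "(\<lambda>m. WN m u v) \<longlonglongrightarrow> (kappa * EE ?s ?s - kappa * EE ?d ?d) / 4"
    unfolding WNpol by (intro tendsto_intros W sd) simp
  have "(\<lambda>m. EN m u v) \<longlonglongrightarrow> (EE ?s ?s - EE ?d ?d) / 4"
    unfolding ENpol by (intro tendsto_intros E sd) simp
  then have eq: "EE u v = (EE ?s ?s - EE ?d ?d) / 4" using EN_tendsto[OF assms] LIMSEQ_unique by blast
  show ?thesis unfolding inner_WN limI[OF 1] eq by (simp only: right_diff_distrib times_divide_eq_right)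
qed

end

lemma finite_common_radius:
  assumes "finite F" "\<And>z. z \<in> F \<Longrightarrow> \<exists>d>0. Q z (d::real)" "\<And>z d e. Q z d \<Longrightarrow> e \<le> d \<Longrightarrow> Q z e"
  shows "\<exists>d>0. \<forall>z\<in>F. Q z d"
  using assms(1,2)
proof (induction F rule: finite_induct)
  case empty
  then show ?case using zero_less_one by blast
next
  case (insert z F)
  then obtain d d' where "d > 0" "\<And>y. y \<in> F \<Longrightarrow> Q y d" "d' > 0" "Q z d'" by (metis insertI1 insertI2)
  then show ?case using assms(3)
    by (intro exI[of _ "min d d'"]) (auto intro: assms(3)[OF _ min.cobounded1] assms(3)[OF _ min.cobounded2])
qed

context simplex_gasket
begin

subsection \<open>Cells\<close>

primrec Sw :: "nat list \<Rightarrow> 'a \<Rightarrow> 'a" where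
  "Sw [] x = x"
| "Sw (i # w) x = S i (Sw w x)"

definition words :: "nat \<Rightarrow> nat list set" where "words n = {w. set w \<subseteq> I \<and> length w = n}"

lemma finite_words: "finite (words n)"
  unfolding words_def by (rule finite_lists_length_eq) simp

lemma card_words: "card (words n) = N ^ n"
  unfolding words_def using card_lists_length_eq[of I n] by simp

lemma dist_Sw: "dist (Sw w x) (Sw w y) = (1/2) ^ length w * dist x y"
  by (induction w) (auto simp: dist_S)

lemma Sw_in_V: "set w \<subseteq> I \<Longrightarrow> x \<in> V \<Longrightarrow> Sw w x \<in> V"
  by (induction w) (auto simp: S_in_V)

lemma cont_Sw: "continuous_on B (Sw w)"
proof (induction w)
  case (Cons i w)
  then show ?case using continuous_on_compose2[OF cont_S[of UNIV i] Cons] by simp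
qed simp

lemma compact_cell: "compact (Sw w ` V)"
  by (intro compact_continuous_image cont_Sw gasket_props)

lemma V_words: "x \<in> V \<Longrightarrow> \<exists>w\<in>words n. x \<in> Sw w ` V"
proof (induction n arbitrary: x)
  case (Suc n)
  obtain i y where y: "i \<in> I" "y \<in> V" "x = S i y" using V_cases[OF Suc.prems] .
  obtain w z where "w \<in> words n" "z \<in> V" "y = Sw w z" using Suc.IH[OF y(2)] by blast
  then show ?case using y by (intro bexI[of _ "i # w"]) (auto simp: words_def)
qed (auto simp: words_def)

subsection \<open>Oscillation and compactness\<close>

lemma EN_cell:
  assumes "\<And>m. EN m u u \<le> B" "i \<in> I"
  shows "EN m (\<lambda>x. u (S i x)) (\<lambda>x. u (S i x)) \<le> B / rho"
proof -
  have "rho * EN m (\<lambda>x. u (S i x)) (\<lambda>x. u (S i x)) \<le> rho * (\<Sum>j\<in>I. EN m (\<lambda>x. u (S j x)) (\<lambda>x. u (S j x)))"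
    using rho_pos assms(2) by (intro mult_left_mono member_le_sum) (auto simp: EN_nonneg)
  also have "\<dots> \<le> B" using assms(1)[of "Suc m"] by simp
  finally show ?thesis using rho_pos by (simp add: field_simps)
qed

lemma EN_Sw:
  "(\<And>m. EN m u u \<le> B) \<Longrightarrow> set w \<subseteq> I \<Longrightarrow> EN m (\<lambda>x. u (Sw w x)) (\<lambda>x. u (Sw w x)) \<le> B / rho ^ length w"
proof (induction w arbitrary: u B m)
  case (Cons i w)
  have "EN m (\<lambda>x. (\<lambda>x. u (S i x)) (Sw w x)) (\<lambda>x. (\<lambda>x. u (S i x)) (Sw w x)) \<le> (B / rho) / rho ^ length w"
    by (rule Cons.IH[of "\<lambda>x. u (S i x)"]) (use EN_cell Cons.prems in auto)
  then show ?case by simp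
qed simp

text \<open>The geometric series of \<open>1 / sqrt rho\<close>; it becomes the constant
  \<open>C\<close> of the energy space.\<close>

definition Kosc :: real where "Kosc = 1 / (1 - 1 / sqrt rho)"

lemma edge_osc: assumes "i \<in> I" "j \<in> I" "EN 0 u u \<le> B" shows "\<bar>u (p i) - u (p j)\<bar> \<le> sqrt B"
proof -
  have "(u (p i) - u (p j)) * (u (p i) - u (p j)) \<le> (\<Sum>j\<in>I. (u (p i) - u (p j)) * (u (p i) - u (p j)))"
    using assms by (intro member_le_sum) auto
  also have "\<dots> \<le> EN 0 u u" unfolding EN.simps
    by (rule member_le_sum[of i I "\<lambda>i. \<Sum>j\<in>I. (u (p i) - u (p j)) * (u (p i) - u (p j))"]) (use assms in \<open>auto intro: sum_nonneg\<close>)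
  finally have "(u (p i) - u (p j))\<^sup>2 \<le> B" using assms(3) by (simp add: power2_eq_square)
  then show ?thesis by (metis real_sqrt_abs real_sqrt_le_mono)
qed

text \<open>A chain of cells leads down to \<open>x\<close>: each level divides the energy bound by
  \<open>rho\<close>, hence the bound for corner differences by \<open>sqrt rho\<close>.\<close>

lemma vert_osc:
  "(\<And>m. EN m u u \<le> B) \<Longrightarrow> x \<in> vert k \<Longrightarrow> j \<in> I \<Longrightarrow> \<bar>u x - u (p j)\<bar> \<le> (\<Sum>l\<le>k. (1 / sqrt rho) ^ l) * sqrt B"
proof (induction k arbitrary: u x B j)
  case 0
  then obtain i where i: "i \<in> I" "x = p i" by auto
  show ?case using edge_osc[OF i(1) 0(3) 0(1)] by (simp add: i)
next
  case (Suc k)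
  then obtain i y where y: "i \<in> I" "y \<in> vert k" "x = S i y" by auto
  have "\<bar>u (S i y) - u (S i (p i))\<bar> \<le> (\<Sum>l\<le>k. (1 / sqrt rho) ^ l) * sqrt (B / rho)"
    using Suc.IH[of "\<lambda>x. u (S i x)" "B / rho" y i] EN_cell[OF Suc.prems(1) y(1)] y by simp
  moreover have "\<bar>u (p i) - u (p j)\<bar> \<le> sqrt B" using edge_osc y(1) Suc.prems by blast
  moreover have "(\<Sum>l\<le>k. (1 / sqrt rho) ^ l) * sqrt (B / rho) + sqrt B = (\<Sum>l\<le>Suc k. (1 / sqrt rho) ^ l) * sqrt B"
    unfolding sum.atMost_Suc_shift by (simp add: real_sqrt_divide sum_distrib_left sum_distrib_right sum_divide_distrib distrib_right)
  ultimately show ?case by (simp add: y)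
qed

lemma Kosc: "0 < 1 / sqrt rho" "1 / sqrt rho < 1" "0 < Kosc" "(\<Sum>l\<le>k. (1 / sqrt rho) ^ l) \<le> Kosc"
proof -
  show 1: "0 < 1 / sqrt rho" "1 / sqrt rho < 1" using rho_gt1 by auto
  then show "0 < Kosc" by (simp add: Kosc_def)
  have "(\<Sum>l\<le>k. (1 / sqrt rho) ^ l) \<le> suminf (\<lambda>l. (1 / sqrt rho) ^ l)"
    by (rule sum_le_suminf) (use 1 in \<open>auto intro: summable_geometric\<close>)
  also have "\<dots> = Kosc" unfolding Kosc_def by (rule suminf_geometric) (use 1 in auto)
  finally show "(\<Sum>l\<le>k. (1 / sqrt rho) ^ l) \<le> Kosc" .
qed

lemma closure_vert: "closure (\<Union>m. vert m) = V"
proof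
  show "closure (\<Union>m. vert m) \<subseteq> V" by (rule closure_minimal[OF _ closed_V]) (use vert_in_V in blast)
qed (rule V_closure_vert)

lemma V_osc:
  assumes u: "continuous_on V u" "\<And>m. EN m u u \<le> B" and x: "x \<in> V" "j \<in> I"
  shows "\<bar>u x - u (p j)\<bar> \<le> Kosc * sqrt B"
proof -
  have B: "0 \<le> B" using u(2)[of 0] EN_nonneg[of 0 u] by linarith
  have "norm (u x - u (p j)) \<le> Kosc * sqrt B"
  proof (rule continuous_on_closure_norm_le[where f = "\<lambda>x. u x - u (p j)" and s = "\<Union>m. vert m"])
    show "continuous_on (closure (\<Union>m. vert m)) (\<lambda>x. u x - u (p j))"
      unfolding closure_vert by (intro continuous_intros u)
    show "\<forall>y\<in>\<Union>m. vert m. norm (u y - u (p j)) \<le> Kosc * sqrt B"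
    proof
      fix y assume "y \<in> (\<Union>m. vert m)"
      then obtain k where "y \<in> vert k" by blast
      from vert_osc[OF u(2) this x(2)] show "norm (u y - u (p j)) \<le> Kosc * sqrt B"
        using mult_right_mono[OF Kosc(4)[of k], of "sqrt B"] B by simp
    qed
    show "x \<in> closure (\<Union>m. vert m)" using x closure_vert by simp
  qed
  then show ?thesis by simp
qed

lemma cell_osc:
  assumes u: "continuous_on V u" "\<And>m. EN m u u \<le> B" and w: "w \<in> words n" and xy: "x \<in> Sw w ` V" "y \<in> Sw w ` V"
  shows "\<bar>u x - u y\<bar> \<le> 2 * (Kosc * sqrt (B / rho ^ n))"
proof -
  obtain a b where ab: "a \<in> V" "b \<in> V" "x = Sw w a" "y = Sw w b" using xy by blast
  have sw: "set w \<subseteq> I" "length w = n" using w by (auto simp: words_def)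
  have c: "continuous_on V (\<lambda>x. u (Sw w x))"
    by (rule continuous_on_compose2[OF u(1) cont_Sw]) (use Sw_in_V sw in auto)
  have e: "EN m (\<lambda>x. u (Sw w x)) (\<lambda>x. u (Sw w x)) \<le> B / rho ^ n" for m
    using EN_Sw[OF u(2) sw(1)] sw(2) by blast
  show ?thesis
    using V_osc[OF c e ab(1) one_in_I] V_osc[OF c e ab(2) one_in_I] by (simp add: ab)
qed

text \<open>Disjoint compact cells have positive distance, and there are finitely many pairs. Cells
  containing points closer than \<open>d\<close> therefore meet, and oscillations can be compared
  through a common point.\<close>

lemma cells_separated: "\<exists>d>0. \<forall>z\<in>words n \<times> words n. \<forall>x\<in>Sw (fst z) ` V. \<forall>y\<in>Sw (snd z) ` V.
   dist x y < d \<longrightarrow> Sw (fst z) ` V \<inter> Sw (snd z) ` V \<noteq> {}"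
proof (rule finite_common_radius)
  show "finite (words n \<times> words n)" using finite_words by simp
  fix z
  show "\<exists>d>0. \<forall>x\<in>Sw (fst z) ` V. \<forall>y\<in>Sw (snd z) ` V. dist x y < d \<longrightarrow> Sw (fst z) ` V \<inter> Sw (snd z) ` V \<noteq> {}"
  proof (cases "Sw (fst z) ` V \<inter> Sw (snd z) ` V = {}")
    case True
    from separate_compact_closed[OF compact_cell compact_imp_closed[OF compact_cell] True]
    show ?thesis by (meson not_le)
  next
    case False
    then show ?thesis using zero_less_one by blast
  qed
next
  fix z and d e :: real
  assume "\<forall>x\<in>Sw (fst z) ` V. \<forall>y\<in>Sw (snd z) ` V. dist x y < d \<longrightarrow> Sw (fst z) ` V \<inter> Sw (snd z) ` V \<noteq> {}" "e \<le> d"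
  then show "\<forall>x\<in>Sw (fst z) ` V. \<forall>y\<in>Sw (snd z) ` V. dist x y < e \<longrightarrow> Sw (fst z) ` V \<inter> Sw (snd z) ` V \<noteq> {}"
    by (meson order_less_le_trans)
qed

lemma equicont:
  assumes "0 < e" "0 \<le> B"
  shows "\<exists>d>0. \<forall>u. continuous_on V u \<longrightarrow> (\<forall>m. EN m u u \<le> B) \<longrightarrow> (\<forall>x\<in>V. \<forall>y\<in>V. dist x y < d \<longrightarrow> \<bar>u x - u y\<bar> < e)"
proof -
  \<comment> \<open>Factor 4: two cells, each of oscillation at most
    \<open>2 * (Kosc * sqrt (B / rho ^ n))\<close>.\<close>
  have "(\<lambda>n. 4 * (Kosc * sqrt (B * (1 / rho) ^ n))) \<longlonglongrightarrow> 4 * (Kosc * sqrt (B * 0))"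
    using rho_gt1 by (intro tendsto_intros LIMSEQ_power_zero) auto
  then have "(\<lambda>n. 4 * (Kosc * sqrt (B * (1 / rho) ^ n))) \<longlonglongrightarrow> 0" by simp
  then have "\<forall>\<^sub>F n in sequentially. 4 * (Kosc * sqrt (B * (1 / rho) ^ n)) < e" by (rule order_tendstoD) (rule assms)
  then obtain n where "4 * (Kosc * sqrt (B * (1 / rho) ^ n)) < e" by (auto simp: eventually_sequentially)
  then have n: "4 * (Kosc * sqrt (B / rho ^ n)) < e" by (simp add: power_one_over)
  from cells_separated[of n] obtain d where d0: "d > 0" and d: "\<forall>z\<in>words n \<times> words n. \<forall>x\<in>Sw (fst z) ` V.
     \<forall>y\<in>Sw (snd z) ` V. dist x y < d \<longrightarrow> Sw (fst z) ` V \<inter> Sw (snd z) ` V \<noteq> {}" by (elim exE conjE)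
  have "\<bar>u x - u y\<bar> < e" if u: "continuous_on V u" "\<And>m. EN m u u \<le> B" and xy: "x \<in> V" "y \<in> V" "dist x y < d" for u x y
  proof -
    obtain w w' where w: "w \<in> words n" "x \<in> Sw w ` V" "w' \<in> words n" "y \<in> Sw w' ` V"
      using V_words[OF xy(1)] V_words[OF xy(2)] by blast
    then obtain z where "z \<in> Sw w ` V" "z \<in> Sw w' ` V" using d[rule_format, of "(w, w')" x y] w xy(3) by auto
    then have "\<bar>u x - u z\<bar> \<le> 2 * (Kosc * sqrt (B / rho ^ n))" "\<bar>u z - u y\<bar> \<le> 2 * (Kosc * sqrt (B / rho ^ n))"
      using cell_osc[OF u w(1,2)] cell_osc[OF u w(3) _ w(4)] by blast+
    then show ?thesis using n by linarith
  qed
  then show ?thesis using d0 by blast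
qed

lemma EN_limit: "(\<And>x. x \<in> V \<Longrightarrow> (\<lambda>n. f n x) \<longlonglongrightarrow> g x) \<Longrightarrow> (\<lambda>n. EN m (f n) (f n)) \<longlonglongrightarrow> EN m g g"
proof (induction m arbitrary: f g)
  case 0
  then show ?case unfolding EN.simps by (intro tendsto_intros) (auto simp: p_in_V)
next
  case (Suc m)
  show ?case unfolding EN.simps
    by (intro tendsto_intros Suc.IH[of "\<lambda>n x. f n (S i x)" "\<lambda>x. g (S i x)" for i] Suc.prems) (simp add: S_in_V)
qed

lemma EN_le_EE: assumes "EB u" shows "EN m u u \<le> EE u u"
  by (rule incseq_le[OF _ EN_tendsto[OF assms assms]]) (auto simp: incseq_def EN_mono)

lemma EE_le: assumes "EB u" "\<And>m. EN m u u \<le> B" shows "EE u u \<le> B"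
  using LIMSEQ_le_const2[OF EN_tendsto[OF assms(1) assms(1)]] assms(2) by blast

lemma EE_lin: assumes "EB u" "EB v" "EB w" shows "EE (\<lambda>x. a * u x + b * v x) w = a * EE u w + b * EE v w"
proof -
  have "(\<lambda>m. EN m (\<lambda>x. a * u x + b * v x) w) \<longlonglongrightarrow> a * EE u w + b * EE v w"
    unfolding EN_lin by (intro tendsto_intros EN_tendsto assms)
  then show ?thesis unfolding EE_def by (rule limI)
qed

lemma EE_sym: "EE u v = EE v u"
  unfolding EE_def by (simp add: EN_sym)

lemma EE_nonneg: "EB u \<Longrightarrow> 0 \<le> EE u u"
  using EN_le_EE[of u 0] EN_nonneg[of 0 u] by linarith

abbreviation H01 :: "('a \<Rightarrow> real) set" where "H01 \<equiv> gasket_H01 N p"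
abbreviation WI :: "('a \<Rightarrow> real) \<Rightarrow> ('a \<Rightarrow> real) \<Rightarrow> real" where "WI \<equiv> gasket_inner N p"

lemma H01_EB: "u \<in> H01 \<Longrightarrow> EB u" by (simp add: H01_iff)

lemma WI_eq: "u \<in> H01 \<Longrightarrow> v \<in> H01 \<Longrightarrow> WI u v = kappa * EE u v"
  by (simp add: inner_EE H01_EB)

lemma norm_eq: "u \<in> H01 \<Longrightarrow> gasket_norm N p u = sqrt (WI u u)"
  using kappa(1) EE_nonneg[of u]
  by (simp add: gasket_norm_def energy_finite H01_EB WI_eq)

lemma H01_sup: assumes u: "u \<in> H01" and x: "x \<in> V" shows "\<bar>u x\<bar> \<le> Kosc * sqrt (WI u u)"
proof -
  have "\<bar>u x - u (p 1)\<bar> \<le> Kosc * sqrt (EE u u)"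
    by (rule V_osc) (use u x one_in_I EN_le_EE in \<open>auto simp: H01_iff\<close>)
  moreover have "u (p 1) = 0" using u one_in_I by (simp add: H01_iff)
  moreover have "EE u u \<le> WI u u"
    using mult_right_mono[OF kappa(1) EE_nonneg[OF H01_EB[OF u]]] by (simp add: WI_eq u)
  then have "Kosc * sqrt (EE u u) \<le> Kosc * sqrt (WI u u)" using Kosc by (intro mult_left_mono) auto
  ultimately show ?thesis by simp
qed

text \<open>Arzela-Ascoli gives the limit. \<open>EN m\<close> involves finitely many points and is
  continuous under pointwise convergence; letting \<open>m\<close> grow afterwards gives
  semicontinuity of the energy.\<close>

lemma H01_compact:
  assumes U: "\<And>n. U n \<in> H01" "\<And>n. WI (U n) (U n) \<le> B"
  shows "\<exists>k u. strict_mono (k :: nat \<Rightarrow> nat) \<and> u \<in> H01 \<and> uniform_limit V (\<lambda>n. U (k n)) u sequentially \<and>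
         (\<forall>b. (\<forall>\<^sub>F n in sequentially. WI (U (k n)) (U (k n)) \<le> b) \<longrightarrow> WI u u \<le> b)"
proof -
  have EEle: "EE u u \<le> WI u u" if "u \<in> H01" for u
    using mult_right_mono[OF kappa(1) EE_nonneg[OF H01_EB[OF that]]] by (simp add: WI_eq that)
  have EN: "EN m (U n) (U n) \<le> B" for m n
    using EN_le_EE[OF H01_EB[OF U(1)], of m n] EEle[OF U(1)[of n]] U(2)[of n] by linarith
  have B: "0 \<le> B" using EN[of 0 0] EN_nonneg[of 0 "U 0"] by linarith
  have cont: "continuous_on V (U n)" for n using U(1) by (simp add: H01_iff)
  obtain g k where g: "continuous_on V g" "strict_mono (k :: nat \<Rightarrow> nat)"
    and lim: "\<And>e. 0 < e \<Longrightarrow> \<exists>N. \<forall>n x. n \<ge> N \<and> x \<in> V \<longrightarrow> norm (U (k n) x - g x) < e"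
  proof (rule Arzela_Ascoli[OF gasket_props(1), of U "Kosc * sqrt B"])
    show "norm (U n x) \<le> Kosc * sqrt B" if "x \<in> V" for n x
    proof -
      have "Kosc * sqrt (WI (U n) (U n)) \<le> Kosc * sqrt B" using U(2)[of n] Kosc by simp
      then show ?thesis using H01_sup[OF U(1) that, of n] by simp
    qed
    show "\<exists>d>0. \<forall>n y. y \<in> V \<and> norm (x - y) < d \<longrightarrow> norm (U n x - U n y) < e" if x: "x \<in> V" and e: "0 < e" for x e
    proof -
      from equicont[OF e B] obtain d where d0: "d > 0" and d: "\<forall>u. continuous_on V u \<longrightarrow> (\<forall>m. EN m u u \<le> B) \<longrightarrow>
        (\<forall>x\<in>V. \<forall>y\<in>V. dist x y < d \<longrightarrow> \<bar>u x - u y\<bar> < e)" by (elim exE conjE)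
      have "norm (U n x - U n y) < e" if "y \<in> V" "norm (x - y) < d" for n y
        using d[rule_format, of "U n" x y] cont EN x that by (simp add: dist_norm)
      then show ?thesis using d0 by blast
    qed
  qed (rule that)
  have ul: "uniform_limit V (\<lambda>n. U (k n)) g sequentially"
  proof (rule uniform_limitI)
    fix e :: real assume "0 < e"
    from lim[OF this] obtain n0 where "\<And>n x. n \<ge> n0 \<Longrightarrow> x \<in> V \<Longrightarrow> norm (U (k n) x - g x) < e" by blast
    then show "\<forall>\<^sub>F n in sequentially. \<forall>x\<in>V. dist (U (k n) x) (g x) < e"
      by (auto simp: eventually_sequentially dist_norm)
  qed
  have pt: "(\<lambda>n. U (k n) x) \<longlonglongrightarrow> g x" if "x \<in> V" for x by (rule tendsto_uniform_limitI[OF ul that])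
  have ENl: "(\<lambda>n. EN m (U (k n)) (U (k n))) \<longlonglongrightarrow> EN m g g" for m by (rule EN_limit[OF pt])
  have "EN m g g \<le> B" for m using LIMSEQ_le_const2[OF ENl] EN by blast
  then have EBg: "EB g" by (auto simp: EB_def)
  have "g (p i) = 0" if "i \<in> I" for i
  proof -
    have "(\<lambda>n. U (k n) (p i)) = (\<lambda>n. 0)" using U(1) that by (auto simp: H01_iff)
    then show ?thesis using pt[OF p_in_V[OF that]] by (simp add: LIMSEQ_const_iff)
  qed
  then have gH: "g \<in> H01" using g EBg by (simp add: H01_iff)
  have "WI g g \<le> b" if ev: "\<forall>\<^sub>F n in sequentially. WI (U (k n)) (U (k n)) \<le> b" for b
  proof -
    have k0: "0 < kappa" using kappa(1) by simp
    have "EE g g \<le> b / kappa"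
    proof (rule EE_le[OF EBg])
      fix m
      have "\<forall>\<^sub>F n in sequentially. EN m (U (k n)) (U (k n)) \<le> b / kappa"
        using ev
      proof eventually_elim
        case (elim n)
        have 1: "kappa * EN m (U (k n)) (U (k n)) \<le> kappa * EE (U (k n)) (U (k n))"
          using k0 EN_le_EE[OF H01_EB[OF U(1)]] by (intro mult_left_mono) auto
        have 2: "kappa * EE (U (k n)) (U (k n)) \<le> b" using elim U(1) by (simp add: WI_eq)
        show ?case using order_trans[OF 1 2] k0 by (simp add: pos_le_divide_eq mult.commute)
      qed
      then show "EN m g g \<le> b / kappa" by (intro tendsto_upperbound[OF ENl]) auto
    qed
    then show ?thesis using k0 by (simp add: WI_eq gH field_simps)
  qed
  then show ?thesis using g ul gH by blast
qed

text \<open>Holds edge by edge; it permits truncating a spline.\<close>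

lemma EN_contraction:
  "(\<And>x y. x \<in> V \<Longrightarrow> y \<in> V \<Longrightarrow> \<bar>v x - v y\<bar> \<le> L * \<bar>u x - u y\<bar>) \<Longrightarrow> EN m v v \<le> L\<^sup>2 * EN m u u"
proof (induction m arbitrary: u v)
  case 0
  have "(v (p i) - v (p j)) * (v (p i) - v (p j)) \<le> L\<^sup>2 * ((u (p i) - u (p j)) * (u (p i) - u (p j)))"
    if "i \<in> I" "j \<in> I" for i j
    using power_mono[OF 0[OF p_in_V[OF that(1)] p_in_V[OF that(2)]], of 2]
    by (simp add: power2_eq_square power_mult_distrib mult_ac)
  then show ?case by (simp add: sum_distrib_left sum_mono)
next
  case (Suc m)
  have "(\<Sum>i\<in>I. EN m (\<lambda>x. v (S i x)) (\<lambda>x. v (S i x))) \<le> (\<Sum>i\<in>I. L\<^sup>2 * EN m (\<lambda>x. u (S i x)) (\<lambda>x. u (S i x)))"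
    by (intro sum_mono Suc.IH Suc.prems S_in_V)
  then have "rho * (\<Sum>i\<in>I. EN m (\<lambda>x. v (S i x)) (\<lambda>x. v (S i x))) \<le> rho * (\<Sum>i\<in>I. L\<^sup>2 * EN m (\<lambda>x. u (S i x)) (\<lambda>x. u (S i x)))"
    using rho_pos by simp
  then show ?case by (simp add: sum_distrib_left mult_ac)
qed

lemma small_cell: assumes "x \<in> V" "0 < d" shows "\<exists>w. set w \<subseteq> I \<and> Sw w ` V \<subseteq> ball x d"
proof -
  obtain b0 where b0: "\<forall>x\<in>V. \<forall>y\<in>V. dist x y \<le> b0"
    using compact_imp_bounded[OF gasket_props(1)] unfolding bounded_two_points by (elim exE)
  define b where "b = max b0 1"
  have b: "b > 0" "\<And>x y. x \<in> V \<Longrightarrow> y \<in> V \<Longrightarrow> dist x y \<le> b" using b0 by (auto simp: b_def le_max_iff_disj)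
  obtain n where n: "(1/2) ^ n < d / b"
    using real_arch_pow_inv[of "d / b" "1/2"] assms b by auto
  obtain w where w: "w \<in> words n" "x \<in> Sw w ` V" using V_words[OF assms(1)] by blast
  have "Sw w ` V \<subseteq> ball x d"
  proof clarify
    fix y assume "y \<in> V"
    obtain a where a: "a \<in> V" "x = Sw w a" using w by blast
    have "dist x (Sw w y) = (1/2) ^ n * dist a y" using w by (simp add: a dist_Sw words_def)
    also have "\<dots> \<le> (1/2) ^ n * b" using b a \<open>y \<in> V\<close> by (intro mult_left_mono) auto
    also have "\<dots> < d" using n b by (simp add: field_simps)
    finally show "Sw w y \<in> ball x d" by simp
  qed
  then show ?thesis using w by (auto simp: words_def)
qed

text \<open>A spline with value 0 at the corners and 1 at a junction is doubled and cut off at 1.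
  This makes it constant near the junction, hence on a small cell.\<close>

lemma plateau: "\<exists>\<phi>\<in>H01. (\<forall>x\<in>V. 0 \<le> \<phi> x \<and> \<phi> x \<le> 1) \<and> (\<exists>w. set w \<subseteq> I \<and> (\<forall>x\<in>Sw w ` V. \<phi> x = 1))"
proof -
  define u where "u x = (if x \<in> p ` I then 0 else 1 :: real)" for x
  define \<psi> where "\<psi> = spline (Suc 0) u"
  define \<phi> where "\<phi> x = min 1 (max 0 (2 * \<psi> x))" for x
  have I2: "2 \<in> I" using N2 by (simp add: I_def)
  have mid: "S 1 (p 2) \<notin> p ` I"
  proof
    assume "S 1 (p 2) \<in> p ` I"
    then obtain j where j: "j \<in> I" "S 1 (p 2) = p j" by auto
    have "bc 1 (S 1 (p 2)) = 1/2" using one_in_I I2 by (simp add: bc_S bc_p)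
    then show False using j bc_p[OF one_in_I j(1)] by (auto split: if_splits)
  qed
  have \<psi>1: "\<psi> (S 1 (p 2)) = 1"
    using spline_S[OF one_in_I p_in_V[OF I2], of 0 u] spline_p[OF I2, of 0 "\<lambda>x. u (S 1 x)"] mid by (simp add: \<psi>_def u_def del: spline.simps)
  have \<psi>0: "\<psi> (p i) = 0" if "i \<in> I" for i using spline_p[OF that, of "Suc 0" u] that by (simp add: \<psi>_def u_def)
  have cont: "continuous_on V \<psi>" unfolding \<psi>_def by (rule spline_cont)
  have EBpsi: "EB \<psi>"
  proof -
    have "EN m \<psi> \<psi> \<le> EN (Suc 0) u u" for m
      using EN_spline_spline[of "Suc 0" m u] EN_mono[of m "Suc 0 + m" \<psi>] by (simp add: \<psi>_def del: spline.simps EN.simps)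
    then show ?thesis by (auto simp: EB_def)
  qed
  then obtain B where B: "\<And>m. EN m \<psi> \<psi> \<le> B" by (auto simp: EB_def)
  have lip: "\<bar>\<phi> x - \<phi> y\<bar> \<le> 2 * \<bar>\<psi> x - \<psi> y\<bar>" for x y
    unfolding \<phi>_def by (auto simp: min_def max_def abs_if)
  have "EN m \<phi> \<phi> \<le> 2\<^sup>2 * EN m \<psi> \<psi>" for m by (rule EN_contraction) (rule lip)
  then have "EN m \<phi> \<phi> \<le> 2\<^sup>2 * B" for m using B[of m] by (meson mult_left_mono order_trans zero_le_power2)
  then have "EB \<phi>" by (auto simp: EB_def)
  moreover have "continuous_on V \<phi>" unfolding \<phi>_def by (intro continuous_intros cont)
  ultimately have \<phi>H: "\<phi> \<in> H01" using \<psi>0 by (simp add: H01_iff \<phi>_def)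
  have x0: "S 1 (p 2) \<in> V" using S_in_V one_in_I p_in_V I2 by blast
  from cont[unfolded continuous_on_iff, rule_format, OF x0, of "1/2"] obtain d where d0: "d > 0"
    and d: "\<forall>y\<in>V. dist y (S 1 (p 2)) < d \<longrightarrow> dist (\<psi> y) (\<psi> (S 1 (p 2))) < 1/2" by auto
  obtain w where w: "set w \<subseteq> I" "Sw w ` V \<subseteq> ball (S 1 (p 2)) d" using small_cell[OF x0 d0] by blast
  have "\<phi> x = 1" if "x \<in> Sw w ` V" for x
  proof -
    have "x \<in> V" "dist x (S 1 (p 2)) < d" using that w Sw_in_V by (auto simp: dist_commute)
    then have "dist (\<psi> x) 1 < 1/2" using d[rule_format, of x] \<psi>1 by simp
    then show ?thesis by (simp add: \<phi>_def dist_real_def abs_if split: if_splits)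
  qed
  then show ?thesis using \<phi>H w(1) by (intro bexI[of _ \<phi>]) (auto simp: \<phi>_def)
qed

end

section \<open>Hausdorff measure\<close>

lemma hausdorff_pre_le:
  "(\<And>i. bounded (U i)) \<Longrightarrow> (\<And>i. diameter (U i) \<le> \<delta>) \<Longrightarrow> A \<subseteq> (\<Union>i. U i) \<Longrightarrow>
     hausdorff_pre s \<delta> A \<le> (\<Sum>i::nat. ennreal (diameter (U i) powr s))"
  unfolding hausdorff_pre_def by (rule INF_lower) auto

lemma hausdorff_pre_ge:
  assumes "\<And>U :: nat \<Rightarrow> 'a::metric_space set. (\<And>i. bounded (U i)) \<Longrightarrow> (\<And>i. diameter (U i) \<le> \<delta>) \<Longrightarrow> A \<subseteq> (\<Union>i. U i) \<Longrightarrow>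
     c \<le> (\<Sum>i. ennreal (diameter (U i) powr s))"
  shows "c \<le> hausdorff_pre s \<delta> A"
  unfolding hausdorff_pre_def by (rule INF_greatest) (use assms in auto)

lemma hausdorff_pre_close:
  assumes "hausdorff_pre s \<delta> A < e"
  shows "\<exists>U. (\<forall>i. bounded (U i)) \<and> (\<forall>i. diameter (U i) \<le> \<delta>) \<and> A \<subseteq> (\<Union>i. U i) \<and>
     (\<Sum>i::nat. ennreal (diameter (U i) powr s)) < e"
  using assms unfolding hausdorff_pre_def INF_less_iff by auto

lemma hausdorff_pre_mono: "A \<subseteq> B \<Longrightarrow> hausdorff_pre s \<delta> A \<le> hausdorff_pre s \<delta> B"
  unfolding hausdorff_pre_def by (rule INF_superset_mono) auto

lemma hausdorff_pre_antimono: "\<delta> \<le> \<delta>' \<Longrightarrow> hausdorff_pre s \<delta>' A \<le> hausdorff_pre s \<delta> A"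
  unfolding hausdorff_pre_def by (rule INF_superset_mono) (auto intro: order_trans)

lemma hausdorff_pre_empty: "0 < \<delta> \<Longrightarrow> hausdorff_pre s \<delta> {} = 0"
  using hausdorff_pre_le[of "\<lambda>_. {}" \<delta> "{}" s] by simp

text \<open>Near-optimal covers of the \<open>A n\<close> with errors
  \<open>e * (1/2) ^ Suc n\<close>, enumerated as one sequence by
  \<open>prod_decode\<close>.\<close>

lemma hausdorff_pre_UN:
  assumes "0 < \<delta>"
  shows "hausdorff_pre s \<delta> (\<Union>n::nat. A n) \<le> (\<Sum>n. hausdorff_pre s \<delta> (A n))"
proof (rule ennreal_le_epsilon)
  fix e :: real assume "0 < e" "(\<Sum>n. hausdorff_pre s \<delta> (A n)) < top"
  then have *: "\<And>n. hausdorff_pre s \<delta> (A n) < hausdorff_pre s \<delta> (A n) + e * (1/2)^Suc n"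
    by (auto simp add: less_top dest!: ennreal_suminf_lessD)
  have "\<exists>B. (\<forall>i. bounded (B i)) \<and> (\<forall>i. diameter (B i) \<le> \<delta>) \<and> A n \<subseteq> (\<Union>i. B i) \<and>
     (\<Sum>i::nat. ennreal (diameter (B i) powr s)) \<le> hausdorff_pre s \<delta> (A n) + e * (1/2)^Suc n" for n
    using hausdorff_pre_close[OF *[of n]] less_imp_le by blast
  then obtain B where B: "\<And>n i. bounded (B n i)" "\<And>n i. diameter (B n i) \<le> \<delta>" "\<And>n. A n \<subseteq> (\<Union>i. B n i)"
     "\<And>n. (\<Sum>i::nat. ennreal (diameter (B n i) powr s)) \<le> hausdorff_pre s \<delta> (A n) + e * (1/2)^Suc n" by metis
  define D where "D = case_prod B o prod_decode"
  have "hausdorff_pre s \<delta> (\<Union>n. A n) \<le> (\<Sum>i. ennreal (diameter (D i) powr s))"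
  proof (rule hausdorff_pre_le)
    show "(\<Union>n. A n) \<subseteq> (\<Union>i. D i)"
    proof clarify
      fix x n assume "x \<in> A n"
      then obtain i where "x \<in> B n i" using B(3) by blast
      then have "x \<in> D (prod_encode (n, i))" by (simp add: D_def)
      then show "x \<in> (\<Union>i. D i)" by blast
    qed
  qed (auto simp: D_def B split: prod.split)
  also have "\<dots> = (\<Sum>n. \<Sum>i. ennreal (diameter (B n i) powr s))"
    unfolding D_def comp_def
    by (rule suminf_ennreal_2dimen[of _ "\<lambda>z. ennreal (diameter (case_prod B z) powr s)"]) simp
  also have "\<dots> \<le> (\<Sum>n. hausdorff_pre s \<delta> (A n) + e * (1/2) ^ Suc n)"
    by (intro suminf_le B) auto
  also have "\<dots> = (\<Sum>n. hausdorff_pre s \<delta> (A n)) + (\<Sum>n. ennreal e * ennreal ((1/2) ^ Suc n))"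
    using \<open>0 < e\<close> by (subst suminf_add[symmetric])
                     (auto simp del: ennreal_suminf_cmult simp add: ennreal_mult[symmetric])
  also have "\<dots> = (\<Sum>n. hausdorff_pre s \<delta> (A n)) + e"
    unfolding ennreal_suminf_cmult
    by (subst suminf_ennreal_eq[OF zero_le_power power_half_series]) auto
  finally show "hausdorff_pre s \<delta> (\<Union>n. A n) \<le> (\<Sum>n. hausdorff_pre s \<delta> (A n)) + e" .
qed

lemma pre_le_outer: "0 < \<delta> \<Longrightarrow> hausdorff_pre s \<delta> A \<le> hausdorff_outer s A"
  unfolding hausdorff_outer_def by (rule SUP_upper) auto

lemma hausdorff_outer_mono: "A \<subseteq> B \<Longrightarrow> hausdorff_outer s A \<le> hausdorff_outer s B"
  unfolding hausdorff_outer_def by (rule SUP_mono') (rule hausdorff_pre_mono)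

lemma hausdorff_outer_empty: "hausdorff_outer s {} = 0"
  unfolding hausdorff_outer_def by (simp add: hausdorff_pre_empty)

lemma hausdorff_outer_UN: "hausdorff_outer s (\<Union>n::nat. A n) \<le> (\<Sum>n. hausdorff_outer s (A n))"
  unfolding hausdorff_outer_def[of s "\<Union>n. A n"]
proof (rule SUP_least)
  fix \<delta> :: real assume "\<delta> \<in> {0<..}"
  then have "hausdorff_pre s \<delta> (\<Union>n. A n) \<le> (\<Sum>n. hausdorff_pre s \<delta> (A n))" by (intro hausdorff_pre_UN) simp
  also have "\<dots> \<le> (\<Sum>n. hausdorff_outer s (A n))" using \<open>\<delta> \<in> {0<..}\<close> by (intro suminf_le pre_le_outer) auto
  finally show "hausdorff_pre s \<delta> (\<Union>n. A n) \<le> (\<Sum>n. hausdorff_outer s (A n))" .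
qed

lemma hausdorff_outer_measure_space: "outer_measure_space UNIV (hausdorff_outer s)"
  unfolding outer_measure_space_def positive_def increasing_def countably_subadditive_def
  by (auto simp: hausdorff_outer_empty hausdorff_outer_mono hausdorff_outer_UN)

lemma hausdorff_outer_Un:
  fixes A B :: "'a::metric_space set"
  shows "hausdorff_outer s (A \<union> B) \<le> hausdorff_outer s A + hausdorff_outer s B"
proof -
  have "subadditive UNIV (hausdorff_outer s :: 'a set \<Rightarrow> ennreal)"
    using hausdorff_outer_measure_space[of s, where 'a = 'a]
      ring_of_sets.countably_subadditive_subadditive[of UNIV UNIV "hausdorff_outer s :: 'a set \<Rightarrow> ennreal"]
      ring_of_sets_Pow[of "UNIV :: 'a set"]
    by (simp add: outer_measure_space_def)
  moreover have "A \<union> B = A \<union> (B - A)" by blast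
  ultimately have "hausdorff_outer s (A \<union> B) \<le> hausdorff_outer s A + hausdorff_outer s (B - A)"
    unfolding subadditive_def by (metis Diff_disjoint UNIV_I)
  also have "\<dots> \<le> hausdorff_outer s A + hausdorff_outer s B"
    by (intro add_left_mono hausdorff_outer_mono) auto
  finally show ?thesis .
qed

text \<open>A covering set of diameter less than \<open>d\<close> meets at most one of
  \<open>A\<close> and \<open>B\<close>, so the cover splits.\<close>

lemma hausdorff_pre_separated:
  assumes d: "0 < \<delta>" "\<delta> < d" and sep: "\<And>x y. x \<in> A \<Longrightarrow> y \<in> B \<Longrightarrow> d \<le> dist x y"
  shows "hausdorff_pre s \<delta> A + hausdorff_pre s \<delta> B \<le> hausdorff_pre s \<delta> (A \<union> B)"
proof (rule hausdorff_pre_ge)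
  fix U :: "nat \<Rightarrow> 'a set"
  assume U: "\<And>i. bounded (U i)" "\<And>i. diameter (U i) \<le> \<delta>" "A \<union> B \<subseteq> (\<Union>i. U i)"
  define UA where "UA i = (if U i \<inter> A = {} then {} else U i)" for i
  define UB where "UB i = (if U i \<inter> B = {} then {} else U i)" for i
  have one: "U i \<inter> A = {} \<or> U i \<inter> B = {}" for i
  proof (rule ccontr)
    assume "\<not> ?thesis"
    then obtain x y where xy: "x \<in> U i" "x \<in> A" "y \<in> U i" "y \<in> B" by blast
    have "d \<le> dist x y" by (rule sep[OF xy(2,4)])
    also have "\<dots> \<le> \<delta>" using diameter_bounded_bound[OF U(1) xy(1,3)] U(2)[of i] by linarith
    finally show False using d by simp
  qed
  have "hausdorff_pre s \<delta> A \<le> (\<Sum>i. ennreal (diameter (UA i) powr s))"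
  proof (rule hausdorff_pre_le)
    show "A \<subseteq> (\<Union>i. UA i)"
    proof
      fix x assume "x \<in> A"
      then obtain i where "x \<in> U i" using U(3) by blast
      then have "x \<in> UA i" using \<open>x \<in> A\<close> by (auto simp: UA_def)
      then show "x \<in> (\<Union>i. UA i)" by blast
    qed
  qed (use U d in \<open>auto simp: UA_def\<close>)
  moreover have "hausdorff_pre s \<delta> B \<le> (\<Sum>i. ennreal (diameter (UB i) powr s))"
  proof (rule hausdorff_pre_le)
    show "B \<subseteq> (\<Union>i. UB i)"
    proof
      fix x assume "x \<in> B"
      then obtain i where "x \<in> U i" using U(3) by blast
      then have "x \<in> UB i" using \<open>x \<in> B\<close> by (auto simp: UB_def)
      then show "x \<in> (\<Union>i. UB i)" by blast
    qed
  qed (use U d in \<open>auto simp: UB_def\<close>)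
  ultimately have "hausdorff_pre s \<delta> A + hausdorff_pre s \<delta> B \<le>
      (\<Sum>i. ennreal (diameter (UA i) powr s)) + (\<Sum>i. ennreal (diameter (UB i) powr s))" by (rule add_mono)
  also have "\<dots> = (\<Sum>i. ennreal (diameter (UA i) powr s) + ennreal (diameter (UB i) powr s))"
    by (rule suminf_add) auto
  also have "\<dots> \<le> (\<Sum>i. ennreal (diameter (U i) powr s))"
  proof (rule suminf_le)
    show "ennreal (diameter (UA i) powr s) + ennreal (diameter (UB i) powr s) \<le> ennreal (diameter (U i) powr s)" for i
      using one[of i] by (auto simp: UA_def UB_def)
  qed auto
  finally show "hausdorff_pre s \<delta> A + hausdorff_pre s \<delta> B \<le> (\<Sum>i. ennreal (diameter (U i) powr s))" .
qed

lemma hausdorff_outer_separated: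
  assumes d: "0 < d" and sep: "\<And>x y. x \<in> A \<Longrightarrow> y \<in> B \<Longrightarrow> d \<le> dist x y"
  shows "hausdorff_outer s A + hausdorff_outer s B \<le> hausdorff_outer s (A \<union> B)"
proof -
  have 1: "hausdorff_pre s \<delta> A + hausdorff_pre s \<delta>' B \<le> hausdorff_outer s (A \<union> B)" if "0 < \<delta>" "0 < \<delta>'" for \<delta> \<delta>'
  proof -
    \<comment> \<open>A common scale below both and below \<open>d\<close>; thus the two suprema can
      be taken independently.\<close>
    define e where "e = min (min \<delta> \<delta>') (d / 2)"
    have e: "0 < e" "e < d" "e \<le> \<delta>" "e \<le> \<delta>'" using that d by (auto simp: e_def)
    have "hausdorff_pre s \<delta> A + hausdorff_pre s \<delta>' B \<le> hausdorff_pre s e A + hausdorff_pre s e B"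
      by (intro add_mono hausdorff_pre_antimono e)
    also have "\<dots> \<le> hausdorff_pre s e (A \<union> B)" by (rule hausdorff_pre_separated[OF e(1,2) sep])
    also have "\<dots> \<le> hausdorff_outer s (A \<union> B)" by (rule pre_le_outer[OF e(1)])
    finally show ?thesis .
  qed
  have ne: "{0<..} \<noteq> ({} :: real set)" by (auto intro: exI[of _ 1])
  have "hausdorff_outer s A + hausdorff_outer s B = (SUP \<delta>\<in>{0<..}. hausdorff_pre s \<delta> A + hausdorff_outer s B)"
    unfolding hausdorff_outer_def[of s A] by (rule ennreal_SUP_add_left[OF ne, symmetric])
  also have "\<dots> \<le> hausdorff_outer s (A \<union> B)"
  proof (rule SUP_least)
    fix \<delta> :: real assume "\<delta> \<in> {0<..}"
    have "hausdorff_pre s \<delta> A + hausdorff_outer s B = (SUP \<delta>'\<in>{0<..}. hausdorff_pre s \<delta> A + hausdorff_pre s \<delta>' B)"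
      unfolding hausdorff_outer_def[of s B] by (rule ennreal_SUP_add_right[OF ne])
    also have "\<dots> \<le> hausdorff_outer s (A \<union> B)" using 1 \<open>\<delta> \<in> {0<..}\<close> by (intro SUP_least) auto
    finally show "hausdorff_pre s \<delta> A + hausdorff_outer s B \<le> hausdorff_outer s (A \<union> B)" .
  qed
  finally show ?thesis .
qed

text \<open>Caratheodory's criterion for a metric outer measure: the layers
  \<open>{x. 1/(n+2) \<le> infdist x C < 1/(n+1)}\<close> of even (or odd) index are pairwise separated, so their measures are summable.\<close>

lemma closed_in_lambda_system:
  fixes C :: "'a::metric_space set"
  assumes C: "closed C"
  shows "C \<in> lambda_system UNIV UNIV (hausdorff_outer s)"
proof (cases "C = {}")
  case True
  then show ?thesis by (simp add: lambda_system_def hausdorff_outer_empty)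
next
  case ne: False
  let ?H = "hausdorff_outer s"
  have main: "?H (A \<inter> C) + ?H (A - C) \<le> ?H A" if fin: "?H A < top" for A
  proof (rule ennreal_le_epsilon)
    fix r :: real assume r: "0 < r"
    define B where "B n = {x \<in> A. 1 / real (Suc n) \<le> infdist x C}" for n
    define D where "D n = B (Suc n) - B n" for n
    have dist_lower: "infdist x C - infdist y C \<le> dist x y" for x y
      using infdist_triangle[of x C y] by simp
    have memD: "1 / real (n + 2) \<le> infdist x C \<and> infdist x C < 1 / real (n + 1) \<and> x \<in> A" if "x \<in> D n" for x n
      using that by (auto simp: D_def B_def)
    have parity: "(\<Sum>k<n. ?H (D (2 * k + e))) \<le> ?H (\<Union>k<n. D (2 * k + e))" for n e
    proof (induction n)
      case 0
      then show ?case by (simp add: hausdorff_outer_empty)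
    next
      case (Suc n)
      \<comment> \<open>The width of the layer between two consecutive layers of the same parity.
        For \<open>n = 0\<close> the union is empty, and that case is treated apart.\<close>
      define g where "g = 1 / real (2 * n + e) - 1 / real (2 * n + e + 1)"
      have "(\<Sum>k<Suc n. ?H (D (2 * k + e))) \<le> ?H (\<Union>k<n. D (2 * k + e)) + ?H (D (2 * n + e))"
        using Suc.IH by (simp add: add_right_mono)
      also have "\<dots> \<le> ?H ((\<Union>k<n. D (2 * k + e)) \<union> D (2 * n + e))"
      proof (cases "n = 0")
        case True
        then show ?thesis by (simp add: hausdorff_outer_empty)
      next
        case False
        show ?thesis
        proof (rule hausdorff_outer_separated[of g])
          show "0 < g" using False by (simp add: g_def frac_less2)
          fix x y assume "x \<in> (\<Union>k<n. D (2 * k + e))" and y: "y \<in> D (2 * n + e)"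
          then obtain k where k: "k < n" "x \<in> D (2 * k + e)" by blast
          have "1 / real (2 * n + e) \<le> 1 / real (2 * k + e + 2)" using k by (intro divide_left_mono) auto
          also have "\<dots> \<le> infdist x C" using memD[OF k(2)] by simp
          finally have "g \<le> infdist x C - infdist y C" using memD[OF y] by (simp add: g_def)
          then show "g \<le> dist x y" using dist_lower[of x y] by linarith
        qed
      qed
      also have "(\<Union>k<n. D (2 * k + e)) \<union> D (2 * n + e) = (\<Union>k<Suc n. D (2 * k + e))"
        by (auto simp: lessThan_Suc)
      finally show ?case .
    qed
    have half: "(\<Sum>k<n. ?H (D (2 * k + e))) \<le> ?H A" for n e
      by (rule order_trans[OF parity]) (intro hausdorff_outer_mono, auto simp: D_def B_def)
    have split: "(\<Sum>k<2 * n. ?H (D k)) = (\<Sum>k<n. ?H (D (2 * k + 0))) + (\<Sum>k<n. ?H (D (2 * k + 1)))" for n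
      by (induction n) (auto simp: algebra_simps)
    have "(\<Sum>k<n. ?H (D k)) \<le> ?H A + ?H A" for n
    proof -
      have "(\<Sum>k<n. ?H (D k)) \<le> (\<Sum>k<2 * n. ?H (D k))" by (intro sum_mono2) auto
      also have "\<dots> \<le> ?H A + ?H A" unfolding split by (intro add_mono half)
      finally show ?thesis .
    qed
    then have "(\<Sum>k. ?H (D k)) \<le> ?H A + ?H A" by (intro suminf_le_const) auto
    then have sfin: "(\<Sum>k. ?H (D k)) < top" using fin by (metis ennreal_add_less_top order_le_less_trans)
    have Hfin: "?H (D k) < top" for k using sfin ennreal_suminf_lessD by blast
    define h where "h k = enn2real (?H (D k))" for k
    have hH: "?H (D k) = ennreal (h k)" for k using Hfin[of k] by (simp add: h_def)
    have h0: "0 \<le> h k" for k by (simp add: h_def)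
    have sm: "summable h" using sfin h0 unfolding hH by (intro summable_suminf_not_top) auto
    \<comment> \<open>The tail of the summable layers bounds what \<open>B n\<close> misses of
      \<open>A - C\<close>.\<close>
    obtain n where n: "norm (\<Sum>k. h (k + n)) < r"
      using suminf_exist_split[OF r sm] by blast
    have sn: "summable (\<lambda>k. h (k + n))" using sm by (simp add: summable_iff_shift)
    have cover: "A - C \<subseteq> B n \<union> (\<Union>k. D (k + n))"
    proof
      fix x assume x: "x \<in> A - C"
      then have "infdist x C \<noteq> 0" using in_closed_iff_infdist_zero[OF C ne] by auto
      then have pos: "0 < infdist x C" using infdist_nonneg[of x C] by linarith
      obtain m where "1 / real (Suc m) < infdist x C" using nat_approx_posE[OF pos] .
      then have m: "x \<in> B m" using x by (auto simp: B_def)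
      define l where "l = (LEAST m. x \<in> B m)"
      have l: "x \<in> B l" unfolding l_def by (rule LeastI[of _ m]) (rule m)
      show "x \<in> B n \<union> (\<Union>k. D (k + n))"
      proof (cases "l \<le> n")
        case True
        have "1 / real (Suc n) \<le> 1 / real (Suc l)" using True by (intro divide_left_mono) auto
        then have "x \<in> B n" using l by (auto simp: B_def)
        then show ?thesis by simp
      next
        case False
        then obtain k where k: "l = Suc (k + n)" by (metis add.commute less_imp_Suc_add not_le)
        have "x \<notin> B (k + n)" using not_less_Least[of "k + n" "\<lambda>m. x \<in> B m"] k by (simp add: l_def)
        then have "x \<in> D (k + n)" using l k by (simp add: D_def)
        then show ?thesis by blast
      qed
    qed
    have "?H (A - C) \<le> ?H (B n) + ?H (\<Union>k. D (k + n))"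
      by (rule order_trans[OF hausdorff_outer_mono[OF cover] hausdorff_outer_Un])
    also have "?H (\<Union>k. D (k + n)) \<le> (\<Sum>k. ?H (D (k + n)))" by (rule hausdorff_outer_UN)
    also have "(\<Sum>k. ?H (D (k + n))) = ennreal (\<Sum>k. h (k + n))"
      unfolding hH using h0 sn by (intro suminf_ennreal2) auto
    also have "\<dots> \<le> ennreal r" using n by (intro ennreal_leI) (simp add: abs_less_iff)
    finally have 1: "?H (A - C) \<le> ?H (B n) + ennreal r" by (simp add: add_left_mono)
    \<comment> \<open>\<open>B n\<close> keeps distance \<open>1 / real (Suc n)\<close> from
      \<open>C\<close>, so additivity for separated sets applies.\<close>
    have "?H (A \<inter> C) + ?H (B n) \<le> ?H ((A \<inter> C) \<union> B n)"
    proof (rule hausdorff_outer_separated[of "1 / real (Suc n)"])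
      fix x y assume "x \<in> A \<inter> C" "y \<in> B n"
      then have "1 / real (Suc n) \<le> infdist y C" "infdist y C \<le> dist y x" by (auto simp: B_def infdist_le)
      then show "1 / real (Suc n) \<le> dist x y" by (simp add: dist_commute)
    qed simp
    also have "\<dots> \<le> ?H A" by (rule hausdorff_outer_mono) (auto simp: B_def)
    finally have 2: "?H (A \<inter> C) + ?H (B n) \<le> ?H A" .
    have "?H (A \<inter> C) + ?H (A - C) \<le> ?H (A \<inter> C) + (?H (B n) + ennreal r)" by (intro add_left_mono 1)
    also have "\<dots> = (?H (A \<inter> C) + ?H (B n)) + ennreal r" by (simp add: add.assoc)
    also have "\<dots> \<le> ?H A + ennreal r" by (intro add_right_mono 2)
    finally show "?H (A \<inter> C) + ?H (A - C) \<le> ?H A + ennreal r" .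
  qed
  have "?H (C \<inter> A) + ?H ((UNIV - C) \<inter> A) = ?H A" for A
  proof (rule antisym)
    have e: "C \<inter> A = A \<inter> C" "(UNIV - C) \<inter> A = A - C" by auto
    show "?H (C \<inter> A) + ?H ((UNIV - C) \<inter> A) \<le> ?H A"
      unfolding e by (cases "?H A < top") (auto simp: main less_top[symmetric])
    have "A = (A \<inter> C) \<union> (A - C)" by blast
    then show "?H A \<le> ?H (C \<inter> A) + ?H ((UNIV - C) \<inter> A)"
      unfolding e using hausdorff_outer_Un[of s "A \<inter> C" "A - C"] by simp
  qed
  then show ?thesis by (simp add: lambda_system_def)
qed

section \<open>The measure on the Caratheodory sets\<close>

lemma hausdorff_measure_space:
  "measure_space UNIV (lambda_system UNIV UNIV (hausdorff_outer s)) (hausdorff_outer s)"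
proof -
  interpret sigma_algebra UNIV "UNIV :: 'a set set" using sigma_algebra_Pow[of UNIV] by simp
  show ?thesis by (rule caratheodory_lemma[OF hausdorff_outer_measure_space])
qed

lemma sets_hausdorff: "sets (hausdorff_measure s :: 'a::metric_space measure) = lambda_system UNIV UNIV (hausdorff_outer s)"
proof -
  have "sigma_algebra UNIV (lambda_system UNIV UNIV (hausdorff_outer s) :: 'a set set)"
    using hausdorff_measure_space[of s, where 'a = 'a] by (simp add: measure_space_def)
  then show ?thesis unfolding hausdorff_measure_def
    by (subst sets_measure_of) (auto simp: sigma_algebra.sigma_sets_eq)
qed

lemma emeasure_hausdorff:
  fixes A :: "'a::metric_space set"
  assumes "A \<in> sets (hausdorff_measure s)"
  shows "emeasure (hausdorff_measure s) A = hausdorff_outer s A"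
proof -
  have ms: "measure_space UNIV (lambda_system UNIV UNIV (hausdorff_outer s)) (hausdorff_outer s :: 'a set \<Rightarrow> ennreal)"
    by (rule hausdorff_measure_space)
  show ?thesis
    by (rule emeasure_measure_of[OF hausdorff_measure_def])
       (use ms assms in \<open>auto simp: measure_space_def sets_hausdorff\<close>)
qed

lemma borel_sub_hausdorff: "sets borel \<subseteq> sets (hausdorff_measure s)"
proof -
  have "sigma_sets UNIV {S. closed S} \<subseteq> sets (hausdorff_measure s)"
    using sets.sigma_sets_subset[of "{S. closed S}" "hausdorff_measure s"] closed_in_lambda_system[of _ s]
    by (auto simp: sets_hausdorff hausdorff_measure_def)
  then show ?thesis by (simp add: borel_eq_closed)
qed

lemma space_hausdorff: "space (hausdorff_measure s) = UNIV"
  by (simp add: hausdorff_measure_def)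

text \<open>Padding with empty sets costs nothing: \<open>diameter {} = 0\<close> and
  \<open>0 powr s = 0\<close>.\<close>

lemma hausdorff_pre_finite_cover:
  assumes F: "finite F" and f: "\<And>w. w \<in> F \<Longrightarrow> bounded (f w)" "\<And>w. w \<in> F \<Longrightarrow> diameter (f w) \<le> \<delta>" "A \<subseteq> (\<Union>w\<in>F. f w)"
    and "0 < \<delta>"
  shows "hausdorff_pre s \<delta> A \<le> (\<Sum>w\<in>F. ennreal (diameter (f w) powr s))"
proof -
  obtain e where e: "bij_betw e {..<card F} F" using ex_bij_betw_nat_finite[OF F] by (metis atLeast0LessThan)
  define U where "U i = (if i < card F then f (e i) else {})" for i
  have eF: "e i \<in> F" if "i < card F" for i using e that by (auto simp: bij_betw_def)
  have "hausdorff_pre s \<delta> A \<le> (\<Sum>i. ennreal (diameter (U i) powr s))"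
  proof (rule hausdorff_pre_le)
    show "A \<subseteq> (\<Union>i. U i)"
    proof
      fix x assume "x \<in> A"
      then obtain w where w: "w \<in> F" "x \<in> f w" using f(3) by blast
      have "w \<in> e ` {..<card F}" using e w(1) by (simp add: bij_betw_def)
      then obtain i where "i < card F" "e i = w" by auto
      then have "x \<in> U i" using w by (simp add: U_def)
      then show "x \<in> (\<Union>i. U i)" by blast
    qed
  qed (use f eF \<open>0 < \<delta>\<close> in \<open>auto simp: U_def\<close>)
  also have "\<dots> = (\<Sum>i<card F. ennreal (diameter (U i) powr s))"
    by (rule suminf_finite) (auto simp: U_def)
  also have "\<dots> = (\<Sum>i<card F. ennreal (diameter (f (e i)) powr s))" by (simp add: U_def)
  also have "\<dots> = (\<Sum>w\<in>F. ennreal (diameter (f w) powr s))" by (rule sum.reindex_bij_betw[OF e])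
  finally show ?thesis .
qed

lemma hausdorff_outer_translation:
  fixes A :: "'a::real_normed_vector set"
  shows "hausdorff_outer s ((\<lambda>x. c + x) ` A) \<le> hausdorff_outer s A"
  unfolding hausdorff_outer_def
proof (rule SUP_mono')
  fix \<delta> :: real
  show "hausdorff_pre s \<delta> ((\<lambda>x. c + x) ` A) \<le> hausdorff_pre s \<delta> A"
  proof (rule hausdorff_pre_ge)
    fix U :: "nat \<Rightarrow> 'a set"
    assume U: "\<And>i. bounded (U i)" "\<And>i. diameter (U i) \<le> \<delta>" "A \<subseteq> (\<Union>i. U i)"
    have d: "diameter ((\<lambda>x. c + x) ` X) = diameter X" for X
    proof -
      have "(\<lambda>(x, y). dist x y) ` ((\<lambda>x. c + x) ` X \<times> (\<lambda>x. c + x) ` X) = (\<lambda>(x, y). dist x y) ` (X \<times> X)"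
        by (force simp: image_iff)
      then show ?thesis by (simp add: diameter_def)
    qed
    have "hausdorff_pre s \<delta> ((\<lambda>x. c + x) ` A) \<le> (\<Sum>i. ennreal (diameter ((\<lambda>x. c + x) ` U i) powr s))"
    proof (rule hausdorff_pre_le)
      show "(\<lambda>x. c + x) ` A \<subseteq> (\<Union>i. (\<lambda>x. c + x) ` U i)" using U(3) by blast
    qed (use U d in \<open>auto intro: bounded_translation\<close>)
    then show "hausdorff_pre s \<delta> ((\<lambda>x. c + x) ` A) \<le> (\<Sum>i. ennreal (diameter (U i) powr s))" by (simp add: d)
  qed
qed

section \<open>The gasket measure\<close>

lemma dyadic_scale: assumes "0 < e" "e < (1::real)" shows "\<exists>k. (1/2) ^ Suc k \<le> e \<and> e < (1/2) ^ k"
proof -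
  obtain n where n: "(1/2) ^ n < e" using real_arch_pow_inv[of e "1/2"] assms by auto
  define l where "l = (LEAST n. (1/2::real) ^ n \<le> e)"
  have l: "(1/2) ^ l \<le> e" unfolding l_def by (rule LeastI[of _ n]) (use n in simp)
  have "l \<noteq> 0" using l assms by (cases l) auto
  then obtain k where k: "l = Suc k" using not0_implies_Suc by blast
  have "\<not> (1/2) ^ k \<le> e" using not_less_Least[of k "\<lambda>n. (1/2::real) ^ n \<le> e"] k by (simp add: l_def)
  then show ?thesis using l k by auto
qed

context simplex_gasket
begin

text \<open>The similarity dimension: \<open>N * (1/2) powr dd = 1\<close>.\<close>

definition dd :: real where "dd = ln (real N) / ln 2"

abbreviation HM :: "'a measure" where "HM \<equiv> hausdorff_measure dd"

lemma dd_pos: "0 < dd"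
  using N2 by (simp add: dd_def)

lemma half_powr: "((1/2) ^ k) powr dd = 1 / real N ^ k"
proof -
  have "2 powr dd = real N" using N_pos by (simp add: powr_def dd_def)
  then have h: "(1/2) powr dd = 1 / real N" by (simp add: powr_divide)
  show ?thesis
  proof (induction k)
    case (Suc k)
    have "((1/2) ^ Suc k) powr dd = (1/2) powr dd * ((1/2) ^ k) powr dd"
      unfolding power_Suc by (rule powr_mult)
    then show ?case by (simp add: Suc h)
  qed simp
qed

text \<open>For \<open>a\<close> and \<open>b\<close> between 0 and 1,
  \<open>(a - b)\<^sup>2 \<le> a + b\<close>, and the coordinates of two points sum to 2.\<close>

lemma dist_V_le1: assumes "x \<in> V" "y \<in> V" shows "dist x y \<le> 1"
proof -
  have "(\<Sum>i\<in>I. (bc i x - bc i y)\<^sup>2) \<le> (\<Sum>i\<in>I. bc i x + bc i y)"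
  proof (rule sum_mono)
    fix i assume i: "i \<in> I"
    have b: "0 \<le> bc i x" "bc i x \<le> 1" "0 \<le> bc i y" "bc i y \<le> 1"
      using bc_nonneg bc_le1 assms i by auto
    then have ab: "\<bar>bc i x - bc i y\<bar> \<le> 1" "\<bar>bc i x - bc i y\<bar> \<le> bc i x + bc i y"
      by (auto simp: abs_le_iff)
    have "\<bar>bc i x - bc i y\<bar> * \<bar>bc i x - bc i y\<bar> \<le> 1 * \<bar>bc i x - bc i y\<bar>"
      by (intro mult_right_mono ab) simp
    also have "\<dots> \<le> bc i x + bc i y" using ab(2) by simp
    finally show "(bc i x - bc i y)\<^sup>2 \<le> bc i x + bc i y" by (simp add: power2_eq_square abs_mult_self_eq)
  qed
  also have "\<dots> = 2" by (simp add: sum.distrib sum_bc)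
  finally have "(norm (x - y))\<^sup>2 \<le> 1\<^sup>2" using norm_bc[OF assms] by simp
  then show ?thesis unfolding dist_norm by (rule power2_le_imp_le) simp
qed

section \<open>Counting the cells that meet a small set\<close>

lemma dist_cell_le: assumes "w \<in> words k" "x \<in> Sw w ` V" "y \<in> Sw w ` V" shows "dist x y \<le> (1/2) ^ k"
proof -
  obtain a b where "a \<in> V" "b \<in> V" "x = Sw w a" "y = Sw w b" using assms by blast
  then have "dist x y = (1/2) ^ k * dist a b" "dist a b \<le> 1" using assms(1) dist_V_le1 by (auto simp: dist_Sw words_def)
  then show ?thesis by (simp add: mult_left_le)
qed

lemma bc_lipschitz: assumes "x \<in> V" "y \<in> V" "i \<in> I" shows "\<bar>bc i x - bc i y\<bar> \<le> 2 * dist x y"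
proof -
  have "(bc i x - bc i y)\<^sup>2 \<le> (\<Sum>i\<in>I. (bc i x - bc i y)\<^sup>2)" using assms by (intro member_le_sum) auto
  also have "\<dots> = 2 * (dist x y)\<^sup>2" using norm_bc[OF assms(1,2)] by (simp add: dist_norm)
  also have "\<dots> \<le> (2 * dist x y)\<^sup>2" by (simp add: power_mult_distrib)
  finally have "\<bar>bc i x - bc i y\<bar>\<^sup>2 \<le> (2 * dist x y)\<^sup>2" by simp
  then show ?thesis by (rule power2_le_imp_le) simp
qed

lemma Sw_p1_corner: "set w \<subseteq> I \<Longrightarrow> j \<in> I \<Longrightarrow> Sw w (p 1) = p j \<Longrightarrow> j = 1"
proof (induction w)
  case Nil
  then show ?case using p_inj[of 1 j] one_in_I by simp
next
  case (Cons i w)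
  have V: "Sw w (p 1) \<in> V" using Sw_in_V Cons.prems p_in_V one_in_I by simp
  have eq: "S i (Sw w (p 1)) = S j (p j)" using Cons.prems by simp
  have "i = j"
  proof (rule ccontr)
    assume ne: "i \<noteq> j"
    have "p j = p i" using overlap[of j i "p j" "Sw w (p 1)"] Cons.prems ne V p_in_V eq by simp
    then show False using p_inj[of j i] Cons.prems ne by simp
  qed
  then have "Sw w (p 1) = p j" using eq S_eq_iff by metis
  then show ?case using Cons by simp
qed

text \<open>Cells are labelled by the image of corner 1, so that counting cells becomes counting
  points. If cells \<open>i\<close> and \<open>i'\<close> shared a label at their junction,
  \<open>Sw_p1_corner\<close> would force \<open>i = 1\<close> and \<open>i' = 1\<close>.\<close>

lemma Sw_p1_inj: "set w \<subseteq> I \<Longrightarrow> set w' \<subseteq> I \<Longrightarrow> length w = length w' \<Longrightarrow> Sw w (p 1) = Sw w' (p 1) \<Longrightarrow> w = w'"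
proof (induction w arbitrary: w')
  case (Cons i w)
  then obtain i' v where w': "w' = i' # v" by (cases w') auto
  have eq: "S i (Sw w (p 1)) = S i' (Sw v (p 1))" using Cons.prems w' by simp
  have ii: "i \<in> I" "i' \<in> I" and sub: "set w \<subseteq> I" "set v \<subseteq> I" using Cons.prems w' by auto
  have V: "Sw w (p 1) \<in> V" "Sw v (p 1) \<in> V" using Sw_in_V sub p_in_V one_in_I by auto
  have "i = i'"
  proof (rule ccontr)
    assume ne: "i \<noteq> i'"
    have "Sw w (p 1) = p i'" by (rule overlap[OF ii ne V eq])
    moreover have "Sw v (p 1) = p i" using overlap[OF ii(2,1) _ V(2,1)] ne eq by simp
    ultimately show False using Sw_p1_corner sub ii ne by blast
  qed
  then show ?case using eq Cons.IH[of v] Cons.prems w' by simp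
qed simp

lemma Sw_vert: "set w \<subseteq> I \<Longrightarrow> Sw w (p 1) \<in> vert (length w)"
  by (induction w) (use imageI[OF one_in_I, of p] in auto)

text \<open>The coordinates of the labels are integers in units of \<open>(1/2) ^ k\<close>, each
  within 4 units of the coordinate of \<open>b\<close>. That leaves at most 10 integers per
  coordinate.\<close>

lemma card_near:
  assumes b: "b \<in> V"
  shows "card {w \<in> words k. dist (Sw w (p 1)) b \<le> 2 * (1/2) ^ k} \<le> 10 ^ N"
proof -
  define X where "X = {w \<in> words k. dist (Sw w (p 1)) b \<le> 2 * (1/2) ^ k}"
  define \<epsilon> :: real where "\<epsilon> = (1/2) ^ k"
  have \<epsilon>: "\<epsilon> > 0" by (simp add: \<epsilon>_def)
  have "\<exists>z. \<forall>i\<in>I. bc i (Sw w (p 1)) = of_int (z i :: int) * \<epsilon>" if "w \<in> X" for w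
  proof -
    have "Sw w (p 1) \<in> vert k" using that Sw_vert[of w] by (simp add: X_def words_def)
    then show ?thesis using bc_vert[of _ k] unfolding \<epsilon>_def by metis
  qed
  then obtain z where z: "\<And>w i. w \<in> X \<Longrightarrow> i \<in> I \<Longrightarrow> bc i (Sw w (p 1)) = of_int (z w i :: int) * \<epsilon>" by metis
  define f where "f i = \<lfloor>bc i b / \<epsilon>\<rfloor>" for i
  \<comment> \<open>A window of 10 integers around the rounded-down coordinate; its asymmetry makes
    up for the rounding.\<close>
  define T where "T = PiE I (\<lambda>i. {f i - 4..f i + 5})"
  define Z where "Z w = restrict (z w) I" for w
  have XV: "Sw w (p 1) \<in> V" if "w \<in> X" for w
    using that Sw_in_V p_in_V one_in_I by (auto simp: X_def words_def)
  have "Z ` X \<subseteq> T"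
  proof clarify
    fix w assume w: "w \<in> X"
    have "z w i \<in> {f i - 4..f i + 5}" if i: "i \<in> I" for i
    proof -
      have "\<bar>bc i (Sw w (p 1)) - bc i b\<bar> \<le> 2 * dist (Sw w (p 1)) b" by (rule bc_lipschitz[OF XV[OF w] b i])
      also have "\<dots> \<le> 4 * \<epsilon>" using w by (simp add: X_def \<epsilon>_def)
      finally have le: "\<bar>bc i (Sw w (p 1)) - bc i b\<bar> \<le> 4 * \<epsilon>" .
      define t where "t = bc i b / \<epsilon>"
      have tb: "bc i b = t * \<epsilon>" using \<epsilon> by (simp add: t_def)
      have "\<bar>of_int (z w i) - t\<bar> * \<epsilon> = \<bar>of_int (z w i) * \<epsilon> - t * \<epsilon>\<bar>"
        using \<epsilon> by (simp add: abs_mult flip: left_diff_distrib)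
      then have "\<bar>of_int (z w i) - t\<bar> * \<epsilon> \<le> 4 * \<epsilon>" using le z[OF w i] tb by simp
      then have "\<bar>of_int (z w i) - t\<bar> \<le> 4" using \<epsilon> by simp
      then show ?thesis unfolding f_def t_def[symmetric] by (simp add: abs_le_iff) linarith
    qed
    then show "Z w \<in> T" by (auto simp: Z_def T_def)
  qed
  moreover have "inj_on Z X"
  proof (rule inj_onI)
    fix w w' assume w: "w \<in> X" "w' \<in> X" "Z w = Z w'"
    have "z w i = z w' i" if "i \<in> I" for i using w(3) that by (metis Z_def restrict_apply')
    then have "Sw w (p 1) = Sw w' (p 1)" using w z by (intro bc_eqI XV) auto
    then show "w = w'" using w(1,2) by (intro Sw_p1_inj) (auto simp: X_def words_def)
  qed
  moreover have "finite T" unfolding T_def by (intro finite_PiE) auto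
  ultimately have "card X \<le> card T" by (intro card_inj_on_le)
  also have "card T = 10 ^ N" unfolding T_def by (subst card_PiE) auto
  finally show ?thesis by (simp add: X_def)
qed

lemma card_meeting:
  assumes B: "\<And>x y. x \<in> B \<Longrightarrow> y \<in> B \<Longrightarrow> dist x y \<le> (1/2) ^ k"
  shows "card {w \<in> words k. Sw w ` V \<inter> B \<noteq> {}} \<le> 10 ^ N"
proof (cases "V \<inter> B = {}")
  case True
  have "Sw w ` V \<inter> B = {}" if "w \<in> words k" for w
    using True Sw_in_V that unfolding words_def by blast
  then have "{w \<in> words k. Sw w ` V \<inter> B \<noteq> {}} = {}" by blast
  then show ?thesis by (metis card.empty zero_le)
next
  case False
  then obtain b where b: "b \<in> V" "b \<in> B" by blast
  have "{w \<in> words k. Sw w ` V \<inter> B \<noteq> {}} \<subseteq> {w \<in> words k. dist (Sw w (p 1)) b \<le> 2 * (1/2) ^ k}"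
  proof
    fix w assume "w \<in> {w \<in> words k. Sw w ` V \<inter> B \<noteq> {}}"
    then obtain y where w: "w \<in> words k" and y: "y \<in> V" "Sw w y \<in> B" by blast
    have "dist (Sw w (p 1)) (Sw w y) \<le> (1/2) ^ k"
      by (rule dist_cell_le[OF w]) (use y p_in_V one_in_I in auto)
    moreover have "dist (Sw w y) b \<le> (1/2) ^ k" by (rule B[OF y(2) b(2)])
    ultimately have "dist (Sw w (p 1)) b \<le> 2 * (1/2) ^ k"
      using dist_triangle[of "Sw w (p 1)" b "Sw w y"] by linarith
    then show "w \<in> {w \<in> words k. dist (Sw w (p 1)) b \<le> 2 * (1/2) ^ k}" using w by blast
  qed
  then have "card {w \<in> words k. Sw w ` V \<inter> B \<noteq> {}} \<le> card {w \<in> words k. dist (Sw w (p 1)) b \<le> 2 * (1/2) ^ k}"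
    by (intro card_mono) (auto simp: finite_words)
  then show ?thesis using card_near[OF b(1), of k] by linarith
qed

lemma Sw_append: "Sw (u @ v) x = Sw u (Sw v x)"
  by (induction u) auto

text \<open>A word of length \<open>m\<close> whose cell meets \<open>B\<close> has a prefix of
  length \<open>k\<close> with the same property, and each prefix has \<open>N ^ (m - k)\<close>
  extensions.\<close>

lemma card_meeting_refine:
  assumes B: "\<And>x y. x \<in> B \<Longrightarrow> y \<in> B \<Longrightarrow> dist x y \<le> (1/2) ^ k" and km: "k \<le> m"
  shows "card {w \<in> words m. Sw w ` V \<inter> B \<noteq> {}} \<le> 10 ^ N * N ^ (m - k)"
proof -
  let ?G = "{w \<in> words k. Sw w ` V \<inter> B \<noteq> {}}"
  have "{w \<in> words m. Sw w ` V \<inter> B \<noteq> {}} \<subseteq> (\<lambda>(u, v). u @ v) ` (?G \<times> words (m - k))"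
  proof
    fix w assume w: "w \<in> {w \<in> words m. Sw w ` V \<inter> B \<noteq> {}}"
    then obtain x where x: "x \<in> V" "Sw w x \<in> B" by blast
    have sw: "set w \<subseteq> I" "length w = m" using w by (auto simp: words_def)
    have td: "set (take k w) \<subseteq> I" "set (drop k w) \<subseteq> I"
      using sw(1) set_take_subset[of k w] set_drop_subset[of k w] by auto
    have "Sw (take k w) (Sw (drop k w) x) = Sw w x" using Sw_append[of "take k w" "drop k w" x] by simp
    then have "take k w \<in> ?G" using td sw km x Sw_in_V[OF td(2) x(1)] by (force simp: words_def)
    moreover have "drop k w \<in> words (m - k)" using td sw by (simp add: words_def)
    ultimately show "w \<in> (\<lambda>(u, v). u @ v) ` (?G \<times> words (m - k))"
      by (intro image_eqI[of _ _ "(take k w, drop k w)"]) auto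
  qed
  then have "card {w \<in> words m. Sw w ` V \<inter> B \<noteq> {}} \<le> card (?G \<times> words (m - k))"
    by (intro surj_card_le) (auto simp: finite_words)
  also have "\<dots> = card ?G * N ^ (m - k)" by (simp add: card_cartesian_product card_words)
  also have "\<dots> \<le> 10 ^ N * N ^ (m - k)" by (intro mult_right_mono card_meeting B) auto
  finally show ?thesis .
qed

text \<open>\<open>10 ^ N\<close> bounds the number of cells met at one scale; \<open>N\<close> is
  the loss from rounding a diameter to a power of 1/2.\<close>

definition mass :: real where "mass = 1 / (10 ^ N * real N)"

lemma mass_pos: "0 < mass" using N_pos by (simp add: mass_def)

text \<open>Counting in place of a mass distribution: at a level \<open>m\<close> at least as fine
  as every set of the cover, all \<open>N ^ m\<close> cells must be met, and the set
  \<open>B i\<close> meets at most \<open>10 ^ N * N ^ (m - k i)\<close> of them.\<close>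

lemma finite_cover_mass:
  assumes J: "finite J" and e: "\<And>i. i \<in> J \<Longrightarrow> 0 < e i"
    and B: "\<And>i x y. i \<in> J \<Longrightarrow> x \<in> B i \<Longrightarrow> y \<in> B i \<Longrightarrow> dist x y \<le> e i" and V: "V \<subseteq> (\<Union>i\<in>J. B i)"
  shows "mass \<le> (\<Sum>i\<in>J. e i powr dd)"
proof (cases "\<exists>i\<in>J. 1 \<le> e i")
  case True
  then obtain i where i: "i \<in> J" "1 \<le> e i" by blast
  have "real 1 \<le> real (10 ^ N * N)" using N2 by (subst of_nat_le_iff) (simp add: Suc_leI)
  then have "mass \<le> 1" using N_pos by (simp add: mass_def divide_le_eq)
  also have "1 \<le> e i powr dd" using i dd_pos by (simp add: ge_one_powr_ge_zero)
  also have "\<dots> \<le> (\<Sum>i\<in>J. e i powr dd)" by (rule member_le_sum[OF i(1)]) (use J in auto)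
  finally show ?thesis .
next
  case False
  then have "\<forall>i\<in>J. \<exists>k. (1/2) ^ Suc k \<le> e i \<and> e i < (1/2) ^ k" using dyadic_scale e by force
  from bchoice[OF this] obtain k where k: "\<And>i. i \<in> J \<Longrightarrow> (1/2) ^ Suc (k i) \<le> e i" "\<And>i. i \<in> J \<Longrightarrow> e i < (1/2) ^ k i" by blast
  define m where "m = Max (insert 0 (k ` J))"
  have km: "k i \<le> m" if "i \<in> J" for i unfolding m_def using J that by (intro Max_ge) auto
  have "words m \<subseteq> (\<Union>i\<in>J. {w \<in> words m. Sw w ` V \<inter> B i \<noteq> {}})"
  proof
    fix w assume w: "w \<in> words m"
    then have "Sw w (p 1) \<in> V" using Sw_in_V p_in_V one_in_I by (auto simp: words_def)
    then obtain i where "i \<in> J" "Sw w (p 1) \<in> B i" using V by blast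
    then show "w \<in> (\<Union>i\<in>J. {w \<in> words m. Sw w ` V \<inter> B i \<noteq> {}})" using w p_in_V[OF one_in_I] by blast
  qed
  then have "card (words m) \<le> card (\<Union>i\<in>J. {w \<in> words m. Sw w ` V \<inter> B i \<noteq> {}})"
    using J by (intro card_mono) (auto simp: finite_words)
  also have "\<dots> \<le> (\<Sum>i\<in>J. card {w \<in> words m. Sw w ` V \<inter> B i \<noteq> {}})" by (rule card_UN_le[OF J])
  also have "\<dots> \<le> (\<Sum>i\<in>J. 10 ^ N * N ^ (m - k i))"
  proof (intro sum_mono card_meeting_refine km)
    fix i x y assume "i \<in> J" "x \<in> B i" "y \<in> B i"
    then show "dist x y \<le> (1/2) ^ k i" using B[of i x y] k(2)[of i] by simp
  qed
  finally have "N ^ m \<le> (\<Sum>i\<in>J. 10 ^ N * N ^ (m - k i))" by (simp add: card_words)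
  then have "real (N ^ m) \<le> real (\<Sum>i\<in>J. 10 ^ N * N ^ (m - k i))" by (simp only: of_nat_le_iff)
  then have "real N ^ m \<le> (\<Sum>i\<in>J. 10 ^ N * real N ^ (m - k i))" by simp
  also have "\<dots> \<le> (\<Sum>i\<in>J. 10 ^ N * (real N ^ m * (real N * e i powr dd)))"
  proof (intro sum_mono mult_left_mono)
    fix i assume i: "i \<in> J"
    have "1 / real N ^ Suc (k i) \<le> e i powr dd"
      unfolding half_powr[symmetric] using k(1)[OF i] dd_pos by (intro powr_mono2) auto
    then have "real N ^ m * (real N * (1 / real N ^ Suc (k i))) \<le> real N ^ m * (real N * e i powr dd)"
      using N_pos by (intro mult_left_mono) auto
    moreover have "real N ^ (m - k i) = real N ^ m * (real N * (1 / real N ^ Suc (k i)))"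
      using N_pos km[OF i] by (simp add: power_diff)
    ultimately show "real N ^ (m - k i) \<le> real N ^ m * (real N * e i powr dd)" by simp
  qed simp
  also have "\<dots> = real N ^ m * (10 ^ N * real N * (\<Sum>i\<in>J. e i powr dd))"
    by (simp add: sum_distrib_left mult_ac)
  finally have "real N ^ m * 1 \<le> real N ^ m * (10 ^ N * real N * (\<Sum>i\<in>J. e i powr dd))" by simp
  then have "1 \<le> 10 ^ N * real N * (\<Sum>i\<in>J. e i powr dd)" using N_pos by simp
  then show ?thesis using N_pos by (simp add: mass_def divide_le_eq mult.commute)
qed

text \<open>The price of enlarging a covering set to an open one; \<open>x = 0\<close> is included
  because sets of diameter 0 must be enlarged too.\<close>

lemma powr_enlarge: assumes "0 \<le> (x::real)" "0 < \<epsilon>" shows "\<exists>r>0. (x + 2 * r) powr dd \<le> x powr dd + \<epsilon>"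
proof -
  have lin: "((\<lambda>r. x + 2 * r) \<longlongrightarrow> x + 2 * 0) (at_right 0)" by (intro tendsto_intros)
  have "((\<lambda>r. (x + 2 * r) powr dd) \<longlongrightarrow> (x + 2 * 0) powr dd) (at_right 0)"
    by (rule tendsto_powr'[OF lin tendsto_const])
       (use assms dd_pos in \<open>auto intro!: eventually_at_right_less[THEN eventually_mono]\<close>)
  then have "\<forall>\<^sub>F r in at_right 0. (x + 2 * r) powr dd < x powr dd + \<epsilon>"
    by (rule order_tendstoD(2)) (use assms in simp)
  then have "\<forall>\<^sub>F r in at_right (0::real). 0 < r \<and> (x + 2 * r) powr dd < x powr dd + \<epsilon>"
    by (intro eventually_conj eventually_at_right_less)
  from eventually_happens'[OF _ this] show ?thesis by (auto intro: less_imp_le)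
qed

text \<open>A countable cover is enlarged to an open one at total cost \<open>\<epsilon>\<close>,
  and compactness reduces it to the finite case.\<close>

lemma outer_V_pos: "ennreal mass \<le> hausdorff_outer dd V"
proof -
  have "ennreal mass \<le> hausdorff_pre dd 1 V"
  proof (rule hausdorff_pre_ge, rule ennreal_le_epsilon)
    fix U :: "nat \<Rightarrow> 'a set" and \<epsilon> :: real
    assume U: "\<And>i. bounded (U i)" "V \<subseteq> (\<Union>i. U i)" and \<epsilon>: "0 < \<epsilon>"
      and fin: "(\<Sum>i. ennreal (diameter (U i) powr dd)) < top"
    have "\<exists>r>0. (diameter (U i) + 2 * r) powr dd \<le> diameter (U i) powr dd + \<epsilon> * (1/2) ^ Suc i" for i
      using \<epsilon> diameter_ge_0[OF U(1)] by (intro powr_enlarge) auto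
    then obtain r where r: "\<And>i. 0 < r i" "\<And>i. (diameter (U i) + 2 * r i) powr dd \<le> diameter (U i) powr dd + \<epsilon> * (1/2) ^ Suc i"
      by metis
    define B where "B i = (\<Union>u\<in>U i. ball u (r i))" for i
    have cover: "V \<subseteq> (\<Union>i\<in>UNIV. B i)"
    proof
      fix x assume "x \<in> V"
      then obtain i where "x \<in> U i" using U(2) by blast
      then have "x \<in> B i" using r(1)[of i] by (auto simp: B_def intro!: bexI[of _ x])
      then show "x \<in> (\<Union>i. B i)" by blast
    qed
    have op: "\<And>i. i \<in> UNIV \<Longrightarrow> open (B i)" unfolding B_def by (intro open_UN ballI open_ball)
    obtain J where J: "finite J" "V \<subseteq> (\<Union>i\<in>J. B i)"
      by (rule compactE_image[OF gasket_props(1) op cover])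
    have "mass \<le> (\<Sum>i\<in>J. (diameter (U i) + 2 * r i) powr dd)"
    proof (rule finite_cover_mass[OF J(1) _ _ J(2)])
      show "0 < diameter (U i) + 2 * r i" for i using diameter_ge_0[OF U(1), of i] r(1)[of i] by linarith
      fix i x y assume "x \<in> B i" "y \<in> B i"
      then obtain u v where uv: "u \<in> U i" "dist u x < r i" "v \<in> U i" "dist v y < r i" by (auto simp: B_def)
      have "dist u v \<le> diameter (U i)" by (rule diameter_bounded_bound[OF U(1) uv(1,3)])
      then show "dist x y \<le> diameter (U i) + 2 * r i"
        using uv dist_triangle[of x y u] dist_triangle[of u y v] by (simp add: dist_commute)
    qed
    also have "\<dots> \<le> (\<Sum>i\<in>J. diameter (U i) powr dd + \<epsilon> * (1/2) ^ Suc i)" by (intro sum_mono r)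
    also have "\<dots> = (\<Sum>i\<in>J. diameter (U i) powr dd) + \<epsilon> * (\<Sum>i\<in>J. (1/2) ^ Suc i)"
      by (simp add: sum.distrib sum_distrib_left)
    also have "(\<Sum>i\<in>J. (1/2::real) ^ Suc i) \<le> 1"
      using sum_le_suminf[of "\<lambda>i. (1/2::real) ^ Suc i" J] power_half_series J(1) by (simp add: sums_iff)
    finally have "mass \<le> (\<Sum>i\<in>J. diameter (U i) powr dd) + \<epsilon>" using \<epsilon> by simp
    then have "ennreal mass \<le> ennreal ((\<Sum>i\<in>J. diameter (U i) powr dd) + \<epsilon>)" by (rule ennreal_leI)
    also have "\<dots> = (\<Sum>i\<in>J. ennreal (diameter (U i) powr dd)) + ennreal \<epsilon>"
      using \<epsilon> by (simp add: ennreal_plus sum_nonneg sum_ennreal)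
    also have "\<dots> \<le> (\<Sum>i. ennreal (diameter (U i) powr dd)) + ennreal \<epsilon>"
      by (intro add_right_mono sum_le_suminf) (use J in auto)
    finally show "ennreal mass \<le> (\<Sum>i. ennreal (diameter (U i) powr dd)) + ennreal \<epsilon>" .
  qed
  also have "\<dots> \<le> hausdorff_outer dd V" by (rule pre_le_outer) simp
  finally show ?thesis .
qed

text \<open>The \<open>N ^ n\<close> cells of level \<open>n\<close> have diameter at most
  \<open>(1/2) ^ n\<close>, so each contributes at most \<open>1 / N ^ n\<close>.\<close>

lemma outer_V_finite: "hausdorff_outer dd V \<le> 1"
  unfolding hausdorff_outer_def
proof (rule SUP_least)
  fix \<delta> :: real assume "\<delta> \<in> {0<..}"
  then have \<delta>: "0 < \<delta>" by simp
  obtain n where n: "(1/2) ^ n < \<delta>" using real_arch_pow_inv[OF \<delta>, of "1/2"] by auto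
  have d: "diameter (Sw w ` V) \<le> (1/2) ^ n" if "w \<in> words n" for w
    by (rule diameter_le) (use dist_cell_le[OF that] in \<open>auto simp: dist_norm\<close>)
  have "hausdorff_pre dd \<delta> V \<le> (\<Sum>w\<in>words n. ennreal (diameter (Sw w ` V) powr dd))"
  proof (rule hausdorff_pre_finite_cover)
    show "V \<subseteq> (\<Union>w\<in>words n. Sw w ` V)" using V_words by blast
    show "diameter (Sw w ` V) \<le> \<delta>" if "w \<in> words n" for w using d[OF that] n by simp
  qed (use \<delta> in \<open>auto simp: finite_words intro!: compact_imp_bounded compact_cell\<close>)
  also have "\<dots> \<le> (\<Sum>w\<in>words n. ennreal (1 / real N ^ n))"
    unfolding half_powr[symmetric] using d dd_pos
    by (intro sum_mono ennreal_leI powr_mono2) (auto intro!: diameter_ge_0 compact_imp_bounded compact_cell)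
  also have "\<dots> = 1" by (subst sum_ennreal) (use N_pos in \<open>auto simp: card_words\<close>)
  finally show "hausdorff_pre dd \<delta> V \<le> 1" .
qed

lemma V_sets: "V \<in> sets HM"
  by (rule subsetD[OF borel_sub_hausdorff borel_closed[OF closed_V]])

lemma cell_sets: "Sw w ` V \<in> sets HM"
  by (rule subsetD[OF borel_sub_hausdorff borel_closed[OF compact_imp_closed[OF compact_cell]]])

lemma emeasure_V: "emeasure HM V \<noteq> 0" "emeasure HM V \<noteq> top"
proof -
  have "0 < ennreal mass" using mass_pos by simp
  then show "emeasure HM V \<noteq> 0" using outer_V_pos by (auto simp: emeasure_hausdorff[OF V_sets])
  show "emeasure HM V \<noteq> top" using outer_V_finite by (auto simp: emeasure_hausdorff[OF V_sets] top_unique)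
qed

lemma Sw_affine: "Sw w x = Sw w 0 + (1/2) ^ length w *\<^sub>R x"
proof (induction w)
  case (Cons i w)
  have "Sw (i # w) x = S i (Sw w 0 + (1/2) ^ length w *\<^sub>R x)" using Cons by simp
  then show ?case by (simp add: gasket_map_def scaleR_add_right)
qed simp

text \<open>Cells of one level are translates of each other. If one were null, all would be, and
  they cover \<open>V\<close>.\<close>

lemma emeasure_cell: assumes "set w \<subseteq> I" shows "emeasure HM (Sw w ` V) \<noteq> 0"
proof
  assume 0: "emeasure HM (Sw w ` V) = 0"
  define n where "n = length w"
  have z: "emeasure HM (Sw v ` V) = 0" if v: "v \<in> words n" for v
  proof -
    have "Sw v ` V = (\<lambda>x. (Sw v 0 - Sw w 0) + x) ` (Sw w ` V)"
      unfolding image_image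
    proof (rule image_cong[OF refl])
      fix x
      show "Sw v x = Sw v 0 - Sw w 0 + Sw w x"
        using Sw_affine[of v x] Sw_affine[of w x] v by (simp add: words_def n_def)
    qed
    then have "hausdorff_outer dd (Sw v ` V) \<le> hausdorff_outer dd (Sw w ` V)"
      using hausdorff_outer_translation[of dd "Sw v 0 - Sw w 0" "Sw w ` V"] by simp
    then show ?thesis using 0 by (simp add: emeasure_hausdorff cell_sets)
  qed
  have "emeasure HM V \<le> emeasure HM (\<Union>v\<in>words n. Sw v ` V)"
  proof (rule emeasure_mono)
    show "V \<subseteq> (\<Union>v\<in>words n. Sw v ` V)" using V_words by blast
    show "(\<Union>v\<in>words n. Sw v ` V) \<in> sets HM" using cell_sets finite_words by (intro sets.finite_UN) auto
  qed
  also have "\<dots> \<le> (\<Sum>v\<in>words n. emeasure HM (Sw v ` V))"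
    by (rule emeasure_subadditive_finite) (use cell_sets finite_words in auto)
  also have "\<dots> = 0" by (simp add: z)
  finally show False using emeasure_V by simp
qed

section \<open>The normalised measure\<close>

abbreviation GM :: "'a measure" where "GM \<equiv> gasket_measure N p"

lemma GM_def: "GM = scale_measure (1 / emeasure HM V) (restrict_space HM V)"
  by (simp add: gasket_measure_def dd_def Let_def)

lemma space_GM: "space GM = V"
  using sets_eq_imp_space_eq[of GM "restrict_space HM V"]
  by (simp add: GM_def space_restrict_space space_hausdorff)

lemma sets_GM: "sets GM = sets (restrict_space HM V)"
  by (simp add: GM_def)

lemma emeasure_GM: assumes "B \<in> sets HM" "B \<subseteq> V" shows "emeasure GM B = emeasure HM B / emeasure HM V"
  using assms V_sets
  by (simp add: GM_def emeasure_restrict_space space_hausdorff divide_ennreal_def mult.commute)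

lemma emeasure_GM_V: "emeasure GM V = 1"
  using emeasure_GM[OF V_sets order_refl] emeasure_V by (simp add: ennreal_divide_self less_top)

lemma finite_GM: "finite_measure GM"
  by (rule finite_measureI) (simp add: space_GM emeasure_GM_V)

lemma measure_GM_V: "measure GM V = 1"
  by (simp add: measure_def emeasure_GM_V)

lemma cont_measurable_GM:
  fixes \<phi> :: "'a \<Rightarrow> real"
  assumes "continuous_on V \<phi>" shows "\<phi> \<in> borel_measurable GM"
proof -
  have b: "\<phi> \<in> borel_measurable (restrict_space borel V)"
    by (rule borel_measurable_continuous_on_restrict[OF assms])
  have "sets (restrict_space borel V) \<subseteq> sets GM"
    unfolding sets_GM sets_restrict_space using borel_sub_hausdorff by blast
  then show ?thesis using b
    by (auto simp: measurable_def space_GM space_restrict_space)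
qed

lemma measure_cell_pos: assumes "set w \<subseteq> I" shows "Sw w ` V \<in> sets GM" "0 < measure GM (Sw w ` V)"
proof -
  have sub: "Sw w ` V \<subseteq> V" using Sw_in_V[OF assms] by blast
  then have "Sw w ` V = V \<inter> Sw w ` V" by blast
  then show s: "Sw w ` V \<in> sets GM" using cell_sets[of w] unfolding sets_GM sets_restrict_space by blast
  have "emeasure GM (Sw w ` V) \<noteq> 0"
    unfolding emeasure_GM[OF cell_sets sub] using emeasure_cell[OF assms] emeasure_V
    by (simp add: ennreal_divide_eq_0_iff)
  then show "0 < measure GM (Sw w ` V)"
    by (simp add: finite_measure.emeasure_eq_measure[OF finite_GM] zero_less_measure_iff)
qed

end

section \<open>Three solutions\<close>

lemma LBINT_deriv:
  fixes \<phi> :: "real \<Rightarrow> real"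
  assumes "continuous_on UNIV \<phi>"
  shows "((\<lambda>t. LBINT \<xi>=0..t. \<phi> \<xi>) has_real_derivative \<phi> t) (at t)"
proof -
  define b where "b = \<bar>t\<bar> + 1"
  have b: "-b < t" "t < b" "0 < b" by (auto simp: b_def)
  have "((\<lambda>u. LBINT y=ereal 0..ereal u. \<phi> y) has_vector_derivative \<phi> t) (at t within {-b..b})"
    by (rule interval_integral_FTC2) (use b assms continuous_on_subset in auto)
  then show ?thesis
    unfolding at_within_Icc_at[OF b(1,2)] has_real_derivative_iff_has_vector_derivative zero_ereal_def .
qed

lemma continuous_section:
  assumes "continuous_on (V \<times> UNIV) (\<lambda>(x, t). h x (t::real) :: real)" "x \<in> V"
  shows "continuous_on UNIV (h x)"
proof -
  have "continuous_on UNIV (\<lambda>t. (\<lambda>(x, t). h x t) (x, t))"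
    by (rule continuous_on_compose2[OF assms(1)]) (use assms(2) in \<open>auto intro!: continuous_intros\<close>)
  then show ?thesis by simp
qed

lemma abs_pow_subquadratic:
  assumes "0 \<le> \<alpha>" "\<alpha> < 2" "0 < \<kappa>"
  shows "\<exists>K\<ge>0. \<forall>t. abs_pow t \<alpha> \<le> \<kappa> * t\<^sup>2 + K"
proof -
  \<comment> \<open>Beyond this threshold \<open>\<bar>t\<bar> powr (2 - \<alpha>)\<close> is at
    least \<open>1 / \<kappa>\<close>.\<close>
  define T where "T = max 1 ((1 / \<kappa>) powr (1 / (2 - \<alpha>)))"
  have T: "1 \<le> T" by (simp add: T_def)
  have "abs_pow t \<alpha> \<le> \<kappa> * t\<^sup>2 + (T powr \<alpha> + 1)" for t
  proof (cases "\<alpha> = 0")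
    case True
    then show ?thesis using assms T by (simp add: abs_pow_def)
  next
    case a0: False
    show ?thesis
    proof (cases "\<bar>t\<bar> \<le> T")
      case True
      then have "\<bar>t\<bar> powr \<alpha> \<le> T powr \<alpha>" using assms by (intro powr_mono2) auto
      moreover have "0 \<le> \<kappa> * t\<^sup>2" using assms by simp
      ultimately show ?thesis using a0 by (simp add: abs_pow_def)
    next
      case False
      then have t: "0 < \<bar>t\<bar>" "T \<le> \<bar>t\<bar>" using T by auto
      have "1 / \<kappa> = ((1 / \<kappa>) powr (1 / (2 - \<alpha>))) powr (2 - \<alpha>)" using assms by (simp add: powr_powr)
      also have "\<dots> \<le> \<bar>t\<bar> powr (2 - \<alpha>)" using t assms by (intro powr_mono2) (auto simp: T_def)
      finally have "\<bar>t\<bar> powr \<alpha> * (1 / \<kappa>) \<le> \<bar>t\<bar> powr \<alpha> * \<bar>t\<bar> powr (2 - \<alpha>)" by (intro mult_left_mono) auto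
      also have "\<dots> = \<bar>t\<bar> powr 2" by (simp flip: powr_add)
      also have "\<dots> = t\<^sup>2" using t by (simp add: powr_numeral)
      finally have "\<bar>t\<bar> powr \<alpha> \<le> \<kappa> * t\<^sup>2" using assms by (simp add: field_simps)
      then show ?thesis using a0 by (simp add: abs_pow_def add_increasing2)
    qed
  qed
  then show ?thesis by (intro exI[of _ "T powr \<alpha> + 1"]) auto
qed

lemma abs_pow_superquadratic:
  assumes "2 < \<beta>" "0 \<le> M" "0 < \<kappa>"
  shows "\<exists>s>0. \<forall>t. \<bar>t\<bar> \<le> s \<longrightarrow> M * abs_pow t \<beta> \<le> \<kappa> * t\<^sup>2"
proof -
  \<comment> \<open>On this interval \<open>\<bar>t\<bar> powr (\<beta> - 2)\<close> is at most
    \<open>\<kappa> / (M + 1)\<close>; \<open>M + 1\<close> is positive also for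
    \<open>M = 0\<close>.\<close>
  define s where "s = (\<kappa> / (M + 1)) powr (1 / (\<beta> - 2))"
  have s: "0 < s" "s powr (\<beta> - 2) = \<kappa> / (M + 1)" using assms by (auto simp: s_def powr_powr)
  have "M * abs_pow t \<beta> \<le> \<kappa> * t\<^sup>2" if t: "\<bar>t\<bar> \<le> s" for t
  proof (cases "t = 0")
    case True
    then show ?thesis using assms by (simp add: abs_pow_def)
  next
    case False
    have "\<bar>t\<bar> powr \<beta> = \<bar>t\<bar> powr (2 + (\<beta> - 2))" by simp
    also have "\<dots> = \<bar>t\<bar> powr 2 * \<bar>t\<bar> powr (\<beta> - 2)" by (rule powr_add)
    also have "\<bar>t\<bar> powr 2 = t\<^sup>2" using False by (simp add: powr_numeral)
    finally have e: "abs_pow t \<beta> = t\<^sup>2 * \<bar>t\<bar> powr (\<beta> - 2)" using assms by (simp add: abs_pow_def)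
    have "\<bar>t\<bar> powr (\<beta> - 2) \<le> \<kappa> / (M + 1)" using t assms unfolding s(2)[symmetric] by (intro powr_mono2) auto
    then have "M * \<bar>t\<bar> powr (\<beta> - 2) \<le> M * (\<kappa> / (M + 1))" using assms by (intro mult_left_mono) auto
    also have "\<dots> \<le> \<kappa>" using assms by (simp add: field_simps)
    finally have "t\<^sup>2 * (M * \<bar>t\<bar> powr (\<beta> - 2)) \<le> t\<^sup>2 * \<kappa>" by (intro mult_left_mono) auto
    then show ?thesis unfolding e by (simp add: mult_ac)
  qed
  then show ?thesis using s by blast
qed

context simplex_gasket
begin

lemma EN_zero: "EN m (\<lambda>x. 0) v = 0"
  using EN_lin[of m 0 v 0 v v] by simp

lemma energy_space_gasket: "energy_space V GM H01 WI Kosc"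
proof (rule energy_space.intro)
  show "compact V" by (rule gasket_props)
  show "finite_measure GM" by (rule finite_GM)
  show "space GM = V" by (rule space_GM)
  show "measure GM V = 1" by (rule measure_GM_V)
  show "\<phi> \<in> borel_measurable GM" if "continuous_on V \<phi>" for \<phi> :: "'a \<Rightarrow> real" by (rule cont_measurable_GM[OF that])
  show "continuous_on V u" if "u \<in> H01" for u using that by (simp add: H01_iff)
  show "(\<lambda>x. 0) \<in> H01" by (auto simp: H01_iff EB_def EN_zero)
  show l: "lin a u b v \<in> H01" if "u \<in> H01" "v \<in> H01" for u v a b
    using that EB_lin[of u v a b] by (auto simp: H01_iff lin_def intro!: continuous_intros)
  show "WI (lin a u b v) w = a * WI u w + b * WI v w" if "u \<in> H01" "v \<in> H01" "w \<in> H01" for u v w a b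
    using that l[OF that(1,2), of a b] EE_lin[of u v w a b]
    by (simp add: WI_eq H01_EB) (simp add: lin_def algebra_simps)
  show "WI u v = WI v u" if "u \<in> H01" "v \<in> H01" for u v using that EE_sym by (simp add: WI_eq)
  show "0 \<le> WI u u" if "u \<in> H01" for u using that kappa(1) EE_nonneg by (simp add: WI_eq H01_EB)
  show "WI u u = WI v v" if "u \<in> H01" "v \<in> H01" "\<And>x. x \<in> V \<Longrightarrow> u x = v x" for u v
  proof -
    have "EN m u u = EN m v v" for m by (rule EN_cong) (use that in auto)
    then show ?thesis using that by (simp add: WI_eq EE_def)
  qed
  show "0 < Kosc" by (rule Kosc)
  show "\<bar>u x\<bar> \<le> Kosc * sqrt (WI u u)" if "u \<in> H01" "x \<in> V" for u x by (rule H01_sup[OF that])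
  show "\<exists>k u. strict_mono (k :: nat \<Rightarrow> nat) \<and> u \<in> H01 \<and> uniform_limit V (\<lambda>n. U (k n)) u sequentially \<and>
         (\<forall>b. (\<forall>\<^sub>F n in sequentially. WI (U (k n)) (U (k n)) \<le> b) \<longrightarrow> WI u u \<le> b)"
    if "\<And>n. U n \<in> H01" "\<And>n. WI (U n) (U n) \<le> B" for U B by (rule H01_compact[OF that])
qed

interpretation es: energy_space V GM H01 WI Kosc by (rule energy_space_gasket)

lemma primitive_problem:
  fixes h P :: "'a \<Rightarrow> real \<Rightarrow> real"
  assumes h: "continuous_on (V \<times> UNIV) (\<lambda>(x, t). h x t)" and P: "\<And>x t::real. x \<in> V \<Longrightarrow> P x t = (LBINT \<xi>=0..t. h x \<xi>)"
  shows "nonlinear_problem V GM H01 WI Kosc h P"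
proof (intro nonlinear_problem.intro nonlinear_problem_axioms.intro energy_space_gasket)
  show "(P x has_real_derivative h x t) (at t)" if x: "x \<in> V" for x t
  proof -
    have "P x = (\<lambda>t. LBINT \<xi>=0..t. h x \<xi>)" using P[OF x] by blast
    then show ?thesis using LBINT_deriv[OF continuous_section[OF h x]] by simp
  qed
  show "P x 0 = 0" if "x \<in> V" for x using P[OF that] by (simp add: zero_ereal_def)
qed (rule h)

lemma functional_subquadratic:
  assumes np: "nonlinear_problem V GM H01 WI Kosc f F"
    and a: "integrable GM a" "0 \<le> m" "0 \<le> \<alpha>" "\<alpha> < 2"
    and growth: "\<And>x t. x \<in> V \<Longrightarrow> F x t \<le> m * (a x + abs_pow t \<alpha>)" and \<kappa>: "0 < \<kappa>"
  shows "\<exists>K\<ge>0. \<forall>u\<in>H01. (\<integral>x. F x (u x) \<partial>GM) \<le> \<kappa> * (es.nrm u)\<^sup>2 + K"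
proof -
  interpret f: nonlinear_problem V GM H01 WI Kosc f F by (rule np)
  interpret fm: finite_measure GM by (rule finite_GM)
  \<comment> \<open>Compensates the square of the bound
    \<open>\<bar>u x\<bar> \<le> Kosc * es.nrm u\<close> and the factor \<open>m\<close>;
    \<open>m + 1\<close> is positive also for \<open>m = 0\<close>.\<close>
  define \<kappa>' where "\<kappa>' = \<kappa> / ((m + 1) * Kosc\<^sup>2)"
  have \<kappa>': "0 < \<kappa>'" using \<kappa> a Kosc(3) by (simp add: \<kappa>'_def)
  from abs_pow_subquadratic[OF a(3,4) \<kappa>'] obtain K where K: "0 \<le> K" "\<And>t. abs_pow t \<alpha> \<le> \<kappa>' * t\<^sup>2 + K" by blast
  have mk: "m * (\<kappa>' * Kosc\<^sup>2) \<le> \<kappa>"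
  proof -
    have e: "\<kappa>' * Kosc\<^sup>2 = \<kappa> / (m + 1)" using Kosc(3) by (simp add: \<kappa>'_def)
    show ?thesis unfolding e using a(2) \<kappa> by (simp add: field_simps)
  qed
  define K' where "K' = m * ((\<integral>x. a x \<partial>GM) + K)"
  have "(\<integral>x. F x (u x) \<partial>GM) \<le> \<kappa> * (es.nrm u)\<^sup>2 + \<bar>K'\<bar>" if u: "u \<in> H01" for u
  proof -
    define q where "q = \<kappa>' * (Kosc * es.nrm u)\<^sup>2 + K"
    have le: "F x (u x) \<le> m * (a x + q)" if x: "x \<in> V" for x
    proof -
      have "\<bar>u x\<bar>\<^sup>2 \<le> (Kosc * es.nrm u)\<^sup>2" by (intro power_mono es.sup_bound_nrm u x) simp
      then have "\<kappa>' * (u x)\<^sup>2 \<le> \<kappa>' * (Kosc * es.nrm u)\<^sup>2" using \<kappa>' by simp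
      then have "abs_pow (u x) \<alpha> \<le> q" using K(2)[of "u x"] by (simp add: q_def)
      then have "m * (a x + abs_pow (u x) \<alpha>) \<le> m * (a x + q)" using a(2) by (intro mult_left_mono) auto
      then show ?thesis using growth[OF x, of "u x"] by linarith
    qed
    have "(\<integral>x. F x (u x) \<partial>GM) \<le> (\<integral>x. m * (a x + q) \<partial>GM)"
    proof (rule integral_mono)
      show "integrable GM (\<lambda>x. F x (u x))" by (intro es.integrable_cont f.comp_cont es.H_cont u)
      show "integrable GM (\<lambda>x. m * (a x + q))" using a(1) by simp
    qed (use le space_GM in auto)
    also have "\<dots> = m * ((\<integral>x. a x \<partial>GM) + q)" using a(1) by (simp add: space_GM measure_GM_V)
    also have "\<dots> = m * (\<kappa>' * Kosc\<^sup>2) * (es.nrm u)\<^sup>2 + K'" by (simp add: q_def K'_def power_mult_distrib algebra_simps)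
    also have "\<dots> \<le> \<kappa> * (es.nrm u)\<^sup>2 + \<bar>K'\<bar>" using mk by (intro add_mono mult_right_mono) auto
    finally show ?thesis .
  qed
  then show ?thesis by (intro exI[of _ "\<bar>K'\<bar>"]) auto
qed

lemma functional_superquadratic:
  assumes np: "nonlinear_problem V GM H01 WI Kosc f F"
    and t0: "0 < t\<^sub>0" "0 \<le> M" "2 < \<beta>"
    and near: "\<And>x t. x \<in> V \<Longrightarrow> \<bar>t\<bar> \<le> t\<^sub>0 \<Longrightarrow> F x t \<le> M * abs_pow t \<beta>" and \<kappa>: "0 < \<kappa>"
  shows "\<exists>\<rho>>0. \<forall>u\<in>H01. es.nrm u \<le> \<rho> \<longrightarrow> (\<integral>x. F x (u x) \<partial>GM) \<le> \<kappa> * (es.nrm u)\<^sup>2"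
proof -
  interpret f: nonlinear_problem V GM H01 WI Kosc f F by (rule np)
  define \<kappa>' where "\<kappa>' = \<kappa> / Kosc\<^sup>2"
  have \<kappa>': "0 < \<kappa>'" using \<kappa> Kosc(3) by (simp add: \<kappa>'_def)
  from abs_pow_superquadratic[OF t0(3,2) \<kappa>'] obtain s where s: "0 < s" "\<And>t. \<bar>t\<bar> \<le> s \<Longrightarrow> M * abs_pow t \<beta> \<le> \<kappa>' * t\<^sup>2" by blast
  \<comment> \<open>On this ball no value exceeds \<open>s\<close> or \<open>t\<^sub>0\<close> in
    absolute value.\<close>
  define \<rho> where "\<rho> = min s t\<^sub>0 / Kosc"
  have "(\<integral>x. F x (u x) \<partial>GM) \<le> \<kappa> * (es.nrm u)\<^sup>2" if u: "u \<in> H01" "es.nrm u \<le> \<rho>" for u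
  proof (rule es.integral_le[OF f.comp_cont(2)[OF es.H_cont[OF u(1)]]])
    fix x assume x: "x \<in> V"
    have ux: "\<bar>u x\<bar> \<le> Kosc * es.nrm u" by (rule es.sup_bound_nrm[OF u(1) x])
    also have "\<dots> \<le> min s t\<^sub>0" using u(2) Kosc(3) by (simp add: \<rho>_def field_simps)
    finally have "\<bar>u x\<bar> \<le> s" "\<bar>u x\<bar> \<le> t\<^sub>0" by auto
    then have "F x (u x) \<le> \<kappa>' * (u x)\<^sup>2" using near[OF x] s(2) by (meson order_trans)
    also have "\<dots> \<le> \<kappa>' * (Kosc * es.nrm u)\<^sup>2"
      using power_mono[OF ux, of 2] \<kappa>' by simp
    also have "\<dots> = \<kappa> * (es.nrm u)\<^sup>2" using Kosc(3) by (simp add: \<kappa>'_def power_mult_distrib)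
    finally show "F x (u x) \<le> \<kappa> * (es.nrm u)\<^sup>2" .
  qed
  moreover have "0 < \<rho>" using s t0 Kosc(3) by (simp add: \<rho>_def)
  ultimately show ?thesis by blast
qed

text \<open>\<open>w\<close> is \<open>t\<^sub>1\<close> times a plateau function. Its values lie
  between 0 and \<open>t\<^sub>1\<close>, so \<open>F\<close> is nonnegative along \<open>w\<close>;
  on the plateau cell, of positive measure, it is at least the minimum of
  \<open>F x t\<^sub>1\<close> over \<open>V\<close>.\<close>

lemma functional_positive:
  assumes np: "nonlinear_problem V GM H01 WI Kosc f F"
    and sign: "\<And>x t. x \<in> V \<Longrightarrow> t \<in> closed_segment 0 t\<^sub>1 \<Longrightarrow> F x t\<^sub>1 > 0 \<and> F x t \<ge> 0"
  shows "\<exists>w\<in>H01. 0 < (\<integral>x. F x (w x) \<partial>GM)"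
proof -
  interpret f: nonlinear_problem V GM H01 WI Kosc f F by (rule np)
  interpret fm: finite_measure GM by (rule finite_GM)
  obtain \<phi> v where \<phi>: "\<phi> \<in> H01" "\<And>x. x \<in> V \<Longrightarrow> 0 \<le> \<phi> x \<and> \<phi> x \<le> 1"
    and v: "set v \<subseteq> I" "\<And>x. x \<in> Sw v ` V \<Longrightarrow> \<phi> x = 1" using plateau by blast
  define w where "w = lin t\<^sub>1 \<phi> 0 \<phi>"
  have w: "w \<in> H01" unfolding w_def by (rule es.H_lin[OF \<phi>(1) \<phi>(1)])
  have wx: "w x = t\<^sub>1 * \<phi> x" for x by (simp add: w_def lin_def)
  have "continuous_on V (\<lambda>x. F x t\<^sub>1)" using f.comp_cont(2)[of "\<lambda>_. t\<^sub>1"] by simp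
  then obtain x0 where x0: "x0 \<in> V" "\<And>y. y \<in> V \<Longrightarrow> F x0 t\<^sub>1 \<le> F y t\<^sub>1"
    using continuous_attains_inf[OF gasket_props(1,2)] by blast
  define c where "c = F x0 t\<^sub>1"
  have c: "0 < c" using sign[OF x0(1), of t\<^sub>1] by (simp add: c_def)
  note cell = measure_cell_pos[OF v(1)]
  have "0 < c * measure GM (Sw v ` V)" using c cell by simp
  also have "\<dots> = (\<integral>x. c * indicator (Sw v ` V) x \<partial>GM)" using cell(1) sets.sets_into_space[OF cell(1)]
    by (simp add: Int_absorb2)
  also have "\<dots> \<le> (\<integral>x. F x (w x) \<partial>GM)"
  proof (rule integral_mono)
    show "integrable GM (\<lambda>x. F x (w x))" by (intro es.integrable_cont f.comp_cont es.H_cont w)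
    show "integrable GM (\<lambda>x. c * indicator (Sw v ` V) x)"
      using cell(1) top.not_eq_extremum[THEN iffD1, OF fm.emeasure_finite, of "Sw v ` V"]
      by (intro integrable_mult_right integrable_real_indicator) (auto simp: infinity_ennreal_def)
    fix x assume "x \<in> space GM"
    then have x: "x \<in> V" by (simp add: space_GM)
    have "w x \<in> closed_segment 0 t\<^sub>1" using \<phi>(2)[OF x] by (auto simp: wx in_segment mult.commute)
    then have "0 \<le> F x (w x)" using sign[OF x] by blast
    moreover have "c \<le> F x (w x)" if "x \<in> Sw v ` V" using x0(2)[OF x] v(2)[OF that] by (simp add: wx c_def)
    ultimately show "c * indicator (Sw v ` V) x \<le> F x (w x)" by (auto simp: indicator_def)
  qed
  finally show ?thesis using w by blast
qed

text \<open>The small radius \<open>\<rho>\<close>, the level \<open>L\<close>, the radius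
  \<open>B\<close> and the truncation height \<open>T\<close> are fixed from \<open>f\<close>,
  \<open>w\<close>, \<open>l\<^sub>1\<close> and \<open>l\<^sub>2\<close>; only
  \<open>\<delta>\<close> sees \<open>g\<close>.\<close>

theorem three_solutions:
  assumes np: "nonlinear_problem V GM H01 WI Kosc f F"
    and sub: "\<And>\<kappa>. 0 < \<kappa> \<Longrightarrow> \<exists>K\<ge>0. \<forall>u\<in>H01. (\<integral>x. F x (u x) \<partial>GM) \<le> \<kappa> * (es.nrm u)\<^sup>2 + K"
    and super: "\<And>\<kappa>. 0 < \<kappa> \<Longrightarrow> \<exists>\<rho>>0. \<forall>u\<in>H01. es.nrm u \<le> \<rho> \<longrightarrow> (\<integral>x. F x (u x) \<partial>GM) \<le> \<kappa> * (es.nrm u)\<^sup>2"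
    and w: "w \<in> H01" "0 < (\<integral>x. F x (w x) \<partial>GM)"
    and l: "(es.nrm w)\<^sup>2 / 2 / (\<integral>x. F x (w x) \<partial>GM) < l\<^sub>1" "l\<^sub>1 \<le> l\<^sub>2"
  shows "\<exists>r>0. \<forall>l\<in>{l\<^sub>1..l\<^sub>2}. \<forall>g. continuous_on (V \<times> UNIV) (\<lambda>(x, t). g x t) \<longrightarrow>
     (\<exists>\<delta>>0. \<forall>\<eta>\<in>{0..\<delta>}. \<exists>u\<^sub>1 u\<^sub>2 u\<^sub>3.
        (\<forall>u\<in>{u\<^sub>1, u\<^sub>2, u\<^sub>3}. gasket_solution N p (\<lambda>x t. l * f x t + \<eta> * g x t) u \<and> gasket_norm N p u < r) \<and>
        (\<exists>x\<in>V. u\<^sub>1 x \<noteq> u\<^sub>2 x) \<and> (\<exists>x\<in>V. u\<^sub>1 x \<noteq> u\<^sub>3 x) \<and> (\<exists>x\<in>V. u\<^sub>2 x \<noteq> u\<^sub>3 x))"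
proof -
  interpret f: nonlinear_problem V GM H01 WI Kosc f F by (rule np)
  define JF where "JF u = (\<integral>x. F x (u x) \<partial>GM)" for u
  define n where "n = es.nrm w"
  define C where "C = Kosc"
  have C: "0 < C" using Kosc(3) by (simp add: C_def)
  have n0: "0 \<le> n" using w by (simp add: n_def)
  have JFw: "0 < JF w" using w by (simp add: JF_def)
  have "0 \<le> n\<^sup>2 / 2 / JF w" using JFw by simp
  then have l0: "0 < l\<^sub>1" "0 < l\<^sub>2" using l by (auto simp: JF_def n_def)
  \<comment> \<open>The depth of the unperturbed functional at \<open>w\<close> for parameter
    \<open>l\<^sub>1\<close>; a larger parameter only deepens it.\<close>
  define \<sigma> where "\<sigma> = l\<^sub>1 * JF w - n\<^sup>2 / 2"
  have \<sigma>: "0 < \<sigma>" using l(1) JFw by (simp add: \<sigma>_def JF_def n_def field_simps)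
  \<comment> \<open>With this constant half of \<open>(es.nrm u)\<^sup>2 / 2\<close> survives on the
    small ball for every parameter up to \<open>l\<^sub>2\<close>.\<close>
  obtain \<rho> where \<rho>: "0 < \<rho>" and \<rho>': "\<And>u. u \<in> H01 \<Longrightarrow> es.nrm u \<le> \<rho> \<Longrightarrow> JF u \<le> 1 / (4 * l\<^sub>2) * (es.nrm u)\<^sup>2"
    using super[of "1 / (4 * l\<^sub>2)"] l0 unfolding JF_def by auto
  obtain K where K: "0 \<le> K" "\<And>u. u \<in> H01 \<Longrightarrow> JF u \<le> 1 / (8 * l\<^sub>2) * (es.nrm u)\<^sup>2 + K"
    using sub[of "1 / (8 * l\<^sub>2)"] l0 unfolding JF_def by auto
  have near: "l * JF u \<le> (es.nrm u)\<^sup>2 / 4" if "u \<in> H01" "es.nrm u \<le> \<rho>" "l\<^sub>1 \<le> l" "l \<le> l\<^sub>2" for u l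
  proof -
    have "l * JF u \<le> l * (1 / (4 * l\<^sub>2) * (es.nrm u)\<^sup>2)" using \<rho>'[OF that(1,2)] that l0 by (intro mult_left_mono) auto
    also have "\<dots> \<le> l\<^sub>2 * (1 / (4 * l\<^sub>2) * (es.nrm u)\<^sup>2)" using that l0 by (intro mult_right_mono) auto
    finally show ?thesis using l0 by simp
  qed
  have far: "l * JF u \<le> (es.nrm u)\<^sup>2 / 8 + l\<^sub>2 * K" if "u \<in> H01" "l\<^sub>1 \<le> l" "l \<le> l\<^sub>2" for u l
  proof -
    have "l * JF u \<le> l * (1 / (8 * l\<^sub>2) * (es.nrm u)\<^sup>2 + K)" using K(2)[OF that(1)] that l0 by (intro mult_left_mono) auto
    also have "\<dots> \<le> l\<^sub>2 * (1 / (8 * l\<^sub>2) * (es.nrm u)\<^sup>2 + K)" using that l0 K by (intro mult_right_mono) auto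
    finally show ?thesis using l0 by (simp add: distrib_left)
  qed
  \<comment> \<open>In the small ball the unperturbed functional is nonnegative, so \<open>w\<close>
    lies outside.\<close>
  have nw: "\<rho> < n"
  proof (rule ccontr)
    assume "\<not> \<rho> < n"
    then have "l\<^sub>1 * JF w \<le> n\<^sup>2 / 4" using near[OF w(1) _ order_refl l(2)] by (simp add: n_def)
    then show False using \<sigma> zero_le_power2[of n] unfolding \<sigma>_def by linarith
  qed
  obtain Q where Q: "0 < Q" "\<And>x t. x \<in> V \<Longrightarrow> \<bar>t\<bar> \<le> C * n \<Longrightarrow> \<bar>f x t\<bar> \<le> Q"
    by (rule f.h_bounded[of "C * n"]) (rule that)
  define Bw where "Bw = Q * (C * n)"
  have JFt: "\<bar>JF (\<lambda>x. t * w x)\<bar> \<le> Bw" if t: "0 \<le> t" "t \<le> 1" for t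
  proof -
    have wb: "\<bar>t * w x\<bar> \<le> C * n" if x: "x \<in> V" for x
    proof -
      have "\<bar>t * w x\<bar> \<le> 1 * \<bar>w x\<bar>" using t by (simp add: abs_mult mult_left_le_one_le)
      also have "\<dots> \<le> C * n" using es.sup_bound_nrm[OF w(1) x] by (simp add: C_def n_def)
      finally show ?thesis .
    qed
    have "continuous_on V (\<lambda>x. t * w x)" by (intro continuous_intros es.H_cont w)
    then show ?thesis unfolding JF_def
    proof (intro es.integral_bound f.comp_cont)
      fix x assume x: "x \<in> V"
      have "\<bar>F x (t * w x) - F x 0 - 0 * (t * w x - 0)\<bar> \<le> Q * \<bar>t * w x - 0\<bar>"
        by (rule f.P_lipschitz[of "C * n"]) (use Q(2)[OF x] x wb C n0 in auto)
      also have "\<dots> \<le> Bw" unfolding Bw_def using wb[OF x] Q(1) by simp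
      finally show "\<bar>F x (t * w x)\<bar> \<le> Bw" using f.P_zero[OF x] by simp
    qed
  qed
  \<comment> \<open>Bounds the functional on the segment from 0 to \<open>w\<close>;
    \<open>C * n\<close> is the allowance for the perturbation.\<close>
  define L where "L = n\<^sup>2 / 2 + l\<^sub>2 * Bw + C * n"
  have Bw0: "0 \<le> Bw" using Q C n0 by (simp add: Bw_def)
  \<comment> \<open>From coercivity: \<open>F\<close> and the perturbation each consume
    \<open>\<nu>\<^sup>2 / 8\<close> of \<open>\<nu>\<^sup>2 / 2\<close>, where \<open>\<nu>\<close>
    is the norm of \<open>u\<close>, and \<open>\<nu>\<^sup>2 / 4\<close> remains.\<close>
  define B where "B = sqrt (4 * (L + l\<^sub>2 * K + 2 * C\<^sup>2))"
  have L0: "0 \<le> L" using l0 Bw0 C n0 by (simp add: L_def)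
  have B0: "0 \<le> B" unfolding B_def using L0 l0 K by simp
  \<comment> \<open>Functions of norm at most \<open>B + 1\<close> take values within
    \<open>T\<close>, so the truncation of \<open>g\<close> is invisible to the solutions
    found.\<close>
  define T where "T = C * (B + 1)"
  have T0: "0 \<le> T" using C B0 by (simp add: T_def)
  show ?thesis
  proof (rule exI[of _ "B + 1"], intro conjI ballI allI impI)
    show "0 < B + 1" using B0 by simp
    fix l and g :: "'a \<Rightarrow> real \<Rightarrow> real"
    assume lr: "l \<in> {l\<^sub>1..l\<^sub>2}" and g: "continuous_on (V \<times> UNIV) (\<lambda>(x, t). g x t)"
    have ll: "l\<^sub>1 \<le> l" "l \<le> l\<^sub>2" "0 < l" using lr l0 by auto
    define tr where "tr t = max (-T) (min T t)" for t
    define gt where "gt x t = g x (tr t)" for x t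
    have gtc: "continuous_on (V \<times> UNIV) (\<lambda>(x, t). gt x t)"
    proof -
      have "continuous_on (V \<times> UNIV) (\<lambda>z. (\<lambda>(x, t). g x t) (fst z, tr (snd z)))"
        unfolding tr_def by (rule continuous_on_compose2[OF g]) (auto intro!: continuous_intros)
      then show ?thesis by (simp add: gt_def case_prod_unfold)
    qed
    define G where "G x t = (LBINT \<xi>=0..t. gt x \<xi>)" for x and t :: real
    interpret g: nonlinear_problem V GM H01 WI Kosc gt G
      by (rule primitive_problem[OF gtc]) (simp add: G_def)
    obtain S where S: "0 < S" "\<And>x t. x \<in> V \<Longrightarrow> \<bar>t\<bar> \<le> T \<Longrightarrow> \<bar>gt x t\<bar> \<le> S"
      by (rule g.h_bounded[of T]) (rule that)
    have gS: "\<bar>gt x t\<bar> \<le> S" if "x \<in> V" for x t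
    proof -
      have "gt x t = gt x (tr t)" using T0 by (simp add: gt_def tr_def)
      moreover have "\<bar>tr t\<bar> \<le> T" using T0 by (auto simp: tr_def)
      ultimately show ?thesis using S(2)[OF that] by simp
    qed
    have JG: "\<bar>\<integral>x. G x (u x) \<partial>GM\<bar> \<le> S * (C * es.nrm u)" if u: "u \<in> H01" for u
    proof (intro es.integral_bound g.comp_cont es.H_cont u)
      fix x assume x: "x \<in> V"
      have "\<bar>G x (u x) - G x 0 - 0 * (u x - 0)\<bar> \<le> S * \<bar>u x - 0\<bar>"
        by (rule g.P_lipschitz[of "\<bar>u x\<bar>"]) (use gS[OF x] x in auto)
      also have "\<dots> \<le> S * (C * es.nrm u)" using es.sup_bound_nrm[OF u x] S(1) by (simp add: C_def)
      finally show "\<bar>G x (u x)\<bar> \<le> S * (C * es.nrm u)" using g.P_zero[OF x] by simp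
    qed
    \<comment> \<open>Collects the three factors of \<open>\<eta>\<close> that have to be small: for
      coercivity, on the small ball, and at \<open>w\<close>.\<close>
    define X where "X = S * (1 + C * \<rho> + C * n)"
    \<comment> \<open>The allowances: 1 for coercivity, half of the barrier
      \<open>\<rho>\<^sup>2 / 4\<close>, and a quarter of the depth \<open>\<sigma>\<close>.\<close>
    define Y where "Y = min 1 (min (\<rho>\<^sup>2 / 8) (\<sigma> / 4))"
    have X: "0 < X" using S C \<rho> n0 by (simp add: X_def add_pos_nonneg)
    have Y: "0 < Y" using \<rho> \<sigma> by (simp add: Y_def)
    show "\<exists>\<delta>>0. \<forall>\<eta>\<in>{0..\<delta>}. \<exists>u\<^sub>1 u\<^sub>2 u\<^sub>3.
        (\<forall>u\<in>{u\<^sub>1, u\<^sub>2, u\<^sub>3}. gasket_solution N p (\<lambda>x t. l * f x t + \<eta> * g x t) u \<and> gasket_norm N p u < B + 1) \<and>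
        (\<exists>x\<in>V. u\<^sub>1 x \<noteq> u\<^sub>2 x) \<and> (\<exists>x\<in>V. u\<^sub>1 x \<noteq> u\<^sub>3 x) \<and> (\<exists>x\<in>V. u\<^sub>2 x \<noteq> u\<^sub>3 x)"
    proof (intro exI[of _ "Y / X"] conjI ballI)
      show "0 < Y / X" using X Y by simp
      fix \<eta> assume \<eta>: "\<eta> \<in> {0..Y / X}"
      then have \<eta>0: "0 \<le> \<eta>" and \<eta>X: "\<eta> * X \<le> Y" using X by (auto simp: field_simps)
      have \<eta>S: "\<eta> * S * (C * \<rho>) \<le> Y" "\<eta> * S * (C * n) \<le> Y" "\<eta> * S \<le> Y"
      proof -
        have nn: "0 \<le> \<eta> * S" "0 \<le> \<eta> * S * (C * \<rho>)" "0 \<le> \<eta> * S * (C * n)" using \<eta>0 S C \<rho> n0 by auto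
        have "\<eta> * X = \<eta> * S + \<eta> * S * (C * \<rho>) + \<eta> * S * (C * n)" by (simp add: X_def algebra_simps)
        then show "\<eta> * S * (C * \<rho>) \<le> Y" "\<eta> * S * (C * n) \<le> Y" "\<eta> * S \<le> Y" using nn \<eta>X by linarith+
      qed
      have Yle: "Y \<le> 1" "Y \<le> \<rho>\<^sup>2 / 8" "Y \<le> \<sigma> / 4" by (auto simp: Y_def)
      define h where "h x t = l * f x t + \<eta> * gt x t" for x t
      define P where "P x t = l * F x t + \<eta> * G x t" for x t
      interpret h: nonlinear_problem V GM H01 WI Kosc h P
      proof
        show "continuous_on (V \<times> UNIV) (\<lambda>(x, t). h x t)"
          using f.h_cont g.h_cont unfolding h_def case_prod_unfold by (intro continuous_intros)
        show "(P x has_real_derivative h x t) (at t)" if "x \<in> V" for x t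
          unfolding P_def h_def by (intro DERIV_add DERIV_cmult f.P_deriv g.P_deriv that)
        show "P x 0 = 0" if "x \<in> V" for x using f.P_zero[OF that] g.P_zero[OF that] by (simp add: P_def)
      qed
      have E: "h.E u = (es.nrm u)\<^sup>2 / 2 - l * JF u - \<eta> * (\<integral>x. G x (u x) \<partial>GM)" if u: "u \<in> H01" for u
      proof -
        have i: "integrable GM (\<lambda>x. F x (u x))" "integrable GM (\<lambda>x. G x (u x))"
          by (intro es.integrable_cont f.comp_cont g.comp_cont es.H_cont u)+
        show ?thesis unfolding h.E_def h.J_def P_def JF_def using i by (simp add: es.nrm_sq u)
      qed
      have \<eta>JG: "\<bar>\<eta> * (\<integral>x. G x (u x) \<partial>GM)\<bar> \<le> \<eta> * S * (C * es.nrm u)" if u: "u \<in> H01" for u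
        using mult_left_mono[OF JG[OF u] \<eta>0] \<eta>0 by (simp add: abs_mult mult.assoc)
      have pert: "\<bar>\<eta> * (\<integral>x. G x (u x) \<partial>GM)\<bar> \<le> \<eta> * S * (C * b)" if u: "u \<in> H01" "es.nrm u \<le> b" for u b
      proof -
        have "\<eta> * S * (C * es.nrm u) \<le> \<eta> * S * (C * b)" using \<eta>0 S C u(2) by (intro mult_left_mono) auto
        then show ?thesis using \<eta>JG[OF u(1)] by linarith
      qed
      have three: "\<exists>u\<^sub>1 u\<^sub>2 u\<^sub>3. (\<forall>u\<in>{u\<^sub>1, u\<^sub>2, u\<^sub>3}. h.critical u \<and> es.nrm u \<le> B) \<and>
        (\<exists>x\<in>V. u\<^sub>1 x \<noteq> u\<^sub>2 x) \<and> (\<exists>x\<in>V. u\<^sub>1 x \<noteq> u\<^sub>3 x) \<and> (\<exists>x\<in>V. u\<^sub>2 x \<noteq> u\<^sub>3 x)"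
      proof (rule h.three_critical_points)
        show "w \<in> H01" by (rule w)
        show "0 < \<rho>" by (rule \<rho>)
        show "\<rho> < es.nrm w" using nw by (simp add: n_def)
        show "0 < \<rho>\<^sup>2 / 8" using \<rho> by simp
        show "\<rho>\<^sup>2 / 8 \<le> h.E u" if u: "u \<in> H01" "es.nrm u = \<rho>" for u
          using near[OF u(1) _ ll(1,2)] pert[OF u(1), of \<rho>] u(2) \<eta>S(1) Yle(2) unfolding E[OF u(1)] by simp
        show "- (\<sigma> / 4) \<le> h.E u" if u: "u \<in> H01" "es.nrm u \<le> \<rho>" for u
        proof -
          have "0 \<le> (es.nrm u)\<^sup>2" by simp
          then show ?thesis using near[OF u ll(1,2)] pert[OF u] \<eta>S(1) Yle(3) unfolding E[OF u(1)] by linarith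
        qed
        \<comment> \<open>The value is at most \<open>- \<sigma> + \<sigma> / 4\<close>, which is
          below the bound \<open>- (\<sigma> / 4)\<close> valid on the small ball.\<close>
        show "h.E w < - (\<sigma> / 4)"
        proof -
          have "l\<^sub>1 * JF w \<le> l * JF w" using ll JFw by (intro mult_right_mono) auto
          then have "\<sigma> \<le> l * JF w - n\<^sup>2 / 2" by (simp add: \<sigma>_def)
          moreover have "\<bar>\<eta> * (\<integral>x. G x (w x) \<partial>GM)\<bar> \<le> \<sigma> / 4"
            using pert[OF w(1) order_refl] \<eta>S(2) Yle(3) by (simp add: n_def)
          ultimately show ?thesis using \<sigma> unfolding E[OF w(1)] n_def[symmetric] by linarith
        qed
        show "h.E (\<lambda>x. t * w x) \<le> L" if t: "0 \<le> t" "t \<le> 1" for t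
        proof -
          have tw: "(\<lambda>x. t * w x) = lin t w 0 w" by (simp add: lin_def)
          have twH: "(\<lambda>x. t * w x) \<in> H01" unfolding tw by (rule es.H_lin[OF w(1) w(1)])
          have "es.nrm (\<lambda>x. t * w x) \<le> t * n"
            using es.nrm_lin[OF w(1) w(1), of t 0] t unfolding tw by (simp add: n_def)
          also have "\<dots> \<le> n" using t n0 by (simp add: mult_left_le_one_le)
          finally have nt: "es.nrm (\<lambda>x. t * w x) \<le> n" .
          have "(es.nrm (\<lambda>x. t * w x))\<^sup>2 \<le> n\<^sup>2" using nt es.nrm_nonneg[OF twH] by (rule power_mono)
          moreover have "- (l * JF (\<lambda>x. t * w x)) \<le> l\<^sub>2 * Bw"
          proof -
            have "- (l * JF (\<lambda>x. t * w x)) \<le> l * \<bar>JF (\<lambda>x. t * w x)\<bar>" 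
              using mult_left_mono[of "- JF (\<lambda>x. t * w x)" "\<bar>JF (\<lambda>x. t * w x)\<bar>" l] ll(3) by simp
            also have "\<dots> \<le> l\<^sub>2 * Bw" using JFt[OF t] ll l0 by (intro mult_mono) auto
            finally show ?thesis .
          qed
          moreover have "\<eta> * S * (C * n) \<le> C * n"
            using \<eta>S(3) Yle(1) C n0 by (intro mult_left_le_one_le) (use \<eta>0 S in auto)
          ultimately show ?thesis using pert[OF twH nt] unfolding E[OF twH] L_def by linarith
        qed
        show "es.nrm u \<le> B" if u: "u \<in> H01" "h.E u \<le> L" for u
        proof -
          define \<nu> where "\<nu> = es.nrm u"
          have \<nu>0: "0 \<le> \<nu>" using u by (simp add: \<nu>_def)
          have "\<eta> * (\<integral>x. G x (u x) \<partial>GM) \<le> \<eta> * S * (C * \<nu>)"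
            using pert[OF u(1) order_refl] unfolding \<nu>_def by (rule abs_le_D1)
          also have "\<dots> \<le> C * \<nu>"
            using \<eta>S(3) Yle(1) C \<nu>0 by (intro mult_left_le_one_le) (use \<eta>0 S in auto)
          also have "C * \<nu> \<le> \<nu>\<^sup>2 / 8 + 2 * C\<^sup>2"
          proof -
            have "0 \<le> (\<nu> - 4 * C)\<^sup>2" by simp
            then show ?thesis by (simp add: power2_eq_square algebra_simps)
          qed
          finally have "\<eta> * (\<integral>x. G x (u x) \<partial>GM) \<le> \<nu>\<^sup>2 / 8 + 2 * C\<^sup>2" .
          then have "\<nu>\<^sup>2 / 4 \<le> L + l\<^sub>2 * K + 2 * C\<^sup>2"
            using far[OF u(1) ll(1,2)] u(2) unfolding E[OF u(1)] \<nu>_def[symmetric] by linarith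
          then have "\<nu>\<^sup>2 \<le> 4 * (L + l\<^sub>2 * K + 2 * C\<^sup>2)" by simp
          then show ?thesis unfolding B_def \<nu>_def[symmetric] by (rule real_le_rsqrt)
        qed
      qed
      have sol: "gasket_solution N p (\<lambda>x t. l * f x t + \<eta> * g x t) u \<and> gasket_norm N p u < B + 1"
        if u: "h.critical u" "es.nrm u \<le> B" for u
      proof -
        have uH: "u \<in> H01" using u(1) by (simp add: h.critical_def)
        have ux: "gt x (u x) = g x (u x)" if "x \<in> V" for x
        proof -
          have "\<bar>u x\<bar> \<le> C * es.nrm u" using es.sup_bound_nrm[OF uH that] by (simp add: C_def)
          also have "\<dots> \<le> T" unfolding T_def using u(2) C by (intro mult_left_mono) auto
          finally have "tr (u x) = u x" by (auto simp: tr_def abs_le_iff)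
          then show ?thesis by (simp add: gt_def)
        qed
        have "WI u v = (\<integral>x. (l * f x (u x) + \<eta> * g x (u x)) * v x \<partial>GM)" if v: "v \<in> H01" for v
        proof -
          have "WI u v = (\<integral>x. h x (u x) * v x \<partial>GM)" using u(1) v by (simp add: h.critical_def)
          also have "\<dots> = (\<integral>x. (l * f x (u x) + \<eta> * g x (u x)) * v x \<partial>GM)"
            by (rule Bochner_Integration.integral_cong) (simp_all add: h_def ux space_GM)
          finally show ?thesis .
        qed
        moreover have "gasket_norm N p u < B + 1" using u(2) norm_eq[OF uH] by (simp add: es.nrm_def)
        ultimately show ?thesis using uH by (simp add: gasket_solution_def)
      qed
      from three obtain u\<^sub>1 u\<^sub>2 u\<^sub>3 where u: "\<forall>u\<in>{u\<^sub>1, u\<^sub>2, u\<^sub>3}. h.critical u \<and> es.nrm u \<le> B"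
        and d: "\<exists>x\<in>V. u\<^sub>1 x \<noteq> u\<^sub>2 x" "\<exists>x\<in>V. u\<^sub>1 x \<noteq> u\<^sub>3 x" "\<exists>x\<in>V. u\<^sub>2 x \<noteq> u\<^sub>3 x" by (elim exE conjE)
      show "\<exists>u\<^sub>1 u\<^sub>2 u\<^sub>3.
        (\<forall>u\<in>{u\<^sub>1, u\<^sub>2, u\<^sub>3}. gasket_solution N p (\<lambda>x t. l * f x t + \<eta> * g x t) u \<and> gasket_norm N p u < B + 1) \<and>
        (\<exists>x\<in>V. u\<^sub>1 x \<noteq> u\<^sub>2 x) \<and> (\<exists>x\<in>V. u\<^sub>1 x \<noteq> u\<^sub>3 x) \<and> (\<exists>x\<in>V. u\<^sub>2 x \<noteq> u\<^sub>3 x)"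
        by (intro exI[of _ u\<^sub>1] exI[of _ u\<^sub>2] exI[of _ u\<^sub>3] conjI d) (use u sol in blast)
    qed
  qed
qed

end

theorem theorem5p1:
  fixes N :: nat
    and p :: "nat \<Rightarrow> real ^ 'n"
    and V :: "(real ^ 'n) set"
    and \<mu> :: "(real ^ 'n) measure"
    and f F :: "real ^ 'n \<Rightarrow> real \<Rightarrow> real"
  assumes N: "N \<ge> 2"
    and dim: "CARD('n) = N - 1"
    and p: "\<forall>i\<in>{1..N}. \<forall>j\<in>{1..N}. i \<noteq> j \<longrightarrow> norm (p i - p j) = 1"
    and V: "V = gasket N p"
    and \<mu>: "\<mu> = gasket_measure N p"
    and f: "continuous_on (V \<times> UNIV) (\<lambda>(x, t). f x t)"
    and F: "\<forall>x\<in>V. \<forall>t. F x t = (LBINT \<xi>=0..t. f x \<xi>)"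
    and growth: "\<exists>\<alpha> a m. 0 \<le> \<alpha> \<and> \<alpha> < 2 \<and> integrable \<mu> a \<and> 0 \<le> m \<and>
                   (\<forall>x\<in>V. \<forall>t. F x t \<le> m * (a x + abs_pow t \<alpha>))"
    and near_zero: "\<exists>t\<^sub>0 M \<beta>. 0 < t\<^sub>0 \<and> 0 \<le> M \<and> 2 < \<beta> \<and>
                   (\<forall>x\<in>V. \<forall>t\<in>{-t\<^sub>0..t\<^sub>0}. F x t \<le> M * abs_pow t \<beta>)"
    and sign: "\<exists>t\<^sub>1. t\<^sub>1 \<noteq> 0 \<and> (\<forall>x\<in>V. \<forall>t\<in>closed_segment 0 t\<^sub>1. F x t\<^sub>1 > 0 \<and> F x t \<ge> 0)"
  shows "\<exists>\<Lambda>\<ge>0. \<forall>l\<^sub>1 l\<^sub>2. \<Lambda> < l\<^sub>1 \<and> l\<^sub>1 \<le> l\<^sub>2 \<longrightarrow>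
           (\<exists>r>0. \<forall>l\<in>{l\<^sub>1..l\<^sub>2}. \<forall>g :: real ^ 'n \<Rightarrow> real \<Rightarrow> real.
              continuous_on (V \<times> UNIV) (\<lambda>(x, t). g x t) \<longrightarrow>
              (\<exists>\<delta>>0. \<forall>\<eta>\<in>{0..\<delta>}. \<exists>u\<^sub>1 u\<^sub>2 u\<^sub>3.
                 (\<forall>u\<in>{u\<^sub>1, u\<^sub>2, u\<^sub>3}.
                    gasket_solution N p (\<lambda>x t. l * f x t + \<eta> * g x t) u \<and>
                    gasket_norm N p u < r) \<and>
                 (\<exists>x\<in>V. u\<^sub>1 x \<noteq> u\<^sub>2 x) \<and> (\<exists>x\<in>V. u\<^sub>1 x \<noteq> u\<^sub>3 x) \<and> (\<exists>x\<in>V. u\<^sub>2 x \<noteq> u\<^sub>3 x)))"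
proof -
  interpret simplex_gasket N p
    by unfold_locales (use N p in auto)
  interpret es: energy_space "gasket N p" "gasket_measure N p" "gasket_H01 N p" "gasket_inner N p" Kosc
    by (rule energy_space_gasket)
  have np: "nonlinear_problem (gasket N p) (gasket_measure N p) (gasket_H01 N p) (gasket_inner N p) Kosc f F"
    using f F unfolding V by (intro primitive_problem) auto
  obtain \<alpha> a m where a: "0 \<le> \<alpha>" "\<alpha> < 2" "integrable (gasket_measure N p) a" "0 \<le> m"
    and gr: "\<And>x t. x \<in> gasket N p \<Longrightarrow> F x t \<le> m * (a x + abs_pow t \<alpha>)"
    using growth unfolding V \<mu> by auto
  obtain t\<^sub>0 M \<beta> where t0: "0 < t\<^sub>0" "0 \<le> M" "2 < \<beta>"
    and nz: "\<And>x t. x \<in> gasket N p \<Longrightarrow> \<bar>t\<bar> \<le> t\<^sub>0 \<Longrightarrow> F x t \<le> M * abs_pow t \<beta>"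
    using near_zero unfolding V by (auto simp: abs_le_iff)
  obtain t\<^sub>1 where sg: "\<And>x t. x \<in> gasket N p \<Longrightarrow> t \<in> closed_segment 0 t\<^sub>1 \<Longrightarrow> F x t\<^sub>1 > 0 \<and> F x t \<ge> 0"
    using sign unfolding V by blast
  obtain w where w: "w \<in> gasket_H01 N p" "0 < (\<integral>x. F x (w x) \<partial>gasket_measure N p)"
    using functional_positive[OF np sg] by blast
  \<comment> \<open>For parameters above this value the unperturbed functional is negative at
    \<open>w\<close>.\<close>
  define \<Lambda> where "\<Lambda> = (es.nrm w)\<^sup>2 / 2 / (\<integral>x. F x (w x) \<partial>gasket_measure N p)"
  have "0 \<le> \<Lambda>" using w by (simp add: \<Lambda>_def)
  moreover note three_solutions[OF np functional_subquadratic[OF np a(3,4,1,2) gr]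
      functional_superquadratic[OF np t0 nz] w, folded \<Lambda>_def]
  ultimately show ?thesis unfolding V by blast
qed

end
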